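(* For every Markoff number $m$, the number $\dfrac{2m}{\sqrt{9m^2-4}+3m}$ is a limit point of $\mathcal{Z}\cap(\tfrac13,\infty)$. Conversely, every limit point of $\mathcal{Z}$ that is larger than $\tfrac13$ is of the form $\dfrac{2m}{\sqrt{9m^2-4}+3m}$ for some Markoff number $m$.
   Context: For a rational number $a/b$ in lowest terms with $b\ge 2$, set $\mathcal{Z}(a/b)=\min_{q\in\mathbb{N},\,0<q<b} q\,\|qa/b\|$, where $\|x\|$ denotes the distance from $x$ to the nearest integer. The $\mathcal{Z}$-spectrum is the set $\mathcal{Z}=\{\mathcal{Z}(a/b): a/b\in\mathbb{Q}\}$; equivalently it is the set of values $\inf_{(x,y)\in\Lambda,\,xy\neq0}|xy|$ as $\Lambda$ ranges over unimodular lattices of $\mathbb{R}^2$ contained in $\sqrt{d}\,\mathbb{Q}^2$ for some positive rational $d$. A Markoff number is a positive integer that occurs as a coordinate of a positive integer solution of $x^2+y^2+z^2=3xyz$. *)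

theory Defs
  imports "HOL-Analysis.Analysis"
begin

definition dist_int :: "real \<Rightarrow> real" where
  "dist_int x = \<bar>x - of_int (round x)\<bar>"

definition Zval :: "rat \<Rightarrow> real" where
  "Zval r = (case quotient_of r of (a, b) \<Rightarrow>
      Min ((\<lambda>q::int. of_int q * dist_int (of_int q * of_int a / of_int b)) ` {0<..<b}))"

definition Z_spectrum :: "real set" where
  "Z_spectrum = {Zval r | r. snd (quotient_of r) \<ge> 2}"

definition markoff_triple :: "nat \<Rightarrow> nat \<Rightarrow> nat \<Rightarrow> bool" where
  "markoff_triple x y z \<longleftrightarrow> x > 0 \<and> y > 0 \<and> z > 0 \<and> x^2 + y^2 + z^2 = 3 * x * y * z"

definition markoff_number :: "nat \<Rightarrow> bool" where
  "markoff_number m \<longleftrightarrow> (\<exists>x y z. markoff_triple x y z \<and> (m = x \<or> m = y \<or> m = z))"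

end

theory Submission
  imports Defs
begin

text \<open>
  The constant of \<open>a/b\<close> is the least nonzero absolute value of the indefinite form \<open>x (a x - b y) / b\<close> of
  discriminant 1 on integer vectors.  Its geodesic joins two cusps of the modular torus, and the values
  are read off at the vertices of any ideal triangulation of the torus; triangulations correspond to
  Markov triples, and a flip of an edge is a Vieta move.

  If the geodesic is itself an edge \<open>s\<close> of a triangulation \<open>(x, y, s)\<close> with \<open>s\<close> maximal, its constant is
  \<open>x y / s\<close>; fixing \<open>x = m\<close> and letting the other two entries grow gives the limit point for \<open>m\<close>.

  Conversely, suppose that the constant is at least \<open>t > 1/3\<close>.  If the geodesic cuts off the vertex
  opposite to the longest edge \<open>c\<close> of a triangulation, then \<open>t\<^sup>2 (9 c\<^sup>2 - 4) \<le> c\<^sup>2\<close>, which bounds \<open>c\<close>.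
  Following the geodesic, either a flip leads to the same situation with a larger \<open>c\<close>, or the geodesic
  never crosses the edges \<open>c\<close> and runs along a strip of \<open>M\<close> triangles.  There are finitely many triples
  to consider, a strip is determined by its triple and \<open>M\<close>, and as \<open>M\<close> grows the constant converges to
  \<open>2 c / (sqrt (9 c\<^sup>2 - 4) + 3 c)\<close>.
\<close>

text \<open>The number 1/3 enters because \<open>t\<^sup>2 (9 c\<^sup>2 - 4) \<le> c\<^sup>2\<close>
  means \<open>c\<^sup>2 (9 t\<^sup>2 - 1) \<le> 4 t\<^sup>2\<close>, which bounds \<open>c\<close>
  exactly when \<open>t > 1/3\<close>. Along a strip, suitably scaled sums of neighbouring values
  satisfy a linear recursion with characteristic roots \<open>rho c\<close> and
  \<open>1 / rho c\<close>, whose sum is \<open>3 c\<close>. Irrationality of \<open>rho c\<close>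
  is used twice: a geodesic between two cusps cannot stay in a strip forever, so every strip has two
  ends; and the rational approximants \<open>x y / s\<close> never equal their limit. The obstacle
  in the converse is to control the constant, not just one value. The discriminant bounds all values
  on a strip, so the growing solution must be exponentially small at the near end; this forces the
  value at the third vertex of the strip towards \<open>c / rho c\<close> in absolute value. A
  convexity argument moves the minimum over the strip to its ends, and a sign argument bounds all
  vertices off the strip. Strips of one fixed length cannot accumulate, because both ends have value
  0 and the recursion is expanding.\<close>

section \<open>Triangles labelled by a quadratic form\<close>

text \<open>
  \<open>Cfg x P y Q s R\<close> is a triangle with integral vertices \<open>p\<close>, \<open>q\<close>, \<open>r\<close>: the form takes the values
  \<open>P\<close>, \<open>Q\<close>, \<open>R\<close> there, and \<open>x\<close>, \<open>y\<close>, \<open>s\<close> are the absolute determinants of the opposite edges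
  \<open>qr\<close>, \<open>rp\<close>, \<open>pq\<close>.  Vectors never occur, only these six numbers.
\<close>

datatype cfg = Cfg real real real real real real

fun mirror :: "cfg \<Rightarrow> cfg" where
  "mirror (Cfg x P y Q s R) = Cfg y Q x P s R"

fun turn :: "cfg \<Rightarrow> cfg" where
  "turn (Cfg x P y Q s R) = Cfg y Q s R x P"

text \<open>
  \<open>cross\<close> passes to the neighbouring triangle over the edge \<open>pq\<close>, whose new vertex is \<open>(x q - y p) / s\<close>
  (up to sign); the rotation that swaps \<open>p\<close> and \<open>q\<close> exchanges the two triangles, hence the exchange
  of \<open>x\<close> and \<open>y\<close>.  \<open>flip\<close> replaces the diagonal \<open>pq\<close> of the same quadrilateral by the other one.
\<close>

fun cross :: "cfg \<Rightarrow> cfg" where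
  "cross (Cfg x P y Q s R) = Cfg y P x Q s ((x\<^sup>2 + y\<^sup>2) * (P + Q) / s\<^sup>2 - R)"

fun flip :: "cfg \<Rightarrow> cfg" where
  "flip (Cfg x P y Q s R) = Cfg x R y ((x\<^sup>2 + y\<^sup>2) * (P + Q) / s\<^sup>2 - R) ((x\<^sup>2 + y\<^sup>2) / s) P"

fun negate :: "cfg \<Rightarrow> cfg" where
  "negate (Cfg x P y Q s R) = Cfg x (- P) y (- Q) s (- R)"

fun vertex_values :: "cfg \<Rightarrow> real set" where
  "vertex_values (Cfg x P y Q s R) = {P, Q, R}"

definition markov_triple :: "real \<Rightarrow> real \<Rightarrow> real \<Rightarrow> bool" where
  "markov_triple x y s \<longleftrightarrow> x \<in> \<int> \<and> y \<in> \<int> \<and> s \<in> \<int> \<and> x \<ge> 1 \<and> y \<ge> 1 \<and> s \<ge> 1 \<and> x\<^sup>2 + y\<^sup>2 + s\<^sup>2 = 3 * x * y * s"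

fun markov :: "cfg \<Rightarrow> bool" where
  "markov (Cfg x P y Q s R) = markov_triple x y s"

text \<open>The form has discriminant 1; the condition is symmetric in the three vertices.\<close>

fun unit_disc :: "cfg \<Rightarrow> bool" where
  "unit_disc (Cfg x P y Q s R) \<longleftrightarrow>
     (s\<^sup>2 * R - x\<^sup>2 * P - y\<^sup>2 * Q)\<^sup>2 = x\<^sup>2 * y\<^sup>2 * (s\<^sup>2 + 4 * P * Q)"

inductive_set orbit :: "cfg \<Rightarrow> cfg set" for C0 where
  base: "C0 \<in> orbit C0"
| mirror: "C \<in> orbit C0 \<Longrightarrow> mirror C \<in> orbit C0"
| turn: "C \<in> orbit C0 \<Longrightarrow> turn C \<in> orbit C0"
| cross: "C \<in> orbit C0 \<Longrightarrow> cross C \<in> orbit C0"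

definition orbit_values :: "cfg \<Rightarrow> real set" where
  "orbit_values C0 = (\<Union>C\<in>orbit C0. vertex_values C)"

lemma markov_triple_turn: "markov_triple x y s \<Longrightarrow> markov_triple y s x"
  and markov_triple_mirror: "markov_triple x y s \<Longrightarrow> markov_triple y x s"
  by (auto simp: markov_triple_def algebra_simps)

lemma markov_tripleD:
  assumes "markov_triple x y s"
  shows "x \<ge> 1" "y \<ge> 1" "s \<ge> 1" "x\<^sup>2 + y\<^sup>2 + s\<^sup>2 = 3 * x * y * s"
    "x\<^sup>2 + y\<^sup>2 = s * (3 * x * y - s)" "(x\<^sup>2 + y\<^sup>2) / s = 3 * x * y - s"
proof -
  show *: "x \<ge> 1" "y \<ge> 1" "s \<ge> 1" "x\<^sup>2 + y\<^sup>2 + s\<^sup>2 = 3 * x * y * s"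
    using assms by (auto simp: markov_triple_def)
  show **: "x\<^sup>2 + y\<^sup>2 = s * (3 * x * y - s)"
    using *(4) by (simp add: algebra_simps power2_eq_square)
  show "(x\<^sup>2 + y\<^sup>2) / s = 3 * x * y - s"
    unfolding ** using *(3) by simp
qed

lemma markov_turn: "markov C \<Longrightarrow> markov (turn C)"
  and markov_mirror: "markov C \<Longrightarrow> markov (mirror C)"
  and markov_cross: "markov C \<Longrightarrow> markov (cross C)"
  by (cases C; auto intro: markov_triple_turn markov_triple_mirror)+

lemma markov_triple_flip:
  assumes "markov_triple x y s"
  shows "markov_triple x y (3 * x * y - s)"
proof -
  note m = markov_tripleD[OF assms]
  have pos: "3 * x * y - s > 0"
    using m by (metis add_pos_pos less_le_trans zero_less_mult_pos zero_less_one zero_less_power)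
  have int: "3 * x * y - s \<in> \<int>"
    using assms by (auto simp: markov_triple_def)
  then obtain k where k: "3 * x * y - s = of_int k"
    by (auto elim: Ints_cases)
  have "3 * x * y - s \<ge> 1"
    using pos unfolding k by simp
  moreover have "x\<^sup>2 + y\<^sup>2 + (3 * x * y - s)\<^sup>2 = 3 * x * y * (3 * x * y - s)"
    using m(4) by (simp add: algebra_simps power2_eq_square)
  ultimately show ?thesis
    using assms int by (auto simp: markov_triple_def)
qed

lemma markov_flip: "markov C \<Longrightarrow> markov (flip C)"
  by (cases C) (auto simp: markov_tripleD(6) intro: markov_triple_flip)

lemma cross_cross: "markov C \<Longrightarrow> cross (cross C) = C"
  by (cases C) (auto simp: add.commute dest: markov_tripleD(3))

lemma turn_turn_turn [simp]: "turn (turn (turn C)) = C"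
  and mirror_mirror [simp]: "mirror (mirror C) = C"
  and cross_mirror: "cross (mirror C) = mirror (cross C)"
  and turn_mirror: "turn (mirror C) = mirror (turn (turn C))"
  by (cases C; simp add: add.commute)+

lemma flip_flip:
  assumes "markov C"
  shows "flip (flip C) = C"
proof (cases C)
  case (Cfg x P y Q s R)
  note m = markov_tripleD[of x y s]
  have markov: "markov_triple x y s" using assms Cfg by simp
  define k where "k = x\<^sup>2 + y\<^sup>2"
  have n: "s \<noteq> 0" "k \<noteq> 0" using m[OF markov]
    by (auto simp: sum_power2_eq_zero_iff k_def)
  show ?thesis using n unfolding Cfg by (simp add: k_def[symmetric]) (simp add: field_simps power2_eq_square)
qed

lemma orbit_markov: "C \<in> orbit C0 \<Longrightarrow> markov C0 \<Longrightarrow> markov C"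
  by (induction rule: orbit.induct) (auto intro: markov_turn markov_mirror markov_cross)

lemma unit_disc_mirror: "unit_disc C \<Longrightarrow> unit_disc (mirror C)"
  by (cases C) (simp add: algebra_simps)

lemma unit_disc_turn: "unit_disc C \<Longrightarrow> unit_disc (turn C)"
  by (cases C) (simp add: algebra_simps power2_eq_square)

lemma unit_disc_cross:
  assumes "markov C" "unit_disc C"
  shows "unit_disc (cross C)"
proof (cases C)
  case (Cfg x P y Q s R)
  have s: "s \<noteq> 0" using assms Cfg markov_tripleD(3)[of x y s] by auto
  have "s\<^sup>2 * ((x\<^sup>2 + y\<^sup>2) * (P + Q) / s\<^sup>2 - R) - y\<^sup>2 * P - x\<^sup>2 * Q = - (s\<^sup>2 * R - x\<^sup>2 * P - y\<^sup>2 * Q)"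
    using s by (simp add: field_simps)
  then show ?thesis
    using assms(2) unfolding Cfg unit_disc.simps cross.simps by (simp only: power2_minus) (simp add: mult_ac)
qed

lemma orbit_unit_disc: "C \<in> orbit C0 \<Longrightarrow> markov C0 \<Longrightarrow> unit_disc C0 \<Longrightarrow> unit_disc C"
  by (induction rule: orbit.induct) (auto intro: unit_disc_mirror unit_disc_turn unit_disc_cross orbit_markov)

lemma unit_disc_flip:
  assumes "markov C" "unit_disc C"
  shows "unit_disc (flip C)"
proof (cases C)
  case (Cfg x P y Q s R)
  have m: "markov_triple x y s" using assms Cfg by simp
  have s: "s \<noteq> 0" "x \<noteq> 0" "y \<noteq> 0" using markov_tripleD(1-3)[OF m] by auto
  define k where "k = x\<^sup>2 + y\<^sup>2"
  have u: "(s\<^sup>2 * R - x\<^sup>2 * P - y\<^sup>2 * Q)\<^sup>2 = x\<^sup>2 * y\<^sup>2 * (s\<^sup>2 + 4 * P * Q)"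
    using assms(2) Cfg by simp
  define R' where "R' = k * (P + Q) / s\<^sup>2 - R"
  have R: "s\<^sup>2 * R' = k * (P + Q) - s\<^sup>2 * R" using s by (simp add: R'_def field_simps)
  \<comment> \<open>\<open>R'\<close> enters only through \<open>s\<^sup>2 * R'\<close>, which is
    polynomial by \<open>R\<close>; the identity is then the discriminant equation \<open>u\<close>
    multiplied by \<open>s\<^sup>2 * k\<^sup>2\<close>.\<close>
  have "s\<^sup>2 * (k\<^sup>2 * P - s\<^sup>2 * (x\<^sup>2 * R + y\<^sup>2 * R'))\<^sup>2
     = s\<^sup>2 * (k\<^sup>2 * P - x\<^sup>2 * (s\<^sup>2 * R) - y\<^sup>2 * (s\<^sup>2 * R'))\<^sup>2" by (simp add: algebra_simps)
  also have "\<dots> = x\<^sup>2 * y\<^sup>2 * (s\<^sup>2 * k\<^sup>2 * s\<^sup>2 + 4 * s\<^sup>2 * R * (s\<^sup>2 * R') * s\<^sup>2)"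
    unfolding R using u unfolding k_def by algebra
  also have "\<dots> = s\<^sup>2 * (x\<^sup>2 * y\<^sup>2 * s\<^sup>2 * (k\<^sup>2 + 4 * R * R' * s\<^sup>2))"
    by (simp add: algebra_simps)
  finally have "(k\<^sup>2 * P - s\<^sup>2 * (x\<^sup>2 * R + y\<^sup>2 * R'))\<^sup>2 = x\<^sup>2 * y\<^sup>2 * s\<^sup>2 * (k\<^sup>2 + 4 * R * R' * s\<^sup>2)"
    using s by simp
  moreover have "(k / s)\<^sup>2 * P - x\<^sup>2 * R - y\<^sup>2 * R' = (k\<^sup>2 * P - s\<^sup>2 * (x\<^sup>2 * R + y\<^sup>2 * R')) / s\<^sup>2"
    using s by (simp add: field_simps)
  ultimately have "((k / s)\<^sup>2 * P - x\<^sup>2 * R - y\<^sup>2 * R')\<^sup>2 = x\<^sup>2 * y\<^sup>2 * s\<^sup>2 * (k\<^sup>2 + 4 * R * R' * s\<^sup>2) / (s\<^sup>2)\<^sup>2"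
    by (simp add: power_divide)
  also have "\<dots> = x\<^sup>2 * y\<^sup>2 * ((k / s)\<^sup>2 + 4 * R * R')"
    using s by (simp add: field_simps power2_eq_square)
  finally show ?thesis
    unfolding Cfg unit_disc.simps flip.simps R'_def k_def .
qed

section \<open>Orbits up to relabelling, and their invariance under flips\<close>

definition arrangements :: "cfg \<Rightarrow> cfg set" where
  "arrangements D = {D, turn D, turn (turn D), mirror D, mirror (turn D), mirror (turn (turn D))}"

lemma arrangements_mirror: "C \<in> arrangements D \<Longrightarrow> mirror C \<in> arrangements D"
  and arrangements_turn: "C \<in> arrangements D \<Longrightarrow> turn C \<in> arrangements D"
  by (auto simp: arrangements_def turn_mirror)

lemma arrangements_cross:
  assumes "C \<in> arrangements D"
  shows "cross C \<in> arrangements (cross D) \<or> cross C \<in> arrangements (cross (turn D)) \<or> cross C \<in> arrangements (cross (turn (turn D)))"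
  using assms by (auto simp: arrangements_def cross_mirror)

lemma vertex_values_turn [simp]: "vertex_values (turn C) = vertex_values C"
  and vertex_values_mirror [simp]: "vertex_values (mirror C) = vertex_values C"
  by (cases C; auto)+

lemma vertex_values_arrangements: "C \<in> arrangements D \<Longrightarrow> vertex_values C = vertex_values D"
  by (auto simp: arrangements_def)

lemma orbit_arrangements: "D \<in> orbit C0 \<Longrightarrow> C \<in> arrangements D \<Longrightarrow> C \<in> orbit C0"
  by (auto simp: arrangements_def intro: orbit.intros)

lemma orbit_trans:
  assumes "C2 \<in> orbit C1" "C1 \<in> orbit C0"
  shows "C2 \<in> orbit C0"
  using assms by (induction rule: orbit.induct) (auto intro: orbit.intros)

lemma orbit_sym:
  assumes "C \<in> orbit C0" "markov C0"
  shows "C0 \<in> orbit C"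
  using assms
proof (induction rule: orbit.induct)
  case base
  then show ?case by (auto intro: orbit.intros)
next
  case (mirror C)
  have "C \<in> orbit (mirror C)" by (metis orbit.base orbit.mirror mirror_mirror)
  with mirror show ?case using orbit_trans by blast
next
  case (turn C)
  have "C \<in> orbit (turn C)" by (metis orbit.base orbit.turn turn_turn_turn)
  with turn show ?case using orbit_trans by blast
next
  case (cross C)
  have "C \<in> orbit (cross C)" by (metis cross.hyps cross.prems orbit.base orbit.cross cross_cross orbit_markov)
  with cross show ?case using orbit_trans by blast
qed

lemma orbit_values_orbit:
  assumes "C \<in> orbit C0" "markov C0"
  shows "orbit_values C = orbit_values C0"
  using assms orbit_sym[OF assms] unfolding orbit_values_def by (auto intro: orbit_trans)

text \<open>The Markov equation makes flips compatible with crossing edges, so that all triangulations see the same values.\<close>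

lemma cross_flip_arrangements:
  assumes "markov C"
  shows "cross (flip C) \<in> arrangements (flip (mirror (cross C)))"
    and "cross (turn (flip C)) \<in> arrangements (flip (cross (turn (mirror (cross (turn (turn (cross C))))))))"
    and "cross (turn (turn (flip C))) \<in> arrangements (flip (turn (mirror (cross (turn (turn C))))))"
proof -
  obtain x P y Q s R where C: "C = Cfg x P y Q s R" by (cases C)
  have m: "markov_triple x y s" using assms C by simp
  have n: "s \<noteq> 0" "x \<noteq> 0" "y \<noteq> 0" using markov_tripleD(1-3)[OF m] by auto
  define s' where "s' = 3 * x * y - s"
  have m': "markov_triple x y s'" unfolding s'_def by (rule markov_triple_flip[OF m])
  have n': "s' \<noteq> 0" using markov_tripleD(3)[OF m'] by auto
  \<comment> \<open>By Vieta, \<open>s\<close> and \<open>s'\<close> have product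
    \<open>x\<^sup>2 + y\<^sup>2\<close> and sum \<open>3 x y\<close>. The rules below turn each sum
    of two squares into a product, so that the denominators of \<open>cross\<close> and
    \<open>flip\<close> cancel.\<close>
  have k: "x\<^sup>2 + y\<^sup>2 = s * s'" "y\<^sup>2 + x\<^sup>2 = s * s'" using markov_tripleD(5)[OF m] by (auto simp: s'_def)
  have k1: "s\<^sup>2 + x\<^sup>2 = y * (3 * x * s - y)" "x\<^sup>2 + s\<^sup>2 = y * (3 * x * s - y)"
    using markov_tripleD(4)[OF m] by (auto simp: algebra_simps power2_eq_square)
  have k2: "s'\<^sup>2 + x\<^sup>2 = y * (3 * x * s' - y)" "x\<^sup>2 + s'\<^sup>2 = y * (3 * x * s' - y)"
    using markov_tripleD(4)[OF m'] by (auto simp: algebra_simps power2_eq_square)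
  have k3: "s\<^sup>2 + y\<^sup>2 = x * (3 * y * s - x)" "y\<^sup>2 + s\<^sup>2 = x * (3 * y * s - x)"
    using markov_tripleD(4)[OF m] by (auto simp: algebra_simps power2_eq_square)
  have k4: "s'\<^sup>2 + y\<^sup>2 = x * (3 * y * s' - x)" "y\<^sup>2 + s'\<^sup>2 = x * (3 * y * s' - x)"
    using markov_tripleD(4)[OF m'] by (auto simp: algebra_simps power2_eq_square)
  have ss: "s * s' / s = s'" using n by simp
  note sm = flip.simps cross.simps turn.simps mirror.simps k k1 k2 k3 k4 ss
  show "cross (flip C) \<in> arrangements (flip (mirror (cross C)))"
    unfolding C arrangements_def sm using n n' by (simp add: field_simps power2_eq_square)
  show "cross (turn (turn (flip C))) \<in> arrangements (flip (turn (mirror (cross (turn (turn C))))))"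
    unfolding C arrangements_def sm using n n' by (simp add: field_simps power2_eq_square)
  show "cross (turn (flip C)) \<in> arrangements (flip (cross (turn (mirror (cross (turn (turn (cross C))))))))"
    unfolding C arrangements_def sm using n n' by (simp add: field_simps power2_eq_square)
qed

text \<open>A walk through the flipped triangulation is shadowed by one through the original: each
  flipped triangle lies in a quadrilateral of the original, and crossing any of its edges leads to
  another such quadrilateral or to the other half of the same one.\<close>

lemma orbit_flip:
  assumes "C' \<in> orbit (flip C0)" "markov C0"
  shows "\<exists>C\<in>orbit C0. C' \<in> arrangements (flip C)"
  using assms
proof (induction rule: orbit.induct)
  case base
  then show ?case by (auto intro!: bexI[of _ C0] orbit.base simp: arrangements_def)
next
  case (mirror C)
  then show ?case by (blast intro: arrangements_mirror)
next
  case (turn C)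
  then show ?case by (blast intro: arrangements_turn)
next
  case (cross C')
  then obtain C where C: "C \<in> orbit C0" "C' \<in> arrangements (flip C)" by blast
  have markov: "markov C" using C cross orbit_markov by blast
  have 1: "mirror (cross C) \<in> orbit C0" "cross (turn (mirror (cross (turn (turn (cross C)))))) \<in> orbit C0"
    "turn (mirror (cross (turn (turn C)))) \<in> orbit C0"
    using C by (auto intro!: orbit.intros)
  have tr: "A \<in> arrangements D" if "A \<in> arrangements B" "B \<in> arrangements D" for A B D
    using that unfolding arrangements_def[of B] by (auto intro: arrangements_mirror arrangements_turn)
  show ?case
    using arrangements_cross[OF C(2)] cross_flip_arrangements[OF markov] 1 tr by metis
qed

lemma vertex_values_flip: "markov C \<Longrightarrow> vertex_values (flip C) \<subseteq> vertex_values C \<union> vertex_values (cross C)"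
  by (cases C) auto

lemma orbit_values_flip_subset:
  assumes "markov C0" shows "orbit_values (flip C0) \<subseteq> orbit_values C0"
proof
  fix v assume "v \<in> orbit_values (flip C0)"
  then obtain C' where C': "C' \<in> orbit (flip C0)" "v \<in> vertex_values C'" by (auto simp: orbit_values_def)
  then obtain C where C: "C \<in> orbit C0" "C' \<in> arrangements (flip C)" using orbit_flip[OF _ assms] by blast
  then have "v \<in> vertex_values (flip C)" using vertex_values_arrangements C' by blast
  then have "v \<in> vertex_values C \<union> vertex_values (cross C)" using vertex_values_flip C orbit_markov assms by blast
  then show "v \<in> orbit_values C0" using C orbit.cross unfolding orbit_values_def by blast
qed

lemma orbit_values_flip:
  assumes "markov C0" shows "orbit_values (flip C0) = orbit_values C0"
  using orbit_values_flip_subset[OF assms] orbit_values_flip_subset[OF markov_flip[OF assms]] flip_flip[OF assms] by auto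

lemma cross_negate: "cross (negate C) = negate (cross C)"
  by (cases C) (simp add: algebra_simps diff_divide_distrib add_divide_distrib)

lemma orbit_negate: "C \<in> orbit C0 \<Longrightarrow> negate C \<in> orbit (negate C0)"
proof (induction rule: orbit.induct)
  case base
  then show ?case by (rule orbit.base)
next
  case (mirror C)
  have "negate (mirror C) = mirror (negate C)" by (cases C) auto
  then show ?case using mirror by (auto intro: orbit.intros)
next
  case (turn C)
  have "negate (turn C) = turn (negate C)" by (cases C) auto
  then show ?case using turn by (auto intro: orbit.intros)
next
  case (cross C)
  then show ?case by (auto intro: orbit.intros simp: cross_negate[symmetric])
qed

lemma negate_negate [simp]: "negate (negate C) = C"
  by (cases C) auto

lemma vertex_values_negate: "vertex_values (negate C) = uminus ` vertex_values C"
  by (cases C) auto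

lemma orbit_values_negate_subset: "uminus ` orbit_values C \<subseteq> orbit_values (negate C)"
  unfolding orbit_values_def using orbit_negate vertex_values_negate by fastforce

lemma orbit_values_negate: "orbit_values (negate C) = uminus ` orbit_values C"
proof
  have "uminus ` orbit_values (negate C) \<subseteq> orbit_values C" using orbit_values_negate_subset[of "negate C"] by simp
  then have "uminus ` uminus ` orbit_values (negate C) \<subseteq> uminus ` orbit_values C" by blast
  then show "orbit_values (negate C) \<subseteq> uminus ` orbit_values C" by (simp add: image_image)
qed (rule orbit_values_negate_subset)

section \<open>The Farey triangulation and the constants of rationals\<close>

text \<open>Zero is left out because the form vanishes at the two cusps that the geodesic
  joins.\<close>

definition least_abs :: "real set \<Rightarrow> real" where
  "least_abs S = Inf {\<bar>v\<bar> | v. v \<in> S \<and> v \<noteq> 0}"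

lemma least_abs_le: "v \<in> S \<Longrightarrow> v \<noteq> 0 \<Longrightarrow> least_abs S \<le> \<bar>v\<bar>"
  unfolding least_abs_def by (rule cInf_lower) (auto intro: bdd_belowI[of _ 0])

lemma least_abs_ge:
  assumes "\<And>v. v \<in> S \<Longrightarrow> v \<noteq> 0 \<Longrightarrow> t \<le> \<bar>v\<bar>" "v \<in> S" "v \<noteq> 0"
  shows "t \<le> least_abs S"
  unfolding least_abs_def using assms by (intro cInf_greatest) auto

lemma least_abs_uminus: "least_abs (uminus ` S) = least_abs S"
proof -
  have "{\<bar>v\<bar> |v. v \<in> T \<and> v \<noteq> 0} = abs ` (T - {0})" for T :: "real set"
    by auto
  moreover have "abs ` (uminus ` S - {0}) = abs ` (S - {0})"
  proof -
    have "uminus ` S - {0} = uminus ` (S - {0})" by auto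
    then show ?thesis by (simp add: image_image)
  qed
  ultimately have "{\<bar>v\<bar> |v. v \<in> uminus ` S \<and> v \<noteq> 0} = {\<bar>v\<bar> |v. v \<in> S \<and> v \<noteq> 0}"
    by simp
  then show ?thesis by (simp add: least_abs_def)
qed

text \<open>The form \<open>x (\<beta> x - y)\<close> on the triangle \<open>(1,0)\<close>, \<open>(0,1)\<close>, \<open>(1,1)\<close>.\<close>

abbreviation farey :: "real \<Rightarrow> cfg" where
  "farey \<beta> \<equiv> Cfg 1 \<beta> 1 0 1 (\<beta> - 1)"

definition rat_form :: "real \<Rightarrow> int \<Rightarrow> int \<Rightarrow> real" where
  "rat_form \<beta> x y = of_int x * (\<beta> * of_int x - of_int y)"

lemma markov_farey [simp]: "markov (Cfg 1 P 1 Q 1 R)"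
  by (simp add: markov_triple_def)

lemma orbit_farey:
  assumes "C \<in> orbit (farey \<beta>)"
  shows "\<exists>p p' q q'. \<bar>p * q' - p' * q\<bar> = 1 \<and> C = Cfg 1 (rat_form \<beta> p p') 1 (rat_form \<beta> q q') 1 (rat_form \<beta> (p + q) (p' + q'))"
  using assms
proof (induction rule: orbit.induct)
  case base
  show ?case by (intro exI[of _ 1] exI[of _ 0]) (simp add: rat_form_def)
next
  case (mirror C)
  then obtain p p' q q' where h: "\<bar>p * q' - p' * q\<bar> = 1"
    "C = Cfg 1 (rat_form \<beta> p p') 1 (rat_form \<beta> q q') 1 (rat_form \<beta> (p + q) (p' + q'))" by blast
  show ?case
    by (intro exI[of _ q] exI[of _ q'] exI[of _ p] exI[of _ p'])
      (use h in \<open>simp add: abs_minus_commute algebra_simps\<close>)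
next
  case (turn C)
  then obtain p p' q q' where h: "\<bar>p * q' - p' * q\<bar> = 1"
    "C = Cfg 1 (rat_form \<beta> p p') 1 (rat_form \<beta> q q') 1 (rat_form \<beta> (p + q) (p' + q'))" by blast
  \<comment> \<open>The third vertex must again be the sum of the first two. The form is even, so
    \<open>p\<close> may be replaced by \<open>- p\<close>, which is
    \<open>q + (- p - q)\<close>.\<close>
  show ?case
    by (rule exI[of _ q], rule exI[of _ q'], rule exI[of _ "- p - q"], rule exI[of _ "- p' - q'"])
      (use h in \<open>simp add: rat_form_def algebra_simps\<close>)
next
  case (cross C)
  then obtain p p' q q' where h: "\<bar>p * q' - p' * q\<bar> = 1"
    "C = Cfg 1 (rat_form \<beta> p p') 1 (rat_form \<beta> q q') 1 (rat_form \<beta> (p + q) (p' + q'))" by blast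
  show ?case
    by (rule exI[of _ p], rule exI[of _ p'], rule exI[of _ "- q"], rule exI[of _ "- q'"])
      (use h in \<open>simp add: rat_form_def algebra_simps abs_minus_commute\<close>)
qed

text \<open>The subtractive Euclidean algorithm on \<open>(i, j)\<close>: passing to the basis
  \<open>p\<close>, \<open>p + q\<close> or \<open>p + q\<close>, \<open>q\<close> is a crossing of
  the Farey triangulation.\<close>

lemma orbit_farey_cone:
  assumes "coprime i j" "Cfg 1 (rat_form \<beta> p p') 1 (rat_form \<beta> q q') 1 (rat_form \<beta> (p + q) (p' + q')) \<in> orbit C0"
  shows "rat_form \<beta> (int i * p + int j * q) (int i * p' + int j * q') \<in> orbit_values C0"
  using assms
proof (induction "i + j" arbitrary: i j p p' q q' rule: less_induct)
  case less
  let ?C = "Cfg 1 (rat_form \<beta> p p') 1 (rat_form \<beta> q q') 1 (rat_form \<beta> (p + q) (p' + q'))"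
  have sub: "vertex_values ?C \<subseteq> orbit_values C0" using less.prems(2) unfolding orbit_values_def by blast
  consider "i = 0" | "j = 0" | "i = j" | "0 < j" "j < i" | "0 < i" "i < j" by linarith
  then show ?case
  proof cases
    case 1
    then have "j = 1" using less.prems by simp
    then show ?thesis using 1 sub by simp
  next
    case 2
    then have "i = 1" using less.prems by simp
    then show ?thesis using 2 sub by simp
  next
    case 3
    then have "j = 1" using less.prems by simp
    then show ?thesis using 3 sub by simp
  next
    case 4
    have c: "coprime (i - j) j" using less.prems(1) 4
      by (metis coprime_commute coprime_iff_gcd_eq_1 gcd_diff1_nat less_imp_le)
    have "mirror (cross (turn (turn ?C))) \<in> orbit C0"
      by (intro orbit.intros less.prems)
    moreover have "mirror (cross (turn (turn ?C))) =
       Cfg 1 (rat_form \<beta> p p') 1 (rat_form \<beta> (p + q) (p' + q')) 1 (rat_form \<beta> (p + (p + q)) (p' + (p' + q')))"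
      by (simp add: rat_form_def algebra_simps)
    ultimately have "rat_form \<beta> (int (i - j) * p + int j * (p + q)) (int (i - j) * p' + int j * (p' + q')) \<in> orbit_values C0"
      using less.hyps[of "i - j" j] c 4 by auto
    moreover have "int (i - j) * p + int j * (p + q) = int i * p + int j * q"
      "int (i - j) * p' + int j * (p' + q') = int i * p' + int j * q'"
      using 4 by (simp_all add: algebra_simps of_nat_diff)
    ultimately show ?thesis by simp
  next
    case 5
    have c: "coprime i (j - i)" using less.prems(1) 5
      by (metis coprime_commute coprime_iff_gcd_eq_1 gcd_diff1_nat less_imp_le)
    have "mirror (cross (turn ?C)) \<in> orbit C0"
      by (intro orbit.intros less.prems)
    moreover have "mirror (cross (turn ?C)) =
       Cfg 1 (rat_form \<beta> (p + q) (p' + q')) 1 (rat_form \<beta> q q') 1 (rat_form \<beta> (p + q + q) (p' + q' + q'))"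
      by (simp add: rat_form_def algebra_simps)
    ultimately have "rat_form \<beta> (int i * (p + q) + int (j - i) * q) (int i * (p' + q') + int (j - i) * q') \<in> orbit_values C0"
      using less.hyps[of i "j - i"] c 5 by auto
    moreover have "int i * (p + q) + int (j - i) * q = int i * p + int j * q"
      "int i * (p' + q') + int (j - i) * q' = int i * p' + int j * q'"
      using 5 by (simp_all add: algebra_simps of_nat_diff)
    ultimately show ?thesis by simp
  qed
qed

lemma orbit_values_farey: "orbit_values (farey \<beta>) = {rat_form \<beta> x y | x y. coprime x y}"
proof (intro equalityI subsetI)
  fix v assume "v \<in> orbit_values (farey \<beta>)"
  then obtain C where C: "C \<in> orbit (farey \<beta>)" "v \<in> vertex_values C" by (auto simp: orbit_values_def)
  obtain p p' q q' where h: "\<bar>p * q' - p' * q\<bar> = 1"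
    "C = Cfg 1 (rat_form \<beta> p p') 1 (rat_form \<beta> q q') 1 (rat_form \<beta> (p + q) (p' + q'))" using orbit_farey[OF C(1)] by blast
  have d: "is_unit (p * q' - p' * q)" using h(1) by simp
  have cp: "coprime p p'" "coprime q q'" "coprime (p + q) (p' + q')"
  proof -
    show "coprime p p'"
      by (rule coprimeI) (meson d dvd_diff dvd_mult2 dvd_trans)
    show "coprime q q'"
      by (rule coprimeI) (meson d dvd_diff dvd_mult dvd_trans)
    show "coprime (p + q) (p' + q')"
    proof (rule coprimeI)
      fix c assume "c dvd p + q" "c dvd p' + q'"
      then have "c dvd (p + q) * q' - (p' + q') * q" by simp
      then have "c dvd p * q' - p' * q" by (simp add: algebra_simps)
      then show "is_unit c" using d by (meson dvd_trans)
    qed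
  qed
  show "v \<in> {rat_form \<beta> x y | x y. coprime x y}" using C(2) h(2) cp by auto
next
  fix v assume "v \<in> {rat_form \<beta> x y | x y. coprime x y}"
  then obtain x y where v: "v = rat_form \<beta> x y" "coprime x y" by blast
  have c: "coprime (nat \<bar>x\<bar>) (nat \<bar>y\<bar>)" using v(2)
    by (simp add: coprime_int_iff[symmetric])
  \<comment> \<open>Up to sign, every vector lies in the cone of (1,0) and (0,1) or in that of (1,0)
    and (0,-1), and the form does not see the sign.\<close>
  have 1: "Cfg 1 (rat_form \<beta> 1 0) 1 (rat_form \<beta> 0 1) 1 (rat_form \<beta> (1 + 0) (0 + 1)) \<in> orbit (farey \<beta>)"
    using orbit.base[of "farey \<beta>"] by (simp add: rat_form_def)
  have "cross (farey \<beta>) \<in> orbit (farey \<beta>)" by (intro orbit.intros)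
  then have 2: "Cfg 1 (rat_form \<beta> 1 0) 1 (rat_form \<beta> 0 (-1)) 1 (rat_form \<beta> (1 + 0) (0 + -1)) \<in> orbit (farey \<beta>)"
    by (simp add: rat_form_def)
  have A: "rat_form \<beta> \<bar>x\<bar> \<bar>y\<bar> \<in> orbit_values (farey \<beta>)" using orbit_farey_cone[OF c 1] by simp
  have B: "rat_form \<beta> \<bar>x\<bar> (- \<bar>y\<bar>) \<in> orbit_values (farey \<beta>)" using orbit_farey_cone[OF c 2] by simp
  have "rat_form \<beta> x y = rat_form \<beta> \<bar>x\<bar> \<bar>y\<bar> \<or> rat_form \<beta> x y = rat_form \<beta> \<bar>x\<bar> (- \<bar>y\<bar>)"
    by (auto simp: rat_form_def abs_if algebra_simps)
  then show "v \<in> orbit_values (farey \<beta>)" using A B v by auto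
qed

text \<open>For fixed \<open>x\<close> the best \<open>y\<close> is the nearest integer, which gives
  the terms of the minimum. The two differences are that \<open>x\<close> is unbounded and that
  vectors must be primitive: large \<open>x\<close> never helps, and dividing by the gcd only
  shrinks the value.\<close>

lemma Zval_eq_least_abs:
  assumes ab: "quotient_of r = (a, b)" and b: "b \<ge> 2"
  shows "Zval r = least_abs (orbit_values (farey (frac (of_int a / of_int b))))"
proof -
  define n where "n = \<lfloor>of_int a / of_int b :: real\<rfloor>"
  define \<beta> :: real where "\<beta> = frac (of_int a / of_int b)"
  have \<beta>: "\<beta> = of_int a / of_int b - of_int n" by (simp add: \<beta>_def n_def frac_def)
  have cop: "coprime a b" using ab by (metis quotient_of_coprime)
  let ?g = "\<lambda>q::int. of_int q * dist_int (of_int q * of_int a / of_int b)"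
  have fin: "finite (?g ` {0<..<b})" by simp
  have "?g 1 \<in> ?g ` {0<..<b}" using b by (intro imageI) auto
  then have ne: "?g ` {0<..<b} \<noteq> {}" by blast
  have Z: "Zval r = Min (?g ` {0<..<b})" by (simp add: Zval_def ab)
  have rat_form_g: "rat_form \<beta> x y = of_int x * (of_int x * of_int a / of_int b - of_int (y + n * x))" for x y
    by (simp add: rat_form_def \<beta> algebra_simps)
  have rat_form_b: "rat_form \<beta> x y * of_int b = of_int (x * (x * a - b * (y + n * x)))" for x y
    using b by (simp add: rat_form_g field_simps)
  have le: "Zval r \<le> \<bar>rat_form \<beta> x y\<bar>" if "rat_form \<beta> x y \<noteq> 0" for x y
  proof -
    have x: "x \<noteq> 0" using that by (auto simp: rat_form_def)
    show ?thesis
    proof (cases "\<bar>x\<bar> < b")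
      case True
      have "Zval r \<le> ?g \<bar>x\<bar>" unfolding Z by (intro Min_le[OF fin] imageI) (use x True in auto)
      also have "\<dots> \<le> of_int \<bar>x\<bar> * \<bar>of_int \<bar>x\<bar> * of_int a / of_int b - of_int (sgn x * (y + n * x))\<bar>"
        unfolding dist_int_def by (intro mult_left_mono round_diff_minimal) auto
      also have "\<dots> = \<bar>rat_form \<beta> x y\<bar>"
      proof -
        have "of_int \<bar>x\<bar> * of_int a / of_int b - of_int (sgn x * (y + n * x))
          = of_int (sgn x) * (of_int x * of_int a / of_int b - of_int (y + n * x) :: real)"
          using x by (cases "x > 0") (simp_all add: algebra_simps)
        moreover have "\<bar>real_of_int (sgn x)\<bar> = 1" using x by (simp add: sgn_if)
        ultimately show ?thesis unfolding rat_form_g by (simp only: abs_mult of_int_abs)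
      qed
      finally show ?thesis .
    next
      case False
      \<comment> \<open>Values are integral multiples of \<open>x / b\<close>, so a nonzero one with
        \<open>\<bar>x\<bar> \<ge> b\<close> is at least 1 in absolute value, while
        \<open>Zval r\<close> is at most 1/2.\<close>
      have "x * (x * a - b * (y + n * x)) \<noteq> 0" using that rat_form_b[of x y] b
        by (metis mult_eq_0_iff of_int_0 of_int_eq_0_iff not_numeral_le_zero)
      then have "\<bar>x * a - b * (y + n * x)\<bar> \<ge> 1" by auto
      then have "\<bar>x\<bar> * \<bar>x * a - b * (y + n * x)\<bar> \<ge> b * 1"
        using False b by (intro mult_mono) auto
      then have "real_of_int b \<le> \<bar>rat_form \<beta> x y * of_int b\<bar>"
        unfolding rat_form_b by (metis abs_mult mult.right_neutral of_int_abs of_int_le_iff)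
      then have one: "1 \<le> \<bar>rat_form \<beta> x y\<bar>" using b by (simp add: abs_mult)
      have "Zval r \<le> ?g 1" unfolding Z by (intro Min_le[OF fin] imageI) (use b in auto)
      also have "\<dots> \<le> 1 / 2" unfolding dist_int_def
        using of_int_round_abs_le[of "of_int a / of_int b :: real"]
        by (simp add: abs_minus_commute[of _ "of_int (round _)"])
      finally show ?thesis using one by simp
    qed
  qed
  have attain: "\<exists>x y. coprime x y \<and> rat_form \<beta> x y \<noteq> 0 \<and> \<bar>rat_form \<beta> x y\<bar> \<le> Zval r"
  proof -
    obtain q where q: "0 < q" "q < b" "Zval r = ?g q"
      using Min_in[OF fin ne] unfolding Z by auto
    define k where "k = round (of_int q * of_int a / of_int b :: real) - n * q"
    have eq: "Zval r = \<bar>rat_form \<beta> q k\<bar>"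
      unfolding q(3) rat_form_g k_def dist_int_def using q(1) by (simp add: abs_mult)
    have "\<not> b dvd q" using q by (meson zdvd_not_zless)
    then have "\<not> b dvd q * a" using cop by (simp add: coprime_commute coprime_dvd_mult_left_iff)
    then have "q * a - b * (k + n * q) \<noteq> 0" by (metis dvd_triv_left eq_iff_diff_eq_0)
    then have least_abs: "rat_form \<beta> q k \<noteq> 0" using rat_form_b[of q k] q(1) by (metis mult_eq_0_iff of_int_eq_0_iff less_irrefl)
    define g where "g = gcd q k"
    have g: "g > 0" using q(1) by (simp add: g_def)
    obtain x y where xy: "q = g * x" "k = g * y" "coprime x y"
      using gcd_coprime_exists[of q k] g unfolding g_def by (metis less_irrefl mult.commute)
    have gq: "rat_form \<beta> q k = (of_int g)\<^sup>2 * rat_form \<beta> x y" by (simp add: rat_form_def xy power2_eq_square algebra_simps)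
    have "1 * \<bar>rat_form \<beta> x y\<bar> \<le> \<bar>(of_int g)\<^sup>2\<bar> * \<bar>rat_form \<beta> x y\<bar>"
      using g by (intro mult_right_mono) (auto simp: one_le_power)
    then have "\<bar>rat_form \<beta> x y\<bar> \<le> Zval r" unfolding eq gq abs_mult by simp
    moreover have "rat_form \<beta> x y \<noteq> 0" using least_abs gq by auto
    ultimately show ?thesis using xy(3) by blast
  qed
  obtain x y where xy: "coprime x y" "rat_form \<beta> x y \<noteq> 0" "\<bar>rat_form \<beta> x y\<bar> \<le> Zval r" using attain by blast
  have inV: "rat_form \<beta> x y \<in> orbit_values (farey \<beta>)" using xy unfolding orbit_values_farey by blast
  show ?thesis unfolding \<beta>_def[symmetric]
  proof (rule antisym)
    show "Zval r \<le> least_abs (orbit_values (farey \<beta>))"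
      by (rule least_abs_ge[OF _ inV xy(2)]) (auto simp: orbit_values_farey intro: le)
    show "least_abs (orbit_values (farey \<beta>)) \<le> Zval r" using least_abs_le[OF inV xy(2)] xy(3) by simp
  qed
qed

section \<open>Climbing away from the geodesic\<close>

text \<open>Triangles reached from \<open>C0\<close> without backtracking; the third vertex is always the most recent one.\<close>

inductive_set descendants :: "cfg \<Rightarrow> cfg set" for C0 where
  root0: "cross C0 \<in> descendants C0"
| root1: "cross (turn C0) \<in> descendants C0"
| root2: "cross (turn (turn C0)) \<in> descendants C0"
| child1: "C \<in> descendants C0 \<Longrightarrow> cross (turn C) \<in> descendants C0"
| child2: "C \<in> descendants C0 \<Longrightarrow> cross (turn (turn C)) \<in> descendants C0"

lemma descendants_orbit: "C \<in> descendants C0 \<Longrightarrow> C \<in> orbit C0"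
  by (induction rule: descendants.induct) (auto intro: orbit.intros)

lemma arrangements_self: "C \<in> arrangements C" "turn C \<in> arrangements C" "turn (turn C) \<in> arrangements C"
  by (auto simp: arrangements_def)

lemma arrangements_trans: "A \<in> arrangements B \<Longrightarrow> B \<in> arrangements D \<Longrightarrow> A \<in> arrangements D"
  unfolding arrangements_def[of B] by (auto intro: arrangements_mirror arrangements_turn)

lemma descendants_back:
  assumes "D \<in> descendants C0" "markov C0"
  shows "\<exists>E\<in>insert C0 (descendants C0). cross D \<in> arrangements E"
  using assms(1)
proof cases
  case root0
  then show ?thesis using assms(2) by (auto simp: cross_cross arrangements_self)
next
  case root1
  then show ?thesis using assms(2) by (auto simp: cross_cross markov_turn arrangements_self)
next
  case root2
  then show ?thesis using assms(2) by (auto simp: cross_cross markov_turn arrangements_self)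
next
  case (child1 C)
  then have "markov C" using orbit_markov[OF descendants_orbit assms(2)] by blast
  then show ?thesis using child1 by (auto simp: cross_cross markov_turn intro!: bexI[of _ C] arrangements_self)
next
  case (child2 C)
  then have "markov C" using orbit_markov[OF descendants_orbit assms(2)] by blast
  then show ?thesis using child2 by (auto simp: cross_cross markov_turn intro!: bexI[of _ C] arrangements_self)
qed

text \<open>Crossing the most recent edge again only returns to the parent, so walks without
  backtracking already reach every triangle. This allows induction along a tree.\<close>

lemma orbit_descendants:
  assumes "C \<in> orbit C0" "markov C0"
  shows "\<exists>D\<in>insert C0 (descendants C0). C \<in> arrangements D"
  using assms
proof (induction rule: orbit.induct)
  case base
  show ?case using arrangements_self by blast
next
  case (mirror C)
  then show ?case by (blast intro: arrangements_mirror)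
next
  case (turn C)
  then show ?case by (blast intro: arrangements_turn)
next
  case (cross C)
  then obtain D where D: "D \<in> insert C0 (descendants C0)" "C \<in> arrangements D" by blast
  have 1: "cross (turn D) \<in> descendants C0" "cross (turn (turn D)) \<in> descendants C0"
    using D(1) by (auto intro: descendants.intros)
  have 2: "\<exists>E\<in>insert C0 (descendants C0). cross D \<in> arrangements E"
  proof (cases "D = C0")
    case True
    then show ?thesis using arrangements_self(1)[of "cross C0"] descendants.root0[of C0] by blast
  next
    case False
    then have "D \<in> descendants C0" using D(1) by simp
    then show ?thesis by (rule descendants_back[OF _ cross.prems])
  qed
  show ?case using arrangements_cross[OF D(2)]
  proof (elim disjE)
    assume "cross C \<in> arrangements (cross D)"
    then show ?thesis using 2 arrangements_trans by blast
  next
    assume "cross C \<in> arrangements (cross (turn D))"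
    then show ?thesis using 1 by auto
  next
    assume "cross C \<in> arrangements (cross (turn (turn D)))"
    then show ?thesis using 1 by auto
  qed
qed

text \<open>
  The geodesic of the form lies beyond the edge \<open>pq\<close>.  This persists for all further triangles, and
  already the last inequality forces the new value to be at least \<open>x y / s\<close>, which exceeds 1/3.
\<close>

fun outer :: "cfg \<Rightarrow> bool" where
  "outer (Cfg x P y Q s R) \<longleftrightarrow> P \<ge> 0 \<and> Q \<ge> 0 \<and> s\<^sup>2 * R - x\<^sup>2 * P - y\<^sup>2 * Q \<ge> x * y * s"

lemma outer_third:
  assumes "markov_triple x y s" "outer (Cfg x P y Q s R)"
  shows "R \<ge> x * y / s" "R \<ge> 0"
proof -
  have p: "x \<ge> 1" "y \<ge> 1" "s \<ge> 1" using markov_tripleD[OF assms(1)] by auto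
  have "x\<^sup>2 * P \<ge> 0" "y\<^sup>2 * Q \<ge> 0" using assms(2) by auto
  moreover have "x * y * s \<le> s\<^sup>2 * R - x\<^sup>2 * P - y\<^sup>2 * Q" using assms(2) by simp
  ultimately have "x * y * s \<le> s\<^sup>2 * R" by linarith
  then have "s * (x * y) \<le> s * (s * R)" by (simp add: power2_eq_square mult_ac)
  then have "x * y \<le> s * R" using p by simp
  then show 1: "R \<ge> x * y / s" using p by (simp add: field_simps)
  have "0 \<le> x * y / s" using p by simp
  then show "R \<ge> 0" using 1 by linarith
qed

lemma outer_cross_iff:
  assumes "s \<noteq> 0"
  shows "outer (cross (Cfg x P y Q s R)) \<longleftrightarrow> P \<ge> 0 \<and> Q \<ge> 0 \<and> x * y * s \<le> x\<^sup>2 * P + y\<^sup>2 * Q - s\<^sup>2 * R"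
proof -
  define R' where "R' = (x\<^sup>2 + y\<^sup>2) * (P + Q) / s\<^sup>2 - R"
  have "s\<^sup>2 * R' = (x\<^sup>2 + y\<^sup>2) * (P + Q) - s\<^sup>2 * R"
    using assms by (simp add: R'_def right_diff_distrib)
  then have "s\<^sup>2 * R' - y\<^sup>2 * P - x\<^sup>2 * Q = x\<^sup>2 * P + y\<^sup>2 * Q - s\<^sup>2 * R"
    by (simp add: algebra_simps)
  then show ?thesis
    unfolding cross.simps R'_def[symmetric] outer.simps by (simp add: mult.commute)
qed

text \<open>Over either further edge the dominant term \<open>s\<^sup>2 * R\<close> stays on the
  large side, and one of the other two terms moves there as well, which helps because
  \<open>P\<close> and \<open>Q\<close> are nonnegative.\<close>

lemma outer_child:
  assumes "markov C" "outer C"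
  shows "outer (cross (turn C))" "outer (cross (turn (turn C)))"
proof -
  obtain x P y Q s R where C: "C = Cfg x P y Q s R" by (cases C)
  have m: "markov_triple x y s" using assms C by simp
  have n: "x \<noteq> 0" "y \<noteq> 0" using markov_tripleD(1,2)[OF m] by auto
  have R: "R \<ge> 0" by (rule outer_third(2)[OF m]) (use assms C in simp)
  have o: "P \<ge> 0" "Q \<ge> 0" "s\<^sup>2 * R - x\<^sup>2 * P - y\<^sup>2 * Q \<ge> x * y * s" using assms C by auto
  have nn: "x\<^sup>2 * P \<ge> 0" "y\<^sup>2 * Q \<ge> 0" using o by auto
  have e: "y * s * x = x * y * s" "s * x * y = x * y * s" by simp_all
  show "outer (cross (turn C))"
    unfolding C turn.simps outer_cross_iff[OF n(1)] e(1) using R o nn by linarith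
  show "outer (cross (turn (turn C)))"
    unfolding C turn.simps outer_cross_iff[OF n(2)] e(2) using R o nn by linarith
qed

text \<open>By the discriminant equation the square of the quantity to be bounded is
  \<open>(x y s)\<^sup>2 + 4 x\<^sup>2 y\<^sup>2 P Q\<close>, and the sign conditions make both that
  quantity and \<open>P Q\<close> nonnegative.\<close>

lemma outer_start:
  assumes "markov (Cfg x P y Q s R)" "unit_disc (Cfg x P y Q s R)" "P \<ge> 0" "Q \<ge> 0" "R \<le> 0"
  shows "outer (cross (Cfg x P y Q s R))"
proof -
  have n: "s \<noteq> 0" using markov_tripleD(3)[of x y s] assms(1) by auto
  let ?h = "x\<^sup>2 * P + y\<^sup>2 * Q - s\<^sup>2 * R"
  have nn: "x\<^sup>2 * P \<ge> 0" "y\<^sup>2 * Q \<ge> 0" "s\<^sup>2 * R \<le> 0" using assms by (auto simp: mult_nonneg_nonpos)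
  have pq: "4 * x\<^sup>2 * y\<^sup>2 * (P * Q) \<ge> 0" using assms by simp
  have "?h = - (s\<^sup>2 * R - x\<^sup>2 * P - y\<^sup>2 * Q)" by simp
  then have "?h\<^sup>2 = (s\<^sup>2 * R - x\<^sup>2 * P - y\<^sup>2 * Q)\<^sup>2" by (simp only: power2_minus)
  also have "\<dots> = x\<^sup>2 * y\<^sup>2 * (s\<^sup>2 + 4 * P * Q)" using assms(2) by simp
  also have "\<dots> = (x * y * s)\<^sup>2 + 4 * x\<^sup>2 * y\<^sup>2 * (P * Q)"
    by (simp add: algebra_simps power_mult_distrib)
  finally have "(x * y * s)\<^sup>2 \<le> ?h\<^sup>2" using pq by linarith
  then have "x * y * s \<le> ?h" by (rule power2_le_imp_le) (use nn in linarith)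
  then show ?thesis unfolding outer_cross_iff[OF n] using assms by blast
qed

text \<open>Crossing only permutes the determinants, so their product and maximum are constant on an
  orbit. Since \<open>x y / s = k / s\<^sup>2\<close>, the bound of \<open>outer_third\<close> is at
  least \<open>k / c\<^sup>2\<close> everywhere.\<close>

fun det_bound :: "real \<Rightarrow> real \<Rightarrow> cfg \<Rightarrow> bool" where
  "det_bound c k (Cfg x P y Q s R) \<longleftrightarrow> x * y * s = k \<and> x \<le> c \<and> y \<le> c \<and> s \<le> c"

lemma orbit_det_bound: "C \<in> orbit C0 \<Longrightarrow> det_bound c k C0 \<Longrightarrow> det_bound c k C"
proof (induction rule: orbit.induct)
  case (mirror C) then show ?case by (cases C rule: cfg.exhaust) (auto simp: mult_ac)
next
  case (turn C) then show ?case by (cases C rule: cfg.exhaust) (auto simp: mult_ac)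
next
  case (cross C) then show ?case by (cases C rule: cfg.exhaust) (auto simp: mult_ac)
qed

lemma outer_good:
  assumes "markov C" "det_bound c k C" "outer C" "\<mu> \<le> k / c\<^sup>2" "C = Cfg x P y Q s R"
  shows "R \<ge> \<mu>"
proof -
  have m: "markov_triple x y s" using assms by simp
  have p: "x \<ge> 1" "y \<ge> 1" "s \<ge> 1" using markov_tripleD[OF m] by auto
  have k: "k = x * y * s" "s \<le> c" using assms by auto
  have "k / c\<^sup>2 \<le> k / s\<^sup>2" using k p by (intro divide_left_mono power_mono mult_pos_pos) auto
  also have "\<dots> = x * y / s" using p by (simp add: k field_simps power2_eq_square)
  also have "\<dots> \<le> R" by (rule outer_third(1)[OF m]) (use assms in simp)
  finally show ?thesis using assms(4) by simp
qed

lemma turn_negate: "turn (negate C) = negate (turn C)"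
  by (cases C) auto

text \<open>\<open>I\<close> is to hold of the triangles that the geodesic meets. Once a walk leaves
  them, the form or its negative stays positive and each newest vertex is large; older vertices were
  checked at the parent.\<close>

lemma orbit_values_lower_bound:
  assumes markov: "markov C0" and d: "det_bound c k C0" and \<mu>: "\<mu> \<le> k / c\<^sup>2"
    and g0: "\<And>v. v \<in> vertex_values C0 \<Longrightarrow> v = 0 \<or> \<bar>v\<bar> \<ge> \<mu>"
    and root: "\<And>N. N \<in> {cross C0, cross (turn C0), cross (turn (turn C0))} \<Longrightarrow> I N \<or> outer N \<or> outer (negate N)"
    and good: "\<And>C v. I C \<Longrightarrow> v \<in> vertex_values C \<Longrightarrow> v = 0 \<or> \<bar>v\<bar> \<ge> \<mu>"
    and step: "\<And>C N. I C \<Longrightarrow> N \<in> {cross (turn C), cross (turn (turn C))} \<Longrightarrow> I N \<or> outer N \<or> outer (negate N)"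
    and v: "v \<in> orbit_values C0"
  shows "v = 0 \<or> \<bar>v\<bar> \<ge> \<mu>"
proof -
  let ?g = "\<lambda>C. \<forall>v\<in>vertex_values C. v = 0 \<or> \<bar>v\<bar> \<ge> \<mu>"
  let ?J = "\<lambda>C. I C \<or> outer C \<or> outer (negate C)"
  have aux: "?g (cross C)" if C: "?g C" "C \<in> orbit C0" and J: "?J (cross C)" for C
  proof (cases "I (cross C)")
    case True
    then show ?thesis using good by blast
  next
    case False
    obtain x P y Q s R where e: "cross C = Cfg x P y Q s R" by (cases "cross C")
    have o: "cross C \<in> orbit C0" using C by (intro orbit.intros)
    have PQ: "P \<in> vertex_values C" "Q \<in> vertex_values C" using e by (cases C; auto)+
    have mm: "markov (cross C)" "det_bound c k (cross C)" using o orbit_markov orbit_det_bound markov d by blast+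
    then have mm': "markov (negate (cross C))" "det_bound c k (negate (cross C))" unfolding e by auto
    have "R \<ge> \<mu> \<or> - R \<ge> \<mu>" using False J outer_good[OF mm _ \<mu> e] outer_good[OF mm' _ \<mu>] e by auto
    then show ?thesis using PQ C(1) unfolding e by force
  qed
  have descendants: "?g C \<and> ?J C" if "C \<in> descendants C0" for C
    using that
  proof (induction rule: descendants.induct)
    case root0
    then show ?case using root[of "cross C0"] aux[of C0] g0 orbit.base by simp
  next
    case root1
    then show ?case using root[of "cross (turn C0)"] aux[of "turn C0"] g0 by (auto intro: orbit.intros)
  next
    case root2
    then show ?case using root[of "cross (turn (turn C0))"] aux[of "turn (turn C0)"] g0 by (auto intro: orbit.intros)
  next
    case (child1 C)
    have o: "C \<in> orbit C0" "turn C \<in> orbit C0" using child1 descendants_orbit orbit.turn by blast+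
    have "markov C" using o orbit_markov markov by blast
    moreover have "markov (negate C)" using \<open>markov C\<close> by (cases C) auto
    moreover have "negate (cross (turn C)) = cross (turn (negate C))" by (simp add: cross_negate turn_negate)
    ultimately have "?J (cross (turn C))" using child1.IH step[of C "cross (turn C)"] outer_child(1)[of C] outer_child(1)[of "negate C"] by auto
    then show ?case using aux[OF _ o(2)] child1.IH by simp
  next
    case (child2 C)
    have o: "C \<in> orbit C0" "turn (turn C) \<in> orbit C0" using child2 descendants_orbit orbit.turn by blast+
    have "markov C" using o orbit_markov markov by blast
    moreover have "markov (negate C)" using \<open>markov C\<close> by (cases C) auto
    moreover have "negate (cross (turn (turn C))) = cross (turn (turn (negate C)))" by (simp add: cross_negate turn_negate)
    ultimately have "?J (cross (turn (turn C)))" using child2.IH step[of C "cross (turn (turn C))"] outer_child(2)[of C] outer_child(2)[of "negate C"] by auto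
    then show ?case using aux[OF _ o(2)] child2.IH by simp
  qed
  obtain C where C: "C \<in> orbit C0" "v \<in> vertex_values C" using v by (auto simp: orbit_values_def)
  obtain D where D: "D \<in> insert C0 (descendants C0)" "C \<in> arrangements D" using orbit_descendants[OF C(1) markov] by blast
  have "v \<in> vertex_values D" using C D vertex_values_arrangements by blast
  then show ?thesis using D(1) descendants g0 by blast
qed

section \<open>Markov fractions\<close>

text \<open>\<open>s\<close> and \<open>3 x y - s\<close> are the roots of
  \<open>Z\<^sup>2 - 3 x y Z + x\<^sup>2 + y\<^sup>2\<close>. This polynomial is not positive at the
  maximum of \<open>x\<close> and \<open>y\<close>, which therefore lies between the roots.\<close>

lemma markov_triple_descent:
  assumes m: "markov_triple x y s" and le: "x \<le> s" "y \<le> s" and ne: "s \<noteq> 1"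
  shows "3 * x * y - s < s"
proof -
  define z where "z = max x y"
  note p = markov_tripleD[OF m]
  have "(z - s) * (z - (3 * x * y - s)) \<le> 0 \<and> (z = s \<longrightarrow> s = 1)"
  proof (cases "x \<le> y")
    case True
    then have z: "z = y" by (simp add: z_def)
    have "(y - s) * (y - (3 * x * y - s)) = y\<^sup>2 - 3*x*y*y + (x\<^sup>2 + y\<^sup>2)"
      using p(5) by (simp add: algebra_simps power2_eq_square)
    also have "\<dots> = (x\<^sup>2 - y\<^sup>2) + 3 * y\<^sup>2 * (1 - x)" by (simp add: algebra_simps power2_eq_square)
    finally have e: "(y - s) * (y - (3 * x * y - s)) = (x\<^sup>2 - y\<^sup>2) + 3 * y\<^sup>2 * (1 - x)" .
    have a: "x\<^sup>2 \<le> y\<^sup>2" using True p by (intro power_mono) auto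
    have b: "3 * y\<^sup>2 * (1 - x) \<le> 0" using p by (intro mult_nonneg_nonpos) auto
    have "s = 1" if "y = s"
    proof -
      have "(x\<^sup>2 - y\<^sup>2) + 3 * y\<^sup>2 * (1 - x) = 0" using e that by simp
      then have "x\<^sup>2 = y\<^sup>2" "3 * y\<^sup>2 * (1 - x) = 0" using a b by linarith+
      then have "x = 1" "x = y" using p by (auto simp: power2_eq_iff)
      then show ?thesis using that by simp
    qed
    moreover have "(y - s) * (y - (3 * x * y - s)) \<le> 0" unfolding e using a b by linarith
    ultimately show ?thesis unfolding z by blast
  next
    case False
    then have z: "z = x" by (simp add: z_def)
    have "(x - s) * (x - (3 * x * y - s)) = x\<^sup>2 - 3*x*y*x + (x\<^sup>2 + y\<^sup>2)"
      using p(5) by (simp add: algebra_simps power2_eq_square)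
    also have "\<dots> = (y\<^sup>2 - x\<^sup>2) + 3 * x\<^sup>2 * (1 - y)" by (simp add: algebra_simps power2_eq_square)
    finally have e: "(x - s) * (x - (3 * x * y - s)) = (y\<^sup>2 - x\<^sup>2) + 3 * x\<^sup>2 * (1 - y)" .
    have a: "y\<^sup>2 < x\<^sup>2" using False p by (intro power_strict_mono) auto
    have b: "3 * x\<^sup>2 * (1 - y) \<le> 0" using p by (intro mult_nonneg_nonpos) auto
    have "(x - s) * (x - (3 * x * y - s)) < 0" unfolding e using a b by linarith
    then show ?thesis unfolding z by auto
  qed
  moreover have "z \<le> s" using le by (simp add: z_def)
  ultimately have "z < s" "(z - s) * (z - (3 * x * y - s)) \<le> 0" using ne by force+
  then have "z - (3 * x * y - s) \<ge> 0" by (simp add: mult_le_0_iff)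
  then show ?thesis using \<open>z < s\<close> by linarith
qed

lemma Rats_flip: "markov C \<Longrightarrow> vertex_values C \<subseteq> \<rat> \<Longrightarrow> vertex_values (flip C) \<subseteq> \<rat>"
  and Rats_cross: "markov C \<Longrightarrow> vertex_values C \<subseteq> \<rat> \<Longrightarrow> vertex_values (cross C) \<subseteq> \<rat>"
  using Ints_subset_Rats
  by (cases C; auto simp: markov_triple_def power2_eq_square intro!: Rats_diff Rats_divide Rats_mult Rats_add)+

lemma orbit_Rats: "C \<in> orbit C0 \<Longrightarrow> markov C0 \<Longrightarrow> vertex_values C0 \<subseteq> \<rat> \<Longrightarrow> vertex_values C \<subseteq> \<rat>"
  by (induction rule: orbit.induct) (auto dest: Rats_cross[OF orbit_markov, THEN subsetD])

section \<open>Descent from a Markov triangulation to the Farey triangulation\<close>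

fun det_sum :: "cfg \<Rightarrow> real" where
  "det_sum (Cfg x P y Q s R) = x + y + s"

lemma max_third: "\<exists>x P y Q s R. Cfg x P y Q s R \<in> arrangements C \<and> x \<le> s \<and> y \<le> s"
proof -
  obtain x P y Q s R where C: "C = Cfg x P y Q s R" by (cases C)
  consider "x \<le> s" "y \<le> s" | "x \<le> y" "s \<le> y" | "s \<le> x" "y \<le> x" by linarith
  then show ?thesis
  proof cases
    case 1 then show ?thesis using C arrangements_self by blast
  next
    case 2
    then have "Cfg s R x P y Q \<in> arrangements C" using C by (simp add: arrangements_def)
    then show ?thesis using 2 by blast
  next
    case 3
    then have "Cfg y Q s R x P \<in> arrangements C" using C by (simp add: arrangements_def)
    then show ?thesis using 3 by blast
  qed
qed

lemma arrangements_orbit: "C \<in> arrangements D \<Longrightarrow> C \<in> orbit D"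
  using orbit_arrangements orbit.base by blast

text \<open>Flipping the longest edge is the Vieta descent to (1,1,1). It keeps the set of values,
  and so links a form prescribed on an arbitrary Markov triangle with a rational number.\<close>

lemma reduce_to_unit_dets:
  assumes "markov C" "unit_disc C" "vertex_values C \<subseteq> \<rat>"
  shows "\<exists>A B D. orbit_values (Cfg 1 A 1 B 1 D) = orbit_values C \<and> unit_disc (Cfg 1 A 1 B 1 D) \<and> {A, B, D} \<subseteq> \<rat>"
  using assms
proof (induction "nat \<lfloor>det_sum C\<rfloor>" arbitrary: C rule: less_induct)
  case less
  obtain x P y Q s R where C: "Cfg x P y Q s R \<in> arrangements C" "x \<le> s" "y \<le> s" using max_third by blast
  let ?C = "Cfg x P y Q s R"
  have o: "?C \<in> orbit C" using arrangements_orbit[OF C(1)] .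
  have m: "markov ?C" "unit_disc ?C" "vertex_values ?C \<subseteq> \<rat>" "orbit_values ?C = orbit_values C"
    using orbit_markov[OF o] orbit_unit_disc[OF o] orbit_Rats[OF o] orbit_values_orbit[OF o] less.prems by blast+
  have ds: "det_sum ?C = det_sum C" using C(1) by (cases C) (auto simp: arrangements_def)
  have t: "markov_triple x y s" using m by simp
  show ?case
  proof (cases "s = 1")
    case True
    then have "x = 1" "y = 1" using markov_tripleD(1,2)[OF t] C by auto
    then show ?thesis using m True by auto
  next
    case False
    have lt: "3 * x * y - s < s" using markov_triple_descent[OF t C(2,3) False] .
    have f: "det_sum (flip ?C) = x + y + (3 * x * y - s)" using markov_tripleD(6)[OF t] by simp
    have int: "x + y + s \<in> \<int>" "x + y + (3 * x * y - s) \<in> \<int>" using t by (auto simp: markov_triple_def)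
    obtain i j where ij: "x + y + s = of_int i" "x + y + (3 * x * y - s) = of_int j"
      using int by (auto elim!: Ints_cases)
    have "markov_triple x y (3 * x * y - s)" by (rule markov_triple_flip[OF t])
    then have "x + y + (3 * x * y - s) > 0" using markov_tripleD(1-3) by (smt (verit))
    then have "nat \<lfloor>det_sum (flip ?C)\<rfloor> < nat \<lfloor>det_sum C\<rfloor>"
      unfolding f ds[symmetric] using lt ij by simp
    moreover have "markov (flip ?C)" "unit_disc (flip ?C)" "vertex_values (flip ?C) \<subseteq> \<rat>" "orbit_values (flip ?C) = orbit_values C"
      using markov_flip[OF m(1)] unit_disc_flip[OF m(1,2)] Rats_flip[OF m(1,3)] orbit_values_flip[OF m(1)] m(4) by auto
    ultimately show ?thesis using less.hyps by metis
  qed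
qed

fun unit_dets :: "cfg \<Rightarrow> bool" where
  "unit_dets (Cfg x P y Q s R) \<longleftrightarrow> x = 1 \<and> y = 1 \<and> s = 1"

lemma orbit_unit_dets: "C \<in> orbit C0 \<Longrightarrow> unit_dets C0 \<Longrightarrow> unit_dets C"
proof (induction rule: orbit.induct)
  case (mirror C) then show ?case by (cases C rule: cfg.exhaust) auto
next
  case (turn C) then show ?case by (cases C rule: cfg.exhaust) auto
next
  case (cross C) then show ?case by (cases C rule: cfg.exhaust) auto
qed

text \<open>With unit determinants and value 0 at the second vertex, the discriminant equation says
  that the other two values differ by 1, as they do in \<open>farey\<close>.\<close>

lemma reduce_to_farey:
  assumes "markov C" "unit_disc C" "vertex_values C \<subseteq> \<rat>" "0 \<in> orbit_values C"
  shows "\<exists>\<alpha>\<in>\<rat>. orbit_values (farey \<alpha>) = orbit_values C"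
proof -
  obtain A B D where F: "orbit_values (Cfg 1 A 1 B 1 D) = orbit_values C" "unit_disc (Cfg 1 A 1 B 1 D)" "{A, B, D} \<subseteq> \<rat>"
    using reduce_to_unit_dets[OF assms(1-3)] by blast
  let ?F = "Cfg 1 A 1 B 1 D"
  obtain C' where C': "C' \<in> orbit ?F" "0 \<in> vertex_values C'" using assms(4) unfolding F(1)[symmetric] by (auto simp: orbit_values_def)
  obtain x P y Q s R where e: "C' = Cfg x P y Q s R" by (cases C')
  have e1: "x = 1" "y = 1" "s = 1" using orbit_unit_dets[OF C'(1)] e by auto
  have "\<exists>P' R'. Cfg 1 P' 1 0 1 R' \<in> arrangements C'" using C'(2) unfolding e e1 by (auto simp: arrangements_def)
  then obtain P' R' where G: "Cfg 1 P' 1 0 1 R' \<in> arrangements C'" by blast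
  then have o: "Cfg 1 P' 1 0 1 R' \<in> orbit ?F" using C'(1) orbit_arrangements by blast
  have u: "unit_disc (Cfg 1 P' 1 0 1 R')" using orbit_unit_disc[OF o markov_farey F(2)] .
  have r: "P' \<in> \<rat>" "R' \<in> \<rat>" using orbit_Rats[OF o markov_farey] F(3) by auto
  have "(R' - P')\<^sup>2 = 1" using u by simp
  then have "R' = P' - 1 \<or> P' = R' - 1" by (auto simp: power2_eq_1_iff)
  then show ?thesis
  proof
    assume "R' = P' - 1"
    then show ?thesis using r orbit_values_orbit[OF o markov_farey] F(1) by (intro bexI[of _ P']) auto
  next
    assume a: "P' = R' - 1"
    have "Cfg 1 R' 1 0 1 P' \<in> orbit ?F"
      by (rule orbit_arrangements[OF o]) (simp add: arrangements_def)
    from orbit_values_orbit[OF this markov_farey] show ?thesis using r F(1) a by (intro bexI[of _ R']) auto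
  qed
qed

lemma orbit_values_farey_shift: "orbit_values (farey (\<beta> + of_int n)) = orbit_values (farey \<beta>)"
proof -
  have "{rat_form (\<beta> + of_int n) x y |x y. coprime x y} \<subseteq> {rat_form \<beta> x y |x y. coprime x y}" for \<beta> n
  proof clarify
    fix x y :: int assume "coprime x y"
    then have "coprime x (y - n * x)"
      using gcd_add_mult[of x "- n" y] by (simp add: coprime_iff_gcd_eq_1 add.commute)
    moreover have "rat_form (\<beta> + of_int n) x y = rat_form \<beta> x (y - n * x)" by (simp add: rat_form_def algebra_simps)
    ultimately show "\<exists>x' y'. rat_form (\<beta> + of_int n) x y = rat_form \<beta> x' y' \<and> coprime x' y'" by blast
  qed
  from this[of \<beta> n] this[of "\<beta> + of_int n" "- n"] show ?thesis unfolding orbit_values_farey by auto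
qed

lemma least_abs_in_Z_spectrum:
  assumes "\<alpha> \<in> \<rat>" "\<alpha> \<notin> \<int>"
  shows "least_abs (orbit_values (farey \<alpha>)) \<in> Z_spectrum"
proof -
  obtain r where r: "\<alpha> = of_rat r" using assms(1) by (auto elim: Rats_cases)
  obtain a b where ab: "quotient_of r = (a, b)" by (cases "quotient_of r")
  have b0: "b > 0" using ab quotient_of_denom_pos by blast
  have e: "\<alpha> = of_int a / of_int b" using quotient_of_div[OF ab] r by (simp add: of_rat_divide)
  have "b \<noteq> 1" using e assms(2) by auto
  then have b: "b \<ge> 2" using b0 by simp
  have "orbit_values (farey (frac \<alpha>)) = orbit_values (farey \<alpha>)" using orbit_values_farey_shift[of "frac \<alpha>" "\<lfloor>\<alpha>\<rfloor>"] by (simp add: frac_def)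
  then have "least_abs (orbit_values (farey \<alpha>)) = Zval r" using Zval_eq_least_abs[OF ab b] e by simp
  then show ?thesis using b ab unfolding Z_spectrum_def by auto
qed

text \<open>The geodesic is the edge \<open>pq\<close> itself, so \<open>P\<close> and
  \<open>Q\<close> vanish and discriminant 1 gives \<open>R = x y / s\<close>. It enters no
  triangle: \<open>I\<close> is empty, and all three neighbours are outer for the form or its
  negative. Their bound \<open>k / s\<^sup>2\<close> is again \<open>R\<close>.\<close>

lemma markov_fraction_in_spectrum:
  assumes m: "markov_triple x y s" and lt: "x \<le> s" "y < s"
  shows "x * y / s \<in> Z_spectrum"
proof -
  note p = markov_tripleD[OF m]
  define R where "R = x * y / s"
  let ?C = "Cfg x 0 y 0 s R"
  have R0: "R > 0" using p by (simp add: R_def)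
  have markov: "markov ?C" using m by simp
  have u: "unit_disc ?C" using p by (simp add: R_def field_simps power2_eq_square)
  have d: "det_bound s (x * y * s) ?C" using lt by simp
  have RV: "R \<in> orbit_values ?C" "0 \<in> orbit_values ?C" using orbit.base[of ?C] unfolding orbit_values_def by force+
  have big: "v = 0 \<or> \<bar>v\<bar> \<ge> R" if v: "v \<in> orbit_values ?C" for v
  proof (rule orbit_values_lower_bound[where I = "\<lambda>_. False", OF markov d _ _ _ _ _ v])
    show "R \<le> x * y * s / s\<^sup>2" using p by (simp add: R_def power2_eq_square)
    show "v = 0 \<or> R \<le> \<bar>v\<bar>" if "v \<in> vertex_values ?C" for v using that by auto
    have u1: "unit_disc (negate ?C)" "unit_disc (turn ?C)" "unit_disc (turn (turn ?C))" using u unit_disc_turn by auto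
    have m1: "markov (negate ?C)" "markov (turn ?C)" "markov (turn (turn ?C))"
      using markov markov_turn[OF markov] markov_turn[OF markov_turn[OF markov]] by auto
    have "outer (cross (negate ?C))" using outer_start[of x 0 y 0 s "- R"] R0 u1(1) m1(1) by simp
    moreover have "outer (cross (turn ?C))" using outer_start[of y 0 s R x 0] R0 u1(2) m1(2) by simp
    moreover have "outer (cross (turn (turn ?C)))" using outer_start[of s R x 0 y 0] R0 u1(3) m1(3) by simp
    ultimately show "False \<or> outer N \<or> outer (negate N)" if "N \<in> {cross ?C, cross (turn ?C), cross (turn (turn ?C))}" for N
      using that unfolding cross_negate by blast
  qed auto
  have rat: "vertex_values ?C \<subseteq> \<rat>" using m Ints_subset_Rats
    by (auto simp: R_def markov_triple_def intro!: Rats_divide Rats_mult)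
  obtain \<alpha> where \<alpha>: "\<alpha> \<in> \<rat>" "orbit_values (farey \<alpha>) = orbit_values ?C" using reduce_to_farey[OF markov u rat RV(2)] by blast
  have R1: "R < 1"
  proof -
    have "x\<^sup>2 \<le> s\<^sup>2" "y\<^sup>2 < s\<^sup>2" using lt p by (auto intro!: power_mono power_strict_mono)
    then have "3 * x * y * s < 3 * s\<^sup>2" using p(4) by linarith
    then have "s * (x * y) < s * s" by (simp add: power2_eq_square mult_ac)
    then have "x * y < s" using p by simp
    then show ?thesis using p by (simp add: R_def field_simps)
  qed
  \<comment> \<open>For integral \<alpha> all values would be integers, but
    \<open>0 < R < 1\<close>.\<close>
  have "\<alpha> \<notin> \<int>"
  proof
    assume "\<alpha> \<in> \<int>"
    then obtain k where k: "\<alpha> = of_int k" by (auto elim: Ints_cases)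
    obtain i j where "R = rat_form \<alpha> i j" using RV(1) unfolding \<alpha>(2)[symmetric] orbit_values_farey by blast
    then have "R = of_int (i * (k * i - j))" by (simp add: rat_form_def k)
    then have "0 < i * (k * i - j)" "i * (k * i - j) < 1" using R0 R1 by (metis of_int_0_less_iff, metis of_int_less_1_iff)
    then show False by linarith
  qed
  then have "least_abs (orbit_values ?C) \<in> Z_spectrum" using least_abs_in_Z_spectrum[OF \<alpha>(1)] \<alpha>(2) by simp
  moreover have "least_abs (orbit_values ?C) = R"
  proof (rule antisym)
    show "least_abs (orbit_values ?C) \<le> R" using least_abs_le[OF RV(1)] R0 by simp
    show "R \<le> least_abs (orbit_values ?C)" by (rule least_abs_ge[OF _ RV(1)]) (use big R0 in auto)
  qed
  ultimately show ?thesis by (simp add: R_def)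
qed

text \<open>The larger root of \<open>z\<^sup>2 - 3 c z + 1\<close>; the limit points are the numbers \<open>c / rho c\<close>.\<close>

definition rho :: "real \<Rightarrow> real" where
  "rho c = (3 * c + sqrt (9 * c\<^sup>2 - 4)) / 2"

lemma rho_props:
  assumes "c \<ge> 1"
  shows "rho c \<ge> 2 * c" "rho c * (3 * c - rho c) = 1" "3 * c - rho c = 1 / rho c"
    "2 * c / (sqrt (9 * c\<^sup>2 - 4) + 3 * c) = c / rho c"
proof -
  have "c\<^sup>2 \<ge> 1" using assms by (simp add: one_le_power)
  then have s: "9 * c\<^sup>2 - 4 \<ge> c\<^sup>2" by simp
  then have "sqrt (c\<^sup>2) \<le> sqrt (9 * c\<^sup>2 - 4)" by (rule real_sqrt_le_mono)
  then have "sqrt (9 * c\<^sup>2 - 4) \<ge> c" using assms by simp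
  then show 1: "rho c \<ge> 2 * c" by (simp add: rho_def)
  have "0 \<le> 9 * c\<^sup>2 - 4" using \<open>c\<^sup>2 \<ge> 1\<close> by linarith
  then have q: "(sqrt (9 * c\<^sup>2 - 4))\<^sup>2 = 9 * c\<^sup>2 - 4" by simp
  have "rho c * (3 * c - rho c) = (9 * c\<^sup>2 - (sqrt (9 * c\<^sup>2 - 4))\<^sup>2) / 4"
    by (simp add: rho_def field_simps power2_eq_square)
  then show 2: "rho c * (3 * c - rho c) = 1" unfolding q by simp
  have n: "rho c > 0" using 1 assms by simp
  then show "3 * c - rho c = 1 / rho c" using 2 by (simp add: field_simps)
  have "sqrt (9 * c\<^sup>2 - 4) + 3 * c = 2 * rho c" by (simp add: rho_def)
  then show "2 * c / (sqrt (9 * c\<^sup>2 - 4) + 3 * c) = c / rho c" by simp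
qed

text \<open>A rational square root of an integer is an integer, and \<open>9 k\<^sup>2 - 4\<close>
  lies strictly between \<open>(3 k - 1)\<^sup>2\<close> and \<open>(3 k)\<^sup>2\<close>.\<close>

lemma sqrt_markov_irrational:
  assumes "c \<in> \<int>" "c \<ge> 1"
  shows "sqrt (9 * c\<^sup>2 - 4) \<notin> \<rat>"
proof
  obtain k where k: "c = of_int k" using assms(1) by (auto elim: Ints_cases)
  have k1: "k \<ge> 1" using assms k by simp
  have "k * k \<ge> 1 * 1" using k1 by (intro mult_mono) auto
  then have kk: "k\<^sup>2 \<ge> 1" by (simp add: power2_eq_square)
  assume "sqrt (9 * c\<^sup>2 - 4) \<in> \<rat>"
  then obtain m n :: nat where mn: "n \<noteq> 0" "\<bar>sqrt (9 * c\<^sup>2 - 4)\<bar> = real m / real n" "coprime m n"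
    by (rule Rats_abs_nat_div_natE)
  have pos: "9 * c\<^sup>2 - 4 \<ge> 0" using kk unfolding k of_int_power[symmetric] by linarith
  have "9 * c\<^sup>2 - 4 = (real m / real n)\<^sup>2" using pos mn(2)[symmetric] by simp
  then have "(9 * c\<^sup>2 - 4) * (real n)\<^sup>2 = (real m)\<^sup>2" using mn(1) by (simp add: field_simps)
  then have "real_of_int ((9 * k\<^sup>2 - 4) * (int n)\<^sup>2) = real_of_int ((int m)\<^sup>2)" by (simp add: k)
  then have e: "(9 * k\<^sup>2 - 4) * (int n)\<^sup>2 = (int m)\<^sup>2" by (simp only: of_int_eq_iff)
  then have "(int n)\<^sup>2 dvd (int m)\<^sup>2" by (metis dvd_triv_right)
  then have "int n dvd int m" by simp
  then have "n dvd m" by simp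
  then have "n = 1" using mn(3) by (metis coprime_common_divisor dvd_refl nat_dvd_1_iff_1)
  then have e: "9 * k\<^sup>2 - 4 = (int m)\<^sup>2" using e by simp
  have "(3 * k - 1)\<^sup>2 < (int m)\<^sup>2" using k1 kk unfolding e[symmetric] by (simp add: power2_eq_square algebra_simps)
  then have "3 * k - 1 < int m" by (rule power2_less_imp_less) simp
  moreover have "(int m)\<^sup>2 < (3 * k)\<^sup>2" unfolding e[symmetric] by (simp add: power2_eq_square)
  then have "int m < 3 * k" by (rule power2_less_imp_less) (use k1 in simp)
  ultimately show False by simp
qed

lemma rho_irrational:
  assumes "c \<in> \<int>" "c \<ge> 1"
  shows "rho c \<notin> \<rat>"
proof
  assume "rho c \<in> \<rat>"
  moreover have "c \<in> \<rat>" using assms(1) Ints_subset_Rats by blast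
  ultimately have "2 * rho c - 3 * c \<in> \<rat>" by simp
  moreover have "2 * rho c - 3 * c = sqrt (9 * c\<^sup>2 - 4)" by (simp add: rho_def field_simps)
  ultimately show False using sqrt_markov_irrational[OF assms] by simp
qed

text \<open>\<open>s - rho m y\<close> shrinks by the factor \<open>rho m\<close> from one triple with entry \<open>m\<close> to the next, so \<open>s / y\<close> tends to \<open>rho m\<close>.\<close>

lemma markov_triple_chain:
  assumes "markov_triple m y0 s0"
  shows "\<exists>K\<ge>0. \<forall>n::nat. \<exists>y s. markov_triple m y s \<and> y < s \<and> m \<le> s \<and> real n \<le> s \<and> \<bar>s - rho m * y\<bar> \<le> K"
proof -
  note p0 = markov_tripleD[OF assms]
  note r = rho_props[OF p0(1)]
  have next_trip: "markov_triple m s (3 * m * s - y)" if "markov_triple m y s" for y s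
    by (rule markov_triple_flip[OF markov_triple_mirror[OF markov_triple_turn[OF markov_triple_turn[OF that]]]])
  have grow: "2 * m * s \<le> 3 * m * s - y" if "markov_triple m y s" "y \<le> s" for y s
  proof -
    have "1 * s \<le> m * s" using markov_tripleD[OF that(1)] by (intro mult_right_mono) auto
    then show ?thesis using that by simp
  qed
  have ms: "m \<le> m * s" "s \<le> m * s" if "markov_triple m y s" for y s
    using markov_tripleD[OF that] by (auto simp: mult_le_cancel_left1 mult_le_cancel_right1)
  have "\<exists>y s. markov_triple m y s \<and> y \<le> s"
  proof (cases "y0 \<le> s0")
    case True then show ?thesis using assms by blast
  next
    case False
    moreover have "markov_triple m s0 y0" by (rule markov_triple_mirror[OF markov_triple_turn[OF markov_triple_turn[OF assms]]])
    ultimately show ?thesis by (intro exI[of _ s0] exI[of _ y0]) auto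
  qed
  then obtain a b where ab: "markov_triple m a b" "a \<le> b" by blast
  \<comment> \<open>One Vieta move in advance provides the inequalities \<open>y < s\<close> and
    \<open>m \<le> s\<close> that \<open>markov_fraction_in_spectrum\<close> asks for.\<close>
  define y1 s1 where "y1 = b" and "s1 = 3 * m * b - a"
  have b1: "markov_triple m y1 s1" "y1 < s1" "m \<le> s1"
    using next_trip[OF ab(1)] grow[OF ab] ms[OF ab(1)] markov_tripleD(1,3)[OF ab(1)]
    unfolding y1_def s1_def by (blast, linarith, linarith)
  define K where "K = \<bar>s1 - rho m * y1\<bar>"
  have "\<exists>y s. markov_triple m y s \<and> y < s \<and> m \<le> s \<and> real n \<le> s \<and> \<bar>s - rho m * y\<bar> \<le> K" for n :: nat
  proof (induction n)
    case 0
    show ?case using b1 markov_tripleD(3)[OF b1(1)] by (intro exI[of _ y1] exI[of _ s1]) (auto simp: K_def)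
  next
    case (Suc n)
    then obtain y s where ys: "markov_triple m y s" "y < s" "m \<le> s" "real n \<le> s" "\<bar>s - rho m * y\<bar> \<le> K" by blast
    have g: "2 * m * s \<le> 3 * m * s - y" by (rule grow) (use ys in simp_all)
    note q = markov_tripleD[OF ys(1)] ms[OF ys(1)]
    have "3 * m * s - y - rho m * s = (s - rho m * y) / rho m"
    proof -
      have "3 * m * s - y - rho m * s = (3 * m - rho m) * s - y" by (simp add: algebra_simps)
      also have "\<dots> = (s - rho m * y) / rho m" unfolding r(3) using r(1) p0(1) by (simp add: diff_divide_distrib)
      finally show ?thesis .
    qed
    then have "\<bar>3 * m * s - y - rho m * s\<bar> = \<bar>s - rho m * y\<bar> / rho m" using r(1) p0(1) by simp
    also have "\<dots> \<le> \<bar>s - rho m * y\<bar>" using r(1) p0(1) by (simp add: divide_le_eq mult_le_cancel_left1)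
    finally have "\<bar>3 * m * s - y - rho m * s\<bar> \<le> K" using ys(5) by simp
    moreover have "s < 3 * m * s - y" "m \<le> 3 * m * s - y" "real (Suc n) \<le> 3 * m * s - y"
      using g q(3,7,8) ys(3,4) p0(1) unfolding of_nat_Suc by linarith+
    ultimately show ?case using next_trip[OF ys(1)] by blast
  qed
  then show ?thesis using K_def by (intro exI[of _ K]) auto
qed

text \<open>The approximants are \<open>m y / s\<close> along a chain of triples with entry
  \<open>m\<close>. They exceed 1/3 because the Markov equation gives
  \<open>s\<^sup>2 < 3 m y s\<close>, and differ from the limit because \<open>rho m\<close> is
  irrational.\<close>

lemma markov_islimpt:
  assumes "markoff_number m"
  shows "(2 * real m / (sqrt (9 * (real m)\<^sup>2 - 4) + 3 * real m)) islimpt (Z_spectrum \<inter> {1/3<..})"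
proof -
  have "\<exists>y s. markov_triple (real m) y s"
  proof -
    obtain x y z where t: "markoff_triple x y z" "m = x \<or> m = y \<or> m = z"
      using assms by (auto simp: markoff_number_def)
    have h: "x\<^sup>2 + y\<^sup>2 + z\<^sup>2 = 3 * x * y * z" "x > 0" "y > 0" "z > 0" using t by (auto simp: markoff_triple_def)
    have "real (x\<^sup>2 + y\<^sup>2 + z\<^sup>2) = real (3 * x * y * z)" using h(1) by (simp only:)
    then have "(real x)\<^sup>2 + (real y)\<^sup>2 + (real z)\<^sup>2 = 3 * real x * real y * real z"
      by (simp only: of_nat_add of_nat_mult of_nat_power of_nat_numeral)
    then have a: "markov_triple (real x) (real y) (real z)"
      using h(2-4) unfolding markov_triple_def by simp
    show ?thesis using t(2) a markov_triple_turn[OF a] markov_triple_turn[OF markov_triple_turn[OF a]] by auto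
  qed
  then obtain y0 s0 where m0: "markov_triple (real m) y0 s0" by blast
  note p = markov_tripleD[OF m0]
  note r = rho_props[OF p(1)]
  obtain K where K: "K \<ge> 0" "\<And>n::nat. \<exists>y s. markov_triple m y s \<and> y < s \<and> real m \<le> s \<and> real n \<le> s \<and> \<bar>s - rho m * y\<bar> \<le> K"
    using markov_triple_chain[OF m0] by blast
  have rp: "rho m > 0" using r(1) p(1) by simp
  show ?thesis unfolding r(4) islimpt_approachable
  proof (intro allI impI)
    fix e :: real assume e: "e > 0"
    obtain n :: nat where n: "real n > real m * K / (e * rho m)" using reals_Archimedean2 by blast
    obtain y s where ys: "markov_triple m y s" "y < s" "real m \<le> s" "real n \<le> s" "\<bar>s - rho m * y\<bar> \<le> K" using K(2) by blast
    note q = markov_tripleD[OF ys(1)]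
    let ?v = "real m * y / s"
    have "?v \<in> Z_spectrum" using markov_fraction_in_spectrum[OF ys(1)] ys by simp
    moreover have "?v > 1 / 3"
    proof -
      have "s\<^sup>2 < 3 * real m * y * s" unfolding q(4)[symmetric] using q(1,2) by (simp add: sum_power2_gt_zero_iff)
      then have "s * s < s * (3 * (real m * y))" by (simp add: power2_eq_square mult_ac)
      then have "s < 3 * (real m * y)" using q(3) by simp
      then show ?thesis using q(3) by (simp add: field_simps)
    qed
    moreover have "?v \<noteq> real m / rho m"
    proof
      assume a: "?v = real m / rho m"
      have "real m \<in> \<rat>" "y \<in> \<rat>" "s \<in> \<rat>" using ys(1) Ints_subset_Rats by (auto simp: markov_triple_def)
      moreover have "rho m = s / y" using a rp q by (simp add: field_simps)
      ultimately have "rho m \<in> \<rat>" by simp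
      then show False using rho_irrational[of "real m"] p(1) by simp
    qed
    moreover have "dist ?v (real m / rho m) < e"
    proof -
      have "?v - real m / rho m = real m * (rho m * y - s) / (s * rho m)"
        using rp q(3) by (simp add: field_simps)
      then have "\<bar>?v - real m / rho m\<bar> = real m * \<bar>s - rho m * y\<bar> / (s * rho m)"
        using rp q(3) by (simp add: abs_mult abs_minus_commute)
      also have "\<dots> \<le> real m * K / (s * rho m)"
        using ys(5) rp q(3) by (intro divide_right_mono mult_left_mono) auto
      also have "\<dots> < e"
      proof -
        have "real m * K / (e * rho m) < s" using n ys(4) by simp
        then show ?thesis using e rp q(3) by (simp add: field_simps)
      qed
      finally show ?thesis by (simp add: dist_real_def)
    qed
    ultimately show "\<exists>x'\<in>Z_spectrum \<inter> {1/3<..}. x' \<noteq> real m / rho m \<and> dist x' (real m / rho m) < e"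
      by (intro bexI[of _ ?v]) auto
  qed
qed

section \<open>Strips\<close>

text \<open>
  A geodesic that never crosses edges of determinant \<open>c\<close> runs through a strip of triangles
  \<open>v\<^sub>i v\<^sub>i\<^sub>+\<^sub>1 v\<^sub>i\<^sub>+\<^sub>2\<close>: the determinants of \<open>v\<^sub>i v\<^sub>i\<^sub>+\<^sub>1\<close> alternate between \<open>\<sigma>\<close> and \<open>\<tau>\<close>, those of
  \<open>v\<^sub>i v\<^sub>i\<^sub>+\<^sub>2\<close> equal \<open>c\<close>, and \<open>F i\<close> is the value at \<open>v\<^sub>i\<close>.
\<close>

definition side :: "real \<Rightarrow> real \<Rightarrow> nat \<Rightarrow> real" where
  "side \<sigma> \<tau> i = (if even i then \<sigma> else \<tau>)"

definition strip_cfg :: "real \<Rightarrow> real \<Rightarrow> real \<Rightarrow> (nat \<Rightarrow> real) \<Rightarrow> nat \<Rightarrow> cfg" where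
  "strip_cfg \<sigma> \<tau> c F i = Cfg (side \<sigma> \<tau> (Suc i)) (F i) c (F (i + 1)) (side \<sigma> \<tau> i) (F (i + 2))"

text \<open>The value that \<open>cross\<close> gives to the vertex beyond
  \<open>v\<^sub>i\<^sub>+\<^sub>1 v\<^sub>i\<^sub>+\<^sub>2\<close>. It is stated for one index
  because a strip obeys it only up to its end.\<close>

definition strip_step :: "real \<Rightarrow> real \<Rightarrow> real \<Rightarrow> (nat \<Rightarrow> real) \<Rightarrow> nat \<Rightarrow> bool" where
  "strip_step \<sigma> \<tau> c F i \<longleftrightarrow>
     F (i + 3) = (c\<^sup>2 + (side \<sigma> \<tau> i)\<^sup>2) * (F (i + 1) + F (i + 2)) / (side \<sigma> \<tau> (Suc i))\<^sup>2 - F i"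

text \<open>The strip is continued indefinitely, whether or not the geodesic stays inside; the signs
  of the values tell later where it leaves.\<close>

fun strip_seq :: "real \<Rightarrow> real \<Rightarrow> real \<Rightarrow> real \<Rightarrow> real \<Rightarrow> real \<Rightarrow> nat \<Rightarrow> real" where
  "strip_seq \<sigma> \<tau> c A B D 0 = A"
| "strip_seq \<sigma> \<tau> c A B D (Suc 0) = B"
| "strip_seq \<sigma> \<tau> c A B D (Suc (Suc 0)) = D"
| "strip_seq \<sigma> \<tau> c A B D (Suc (Suc (Suc i))) =
     (c\<^sup>2 + (side \<sigma> \<tau> i)\<^sup>2) * (strip_seq \<sigma> \<tau> c A B D (Suc i) + strip_seq \<sigma> \<tau> c A B D (Suc (Suc i))) / (side \<sigma> \<tau> (Suc i))\<^sup>2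
       - strip_seq \<sigma> \<tau> c A B D i"

lemma strip_seq_strip_step: "strip_step \<sigma> \<tau> c (strip_seq \<sigma> \<tau> c A B D) i"
  by (simp add: strip_step_def eval_nat_numeral)

lemma side_simps [simp]: "side \<sigma> \<tau> 0 = \<sigma>" "side \<sigma> \<tau> (Suc 0) = \<tau>" "side \<sigma> \<tau> (Suc (Suc i)) = side \<sigma> \<tau> i"
  by (auto simp: side_def)

lemma markov_triple_side:
  assumes "markov_triple \<sigma> \<tau> c"
  shows "markov_triple (side \<sigma> \<tau> (Suc i)) c (side \<sigma> \<tau> i)"
proof (cases "even i")
  case True
  then show ?thesis using markov_triple_turn[OF assms] by (simp add: side_def)
next
  case False
  then show ?thesis using markov_triple_mirror[OF markov_triple_turn[OF markov_triple_turn[OF assms]]] by (simp add: side_def)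
qed

lemma side_bounds:
  assumes "markov_triple \<sigma> \<tau> c" "\<sigma> \<le> c" "\<tau> \<le> c"
  shows "1 \<le> side \<sigma> \<tau> i" "side \<sigma> \<tau> i \<le> c"
  using assms markov_tripleD[OF assms(1)] by (auto simp: side_def)

lemma markov_strip_cfg: "markov_triple \<sigma> \<tau> c \<Longrightarrow> markov (strip_cfg \<sigma> \<tau> c F i)"
  unfolding strip_cfg_def markov.simps by (rule markov_triple_side)

lemma strip_cfg_Suc:
  assumes "strip_step \<sigma> \<tau> c F i"
  shows "cross (turn (strip_cfg \<sigma> \<tau> c F i)) = strip_cfg \<sigma> \<tau> c F (Suc i)"
  using assms by (simp add: strip_cfg_def strip_step_def eval_nat_numeral)

lemma strip_cfg_orbit:
  assumes "\<And>j. j < i \<Longrightarrow> strip_step \<sigma> \<tau> c F j"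
  shows "strip_cfg \<sigma> \<tau> c F i \<in> orbit (strip_cfg \<sigma> \<tau> c F 0)"
  using assms
proof (induction i)
  case 0
  show ?case by (rule orbit.base)
next
  case (Suc i)
  then have "cross (turn (strip_cfg \<sigma> \<tau> c F i)) \<in> orbit (strip_cfg \<sigma> \<tau> c F 0)" by (intro orbit.intros) simp
  then show ?case using strip_cfg_Suc[of \<sigma> \<tau> c F i] Suc.prems by simp
qed

lemma strip_val:
  assumes "\<And>j. j < i \<Longrightarrow> strip_step \<sigma> \<tau> c F j" "k \<le> 2"
  shows "F (i + k) \<in> orbit_values (strip_cfg \<sigma> \<tau> c F 0)"
proof -
  have "k = 0 \<or> k = 1 \<or> k = 2" using assms(2) by auto
  then have "F (i + k) \<in> vertex_values (strip_cfg \<sigma> \<tau> c F i)" by (auto simp: strip_cfg_def)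
  then show ?thesis using strip_cfg_orbit[OF assms(1)] unfolding orbit_values_def by blast
qed

text \<open>For discriminant 1 this is the square of the polar form at \<open>p\<close> and
  \<open>q\<close>, a number that a \<open>cfg\<close> does not record.\<close>

lemma unit_disc_nonneg:
  assumes "markov (Cfg x P y Q s R)" "unit_disc (Cfg x P y Q s R)"
  shows "s\<^sup>2 + 4 * P * Q \<ge> 0"
proof -
  have p: "x \<ge> 1" "y \<ge> 1" using markov_tripleD[of x y s] assms(1) by auto
  have "x\<^sup>2 * y\<^sup>2 * (s\<^sup>2 + 4 * P * Q) \<ge> 0"
    using assms(2) unfolding unit_disc.simps by (metis zero_le_power2)
  moreover have "x\<^sup>2 * y\<^sup>2 > 0" using p by simp
  ultimately show ?thesis by (simp add: zero_le_mult_iff)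
qed

text \<open>
  The form at the midpoint of the edge \<open>v\<^sub>i v\<^sub>i\<^sub>+\<^sub>1\<close>.  These midpoints are equally spaced on the closed
  geodesic parallel to the strip, which turns the recursion into one with constant coefficients.
\<close>

definition edge_mean :: "real \<Rightarrow> real \<Rightarrow> (nat \<Rightarrow> real) \<Rightarrow> nat \<Rightarrow> real" where
  "edge_mean \<sigma> \<tau> F i = (F i + F (i + 1)) / side \<sigma> \<tau> i"

text \<open>The Markov equation in the form \<open>c\<^sup>2 + u\<^sup>2 = v (3 u c - v)\<close>
  absorbs the alternating sides. The coefficient \<open>3 c\<close> is the trace of the translation
  along the closed geodesic.\<close>

lemma edge_mean_rec:
  assumes "markov_triple \<sigma> \<tau> c" "strip_step \<sigma> \<tau> c F i"
  shows "edge_mean \<sigma> \<tau> F (i + 2) = 3 * c * edge_mean \<sigma> \<tau> F (i + 1) - edge_mean \<sigma> \<tau> F i"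
proof -
  define u v where "u = side \<sigma> \<tau> i" and "v = side \<sigma> \<tau> (Suc i)"
  have m: "markov_triple v c u" using markov_triple_side[OF assms(1)] by (simp add: u_def v_def)
  have n: "u \<noteq> 0" "v \<noteq> 0" using markov_tripleD(1,3)[OF m] by auto
  have k: "c\<^sup>2 + u\<^sup>2 = v * (3 * u * c - v)" using markov_tripleD(4)[OF m] by (simp add: power2_eq_square algebra_simps)
  define X where "X = F (i + 1) + F (i + 2)"
  have "F (i + 3) = (c\<^sup>2 + u\<^sup>2) * X / v\<^sup>2 - F i" using assms(2) by (simp add: strip_step_def u_def v_def X_def)
  also have "(c\<^sup>2 + u\<^sup>2) * X / v\<^sup>2 = (3 * u * c - v) * X / v"
    unfolding k using n by (simp add: power2_eq_square)
  finally have F3: "F (i + 3) = (3 * u * c - v) * X / v - F i" .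
  have e: "F (i + 2) + F (i + 3) = 3 * u * c * (X / v) - (F i + F (i + 1))"
    unfolding F3 using n by (simp add: X_def field_simps)
  have "edge_mean \<sigma> \<tau> F (i + 2) = (F (i + 2) + F (i + 3)) / u" by (simp add: edge_mean_def u_def eval_nat_numeral)
  also have "\<dots> = 3 * c * (X / v) - (F i + F (i + 1)) / u"
    unfolding e using n by (simp add: diff_divide_distrib)
  also have "\<dots> = 3 * c * edge_mean \<sigma> \<tau> F (i + 1) - edge_mean \<sigma> \<tau> F i"
    by (simp add: edge_mean_def X_def u_def v_def)
  finally show ?thesis .
qed

text \<open>This combination annihilates the decaying solution and so isolates the growing
  one.\<close>

lemma edge_mean_defect:
  assumes "markov_triple \<sigma> \<tau> c" "\<And>j. j < i \<Longrightarrow> strip_step \<sigma> \<tau> c F j"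
  shows "edge_mean \<sigma> \<tau> F (i + 1) - edge_mean \<sigma> \<tau> F i / rho c = rho c ^ i * (edge_mean \<sigma> \<tau> F 1 - edge_mean \<sigma> \<tau> F 0 / rho c)"
  using assms(2)
proof (induction i)
  case 0
  show ?case by simp
next
  case (Suc i)
  have c: "c \<ge> 1" using markov_tripleD(3)[OF assms(1)] .
  note r = rho_props[OF c]
  have rp: "rho c \<noteq> 0" using r(1) c by auto
  have IH: "edge_mean \<sigma> \<tau> F (i + 1) - edge_mean \<sigma> \<tau> F i / rho c = rho c ^ i * (edge_mean \<sigma> \<tau> F 1 - edge_mean \<sigma> \<tau> F 0 / rho c)"
    using Suc by simp
  have g: "edge_mean \<sigma> \<tau> F (i + 2) = 3 * c * edge_mean \<sigma> \<tau> F (i + 1) - edge_mean \<sigma> \<tau> F i"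
    using edge_mean_rec[OF assms(1)] Suc.prems by simp
  have "edge_mean \<sigma> \<tau> F (i + 2) - edge_mean \<sigma> \<tau> F (i + 1) / rho c = (3 * c - 1 / rho c) * edge_mean \<sigma> \<tau> F (i + 1) - edge_mean \<sigma> \<tau> F i"
    unfolding g by (simp add: algebra_simps)
  also have "3 * c - 1 / rho c = rho c" using r(3) by simp
  also have "rho c * edge_mean \<sigma> \<tau> F (i + 1) - edge_mean \<sigma> \<tau> F i = rho c * (edge_mean \<sigma> \<tau> F (i + 1) - edge_mean \<sigma> \<tau> F i / rho c)"
    using rp by (simp add: algebra_simps)
  finally show ?case unfolding IH by simp
qed

text \<open>For values of opposite sign, \<open>unit_disc_nonneg\<close> bounds the product of their
  absolute values by \<open>c\<^sup>2 / 4\<close>; since each factor is at least \<open>t\<close>,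
  neither can be large.\<close>

lemma strip_bounded:
  assumes m: "markov_triple \<sigma> \<tau> c" "\<sigma> \<le> c" "\<tau> \<le> c" and u: "unit_disc (strip_cfg \<sigma> \<tau> c F i)"
    and t: "t > 0" "\<bar>F i\<bar> \<ge> t" "\<bar>F (i + 1)\<bar> \<ge> t" and neg: "F i * F (i + 1) < 0"
  shows "\<bar>F i\<bar> \<le> c\<^sup>2 / (4 * t)" "\<bar>F (i + 1)\<bar> \<le> c\<^sup>2 / (4 * t)"
proof -
  have "(side \<sigma> \<tau> i)\<^sup>2 + 4 * F i * F (i + 1) \<ge> 0"
    using unit_disc_nonneg u markov_strip_cfg[OF m(1), of F i] unfolding strip_cfg_def by blast
  moreover have "\<bar>F i\<bar> * \<bar>F (i + 1)\<bar> = - (F i * F (i + 1))" using neg by (simp add: abs_mult[symmetric])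
  moreover have "(side \<sigma> \<tau> i)\<^sup>2 \<le> c\<^sup>2" using side_bounds[OF m, of i] by (intro power_mono) auto
  ultimately have b: "4 * (\<bar>F i\<bar> * \<bar>F (i + 1)\<bar>) \<le> c\<^sup>2" by linarith
  have "4 * (\<bar>F i\<bar> * t) \<le> 4 * (\<bar>F i\<bar> * \<bar>F (i + 1)\<bar>)" using t by (intro mult_left_mono) auto
  then have "4 * (\<bar>F i\<bar> * t) \<le> c\<^sup>2" using b by linarith
  then show "\<bar>F i\<bar> \<le> c\<^sup>2 / (4 * t)" using t(1) by (simp add: field_simps)
  have "4 * (t * \<bar>F (i + 1)\<bar>) \<le> 4 * (\<bar>F i\<bar> * \<bar>F (i + 1)\<bar>)" using t by (intro mult_left_mono mult_right_mono) auto
  then have "4 * (t * \<bar>F (i + 1)\<bar>) \<le> c\<^sup>2" using b by linarith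
  then show "\<bar>F (i + 1)\<bar> \<le> c\<^sup>2 / (4 * t)" using t(1) by (simp add: field_simps)
qed

text \<open>Boundedness leaves only the decaying solution of the recursion, whose ratio is irrational.\<close>

lemma strip_not_forever:
  assumes m: "markov_triple \<sigma> \<tau> c" "\<sigma> \<le> c" "\<tau> \<le> c" and st: "\<And>i. strip_step \<sigma> \<tau> c F i"
    and u: "unit_disc (strip_cfg \<sigma> \<tau> c F 0)" and t: "t > 0" "\<And>i. \<bar>F i\<bar> \<ge> t"
    and rat: "\<And>i. F i \<in> \<rat>" and neg: "\<And>i. F i * F (i + 1) < 0"
  shows False
proof -
  have c: "c \<ge> 1" and cZ: "c \<in> \<int>" using m(1) by (auto simp: markov_triple_def)
  note r = rho_props[OF c]
  have r2: "rho c \<ge> 2" using r(1) c by simp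
  define K where "K = c\<^sup>2 / (4 * t)"
  have b: "\<bar>F i\<bar> \<le> K" for i
    unfolding K_def
    using strip_bounded(1)[OF m orbit_unit_disc[OF strip_cfg_orbit markov_strip_cfg[OF m(1)] u] t(1) t(2) t(2) neg] st by blast
  have g: "\<bar>edge_mean \<sigma> \<tau> F i\<bar> \<le> 2 * K" for i
  proof -
    have "\<bar>edge_mean \<sigma> \<tau> F i\<bar> = \<bar>F i + F (i + 1)\<bar> / side \<sigma> \<tau> i"
      unfolding edge_mean_def using side_bounds(1)[OF m, of i] by simp
    also have "\<dots> \<le> \<bar>F i + F (i + 1)\<bar>" using side_bounds(1)[OF m, of i]
      by (simp add: divide_le_eq mult_le_cancel_left1)
    also have "\<dots> \<le> 2 * K" using b[of i] b[of "i + 1"] by linarith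
    finally show ?thesis .
  qed
  define W where "W = edge_mean \<sigma> \<tau> F 1 - edge_mean \<sigma> \<tau> F 0 / rho c"
  have "W = 0"
  proof (rule ccontr)
    assume W: "W \<noteq> 0"
    have "2 ^ i * \<bar>W\<bar> \<le> 4 * K" for i
    proof -
      have "2 ^ i * \<bar>W\<bar> \<le> rho c ^ i * \<bar>W\<bar>" using r2 by (intro mult_right_mono power_mono) auto
      also have "\<dots> = \<bar>edge_mean \<sigma> \<tau> F (i + 1) - edge_mean \<sigma> \<tau> F i / rho c\<bar>"
        unfolding edge_mean_defect[OF m(1) st] W_def using r2 by (simp add: abs_mult)
      also have "\<dots> \<le> \<bar>edge_mean \<sigma> \<tau> F (i + 1)\<bar> + \<bar>edge_mean \<sigma> \<tau> F i / rho c\<bar>" by (rule abs_triangle_ineq4)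
      also have "\<bar>edge_mean \<sigma> \<tau> F i / rho c\<bar> \<le> \<bar>edge_mean \<sigma> \<tau> F i\<bar>"
        using r2 by (simp add: divide_le_eq mult_le_cancel_left1)
      finally show ?thesis using g[of i] g[of "i + 1"] by linarith
    qed
    moreover obtain i where "4 * K / \<bar>W\<bar> < 2 ^ i" using real_arch_pow[of 2 "4 * K / \<bar>W\<bar>"] by auto
    then have "4 * K < 2 ^ i * \<bar>W\<bar>" using W by (simp add: field_simps)
    ultimately show False by (meson not_le)
  qed
  have gr: "edge_mean \<sigma> \<tau> F i \<in> \<rat>" for i
  proof -
    have "\<sigma> \<in> \<rat>" "\<tau> \<in> \<rat>" using m(1) Ints_subset_Rats by (auto simp: markov_triple_def)
    then show ?thesis using rat unfolding edge_mean_def side_def by simp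
  qed
  have g1: "edge_mean \<sigma> \<tau> F 1 = edge_mean \<sigma> \<tau> F 0 / rho c" using \<open>W = 0\<close> by (simp add: W_def)
  have g0: "edge_mean \<sigma> \<tau> F 0 = 0"
  proof (rule ccontr)
    assume a: "edge_mean \<sigma> \<tau> F 0 \<noteq> 0"
    then have n1: "edge_mean \<sigma> \<tau> F 1 \<noteq> 0" using g1 r2 by auto
    have "rho c = edge_mean \<sigma> \<tau> F 0 / edge_mean \<sigma> \<tau> F 1" using g1 n1 r2 by (simp add: field_simps)
    then have "rho c \<in> \<rat>" using gr by simp
    then show False using rho_irrational[OF cZ c] by simp
  qed
  \<comment> \<open>The remaining case is the closed geodesic itself: the edge means vanish and the
    first values are \<open>f\<close>, \<open>- f\<close>, \<open>f\<close>. The discriminant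
    equation then gives \<open>(9 c\<^sup>2 - 4) f\<^sup>2 = c\<^sup>2\<close>, impossible for
    rational \<open>f\<close>.\<close>
  define f where "f = F 0"
  have st0: "\<sigma> \<noteq> 0" "\<tau> \<noteq> 0" using markov_tripleD[OF m(1)] by auto
  have F1: "F 1 = - f" using g0 st0 by (simp add: edge_mean_def f_def)
  have F2: "F 2 = f" using g0 g1 st0 F1 by (simp add: edge_mean_def eval_nat_numeral)
  have "unit_disc (turn (turn (strip_cfg \<sigma> \<tau> c F 0)))" by (intro unit_disc_turn u)
  then have "(c\<^sup>2 * (- f) - \<sigma>\<^sup>2 * f - \<tau>\<^sup>2 * f)\<^sup>2 = \<sigma>\<^sup>2 * \<tau>\<^sup>2 * (c\<^sup>2 + 4 * f * f)"
    using F1 F2 by (simp add: strip_cfg_def f_def eval_nat_numeral)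
  moreover have "(c\<^sup>2 * (- f) - \<sigma>\<^sup>2 * f - \<tau>\<^sup>2 * f)\<^sup>2 = (\<sigma>\<^sup>2 + \<tau>\<^sup>2 + c\<^sup>2)\<^sup>2 * f\<^sup>2"
    by (simp add: algebra_simps power2_eq_square)
  ultimately have "\<sigma>\<^sup>2 * \<tau>\<^sup>2 * (9 * c\<^sup>2 * f\<^sup>2) = \<sigma>\<^sup>2 * \<tau>\<^sup>2 * (c\<^sup>2 + 4 * f\<^sup>2)"
    unfolding markov_tripleD(4)[OF m(1)] by (simp add: algebra_simps power2_eq_square)
  then have "9 * c\<^sup>2 * f\<^sup>2 = c\<^sup>2 + 4 * f\<^sup>2" using st0 by simp
  then have e: "(9 * c\<^sup>2 - 4) * f\<^sup>2 = c\<^sup>2" by (simp add: algebra_simps)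
  have f0: "f \<noteq> 0" using t(1) t(2)[of 0] by (auto simp: f_def)
  have "9 * c\<^sup>2 - 4 = (c / f)\<^sup>2" using e f0 by (simp add: field_simps)
  then have "sqrt (9 * c\<^sup>2 - 4) = \<bar>c / f\<bar>" by simp
  moreover have "c / f \<in> \<rat>" using rat[of 0] cZ Ints_subset_Rats unfolding f_def by (intro Rats_divide) auto
  ultimately have "sqrt (9 * c\<^sup>2 - 4) \<in> \<rat>" by (simp only: Rats_abs_iff)
  then show False using sqrt_markov_irrational[OF cZ c] by simp
qed

text \<open>The geodesic cuts off the vertex opposite to the longest edge.\<close>

fun corner :: "real set \<Rightarrow> cfg \<Rightarrow> bool" where
  "corner U (Cfg x P y Q s R) \<longleftrightarrow> markov_triple x y s \<and> x \<le> s \<and> y \<le> s \<and> unit_disc (Cfg x P y Q s R) \<and>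
     orbit_values (Cfg x P y Q s R) = U \<and> P * R < 0 \<and> Q * R < 0"

fun third_det :: "cfg \<Rightarrow> real" where
  "third_det (Cfg x P y Q s R) = s"

definition strip :: "real \<Rightarrow> real \<Rightarrow> real \<Rightarrow> nat \<Rightarrow> (nat \<Rightarrow> real) \<Rightarrow> bool" where
  "strip \<sigma> \<tau> c M F \<longleftrightarrow> markov_triple \<sigma> \<tau> c \<and> \<sigma> \<le> c \<and> \<tau> \<le> c \<and> M \<ge> 3 \<and> F 0 = 0 \<and> F M = 0 \<and>
     (\<forall>i. 0 < i \<and> i + 1 < M \<longrightarrow> F i * F (i + 1) < 0) \<and>
     (\<forall>i. i + 3 \<le> M \<longrightarrow> strip_step \<sigma> \<tau> c F i) \<and>
     (\<forall>i. i + 2 \<le> M \<longrightarrow> unit_disc (strip_cfg \<sigma> \<tau> c F i))"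

lemma vertex_values_subset_orbit_values: "vertex_values C \<subseteq> orbit_values C"
  using orbit.base[of C] unfolding orbit_values_def by blast

text \<open>\<open>R\<close> has the opposite sign to \<open>P\<close> and \<open>Q\<close>, so the
  three terms in the discriminant equation add up in absolute value, and the Markov equation turns
  their least possible sum into \<open>3 x y s t\<close>. The extreme case where all three values
  have absolute value \<open>t\<close> gives the claim.\<close>

lemma corner_bound:
  assumes c: "corner U (Cfg x P y Q s R)" and t: "t > 0" "\<And>v. v \<in> U \<Longrightarrow> v \<noteq> 0 \<Longrightarrow> \<bar>v\<bar> \<ge> t"
  shows "t\<^sup>2 * (9 * s\<^sup>2 - 4) \<le> s\<^sup>2"
proof (rule ccontr)
  assume neg: "\<not> ?thesis"
  have m: "markov_triple x y s" and le: "x \<le> s" "y \<le> s" using c by auto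
  note p = markov_tripleD[OF m]
  have u: "(s\<^sup>2 * R - x\<^sup>2 * P - y\<^sup>2 * Q)\<^sup>2 = x\<^sup>2 * y\<^sup>2 * (s\<^sup>2 + 4 * P * Q)" using c by simp
  have sg: "P * R < 0" "Q * R < 0" using c by auto
  have "{P, Q, R} \<subseteq> U" using c vertex_values_subset_orbit_values[of "Cfg x P y Q s R"] by simp
  then have ge: "\<bar>P\<bar> \<ge> t" "\<bar>Q\<bar> \<ge> t" "\<bar>R\<bar> \<ge> t" using t(2)[of P] t(2)[of Q] t(2)[of R] sg by fastforce+
  define a b where "a = \<bar>P\<bar> - t" and "b = \<bar>Q\<bar> - t"
  have ab: "a \<ge> 0" "b \<ge> 0" using ge by (auto simp: a_def b_def)
  have PQ: "P * Q = (t + a) * (t + b)"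
    using sg by (auto simp: a_def b_def abs_if mult_less_0_iff)
  have "\<bar>s\<^sup>2 * R - x\<^sup>2 * P - y\<^sup>2 * Q\<bar> = s\<^sup>2 * \<bar>R\<bar> + x\<^sup>2 * (t + a) + y\<^sup>2 * (t + b)"
  proof (cases "R > 0")
    case True
    then have "P < 0" "Q < 0" using sg by (auto simp: mult_less_0_iff)
    moreover have "s\<^sup>2 * R \<ge> 0" "x\<^sup>2 * P \<le> 0" "y\<^sup>2 * Q \<le> 0"
      using True calculation by (auto simp: mult_nonneg_nonpos)
    moreover from this have "\<bar>s\<^sup>2 * R - x\<^sup>2 * P - y\<^sup>2 * Q\<bar> = s\<^sup>2 * R - x\<^sup>2 * P - y\<^sup>2 * Q" by linarith
    ultimately show ?thesis using True by (simp add: a_def b_def)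
  next
    case False
    then have "P > 0" "Q > 0" "R < 0" using sg by (auto simp: mult_less_0_iff)
    moreover have "s\<^sup>2 * R \<le> 0" "x\<^sup>2 * P \<ge> 0" "y\<^sup>2 * Q \<ge> 0"
      using calculation by (auto simp: mult_nonneg_nonpos)
    moreover from this have "\<bar>s\<^sup>2 * R - x\<^sup>2 * P - y\<^sup>2 * Q\<bar> = - (s\<^sup>2 * R - x\<^sup>2 * P - y\<^sup>2 * Q)" by linarith
    ultimately show ?thesis by (simp add: a_def b_def)
  qed
  also have "\<dots> \<ge> s\<^sup>2 * t + x\<^sup>2 * (t + a) + y\<^sup>2 * (t + b)"
    using ge(3) by (simp add: mult_left_mono)
  finally have "s\<^sup>2 * t + x\<^sup>2 * (t + a) + y\<^sup>2 * (t + b) \<le> \<bar>s\<^sup>2 * R - x\<^sup>2 * P - y\<^sup>2 * Q\<bar>" .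
  moreover have "s\<^sup>2 * t + x\<^sup>2 * (t + a) + y\<^sup>2 * (t + b) = 3 * x * y * s * t + (x\<^sup>2 * a + y\<^sup>2 * b)"
    unfolding p(4)[symmetric] by (simp add: algebra_simps)
  moreover have nn: "3 * x * y * s * t + (x\<^sup>2 * a + y\<^sup>2 * b) \<ge> 0" using p ab t(1) by simp
  ultimately have "(3 * x * y * s * t + (x\<^sup>2 * a + y\<^sup>2 * b))\<^sup>2 \<le> \<bar>s\<^sup>2 * R - x\<^sup>2 * P - y\<^sup>2 * Q\<bar>\<^sup>2"
    by (intro power_mono) auto
  then have l: "(3 * x * y * s * t + (x\<^sup>2 * a + y\<^sup>2 * b))\<^sup>2 \<le> x\<^sup>2 * y\<^sup>2 * (s\<^sup>2 + 4 * ((t + a) * (t + b)))"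
    using u PQ by (simp add: mult.assoc)
  have xy: "x\<^sup>2 * y\<^sup>2 > 0" using p by simp
  have "x\<^sup>2 * y\<^sup>2 * s\<^sup>2 < x\<^sup>2 * y\<^sup>2 * (t\<^sup>2 * (9 * s\<^sup>2 - 4))" using neg xy by (intro mult_strict_left_mono) auto
  then have "(3 * x * y * s * t + (x\<^sup>2 * a + y\<^sup>2 * b))\<^sup>2
      < x\<^sup>2 * y\<^sup>2 * (t\<^sup>2 * (9 * s\<^sup>2 - 4)) + x\<^sup>2 * y\<^sup>2 * (4 * ((t + a) * (t + b)))"
    using l by (simp add: distrib_left)
  \<comment> \<open>The terms without \<open>a\<close> and \<open>b\<close> cancel exactly. The
    linear terms are nonnegative because \<open>x\<close> and \<open>y\<close> do not exceed
    \<open>s\<close>, and the quadratic ones form a square.\<close>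
  moreover have "(3 * x * y * s * t + (x\<^sup>2 * a + y\<^sup>2 * b))\<^sup>2
      - (x\<^sup>2 * y\<^sup>2 * (t\<^sup>2 * (9 * s\<^sup>2 - 4)) + x\<^sup>2 * y\<^sup>2 * (4 * ((t + a) * (t + b))))
      = 2 * x * y * t * (a * (x * (3 * x * s - 2 * y)) + b * (y * (3 * y * s - 2 * x))) + (x\<^sup>2 * a - y\<^sup>2 * b)\<^sup>2"
    by (simp add: algebra_simps power2_eq_square)
  moreover have "2 * x * y * t * (a * (x * (3 * x * s - 2 * y)) + b * (y * (3 * y * s - 2 * x))) \<ge> 0"
  proof -
    have "1 * s \<le> x * s" "1 * s \<le> y * s" using p by (auto intro!: mult_right_mono)
    then have "3 * x * s - 2 * y \<ge> 0" "3 * y * s - 2 * x \<ge> 0" using le p(1-3) by linarith+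
    then show ?thesis using p ab t(1) by simp
  qed
  ultimately show False using zero_le_power2[of "x\<^sup>2 * a - y\<^sup>2 * b"] by linarith
qed


lemma side_shift: "side (side \<sigma> \<tau> k) (side \<sigma> \<tau> (Suc k)) i = side \<sigma> \<tau> (k + i)"
  by (auto simp: side_def)

lemma markov_triple_side':
  assumes "markov_triple \<sigma> \<tau> c"
  shows "markov_triple (side \<sigma> \<tau> k) (side \<sigma> \<tau> (Suc k)) c"
  using assms markov_triple_mirror[OF assms] by (auto simp: side_def)

text \<open>
  If the strip through a corner is left over an edge of determinant \<open>c\<close>, three consecutive crossed edges
  share a vertex, and flipping the middle one produces a corner of a larger Markov triple.
\<close>

lemma strip_end_or_larger_corner:
  assumes m: "markov_triple \<sigma> \<tau> c" "\<sigma> \<le> c" "\<tau> \<le> c" and st: "\<And>i. strip_step \<sigma> \<tau> c F i"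
    and u: "unit_disc (strip_cfg \<sigma> \<tau> c F 0)" and U: "orbit_values (strip_cfg \<sigma> \<tau> c F 0) = U"
    and t: "t > 0" "\<And>v. v \<in> U \<Longrightarrow> v \<noteq> 0 \<Longrightarrow> \<bar>v\<bar> \<ge> t" and rat: "U \<subseteq> \<rat>"
    and alt: "F k * F (k + 1) < 0" "F (k + 1) * F (k + 2) < 0"
  shows "(\<exists>C'. corner U C' \<and> third_det C' \<ge> c + 1) \<or>
    (\<exists>n\<ge>k. (\<forall>i. k \<le> i \<and> i \<le> n + 1 \<longrightarrow> F i * F (i + 1) < 0) \<and> F (n + 3) = 0)"
proof -
  have FU: "F i \<in> U" for i using strip_val[of i \<sigma> \<tau> c F 0] st U by simp
  have ut: "unit_disc (strip_cfg \<sigma> \<tau> c F i)" for i using orbit_unit_disc[OF strip_cfg_orbit markov_strip_cfg[OF m(1)] u] st by blast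
  have mt: "markov (strip_cfg \<sigma> \<tau> c F i)" for i by (rule markov_strip_cfg[OF m(1)])
  have "\<exists>i\<ge>k. \<not> F i * F (i + 1) < 0"
  proof (rule ccontr)
    assume "\<not> ?thesis"
    then have al: "F i * F (i + 1) < 0" if "i \<ge> k" for i using that by blast
    define F' where "F' = (\<lambda>i. F (k + i))"
    let ?\<sigma> = "side \<sigma> \<tau> k" and ?\<tau> = "side \<sigma> \<tau> (Suc k)"
    show False
    proof (rule strip_not_forever[of ?\<sigma> ?\<tau> c F' t])
      show "markov_triple ?\<sigma> ?\<tau> c" by (rule markov_triple_side'[OF m(1)])
      show "?\<sigma> \<le> c" "?\<tau> \<le> c" using side_bounds[OF m] by auto
      show "strip_step ?\<sigma> ?\<tau> c F' i" for i
        using st[of "k + i"] unfolding strip_step_def side_shift F'_def by (simp add: add.assoc)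
      show "unit_disc (strip_cfg ?\<sigma> ?\<tau> c F' 0)"
        using ut[of k] by (simp add: strip_cfg_def F'_def)
      show "t > 0" by fact
      show "\<bar>F' i\<bar> \<ge> t" for i
      proof -
        have "F (k + i) \<noteq> 0" using al[of "k + i"] by auto
        then show ?thesis using t(2)[OF FU[of "k + i"]] by (simp add: F'_def)
      qed
      show "F' i \<in> \<rat>" for i using FU rat by (auto simp: F'_def)
      show "F' i * F' (i + 1) < 0" for i using al[of "k + i"] by (simp add: F'_def add.assoc)
    qed
  qed
  define j where "j = (LEAST i. i \<ge> k \<and> \<not> F i * F (i + 1) < 0)"
  have j: "j \<ge> k" "\<not> F j * F (j + 1) < 0"
    using \<open>\<exists>i\<ge>k. \<not> F i * F (i + 1) < 0\<close> LeastI_ex[of "\<lambda>i. i \<ge> k \<and> \<not> F i * F (i + 1) < 0"]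
    unfolding j_def by auto
  have jl: "F i * F (i + 1) < 0" if "k \<le> i" "i < j" for i
    using that not_less_Least[of i "\<lambda>i. i \<ge> k \<and> \<not> F i * F (i + 1) < 0"] unfolding j_def by blast
  have "j \<noteq> k" "j \<noteq> k + 1" using j(2) alt by (auto simp: add.assoc)
  then have "j \<ge> k + 2" using j(1) by simp
  define n where "n = j - 2"
  have n: "n \<ge> k" "j = n + 2" using \<open>j \<ge> k + 2\<close> by (auto simp: n_def)
  have al: "F i * F (i + 1) < 0" if "k \<le> i" "i \<le> n + 1" for i using jl that n by simp
  have ge: "\<not> F (n + 2) * F (n + 3) < 0" using j(2) n by (simp add: eval_nat_numeral)
  show ?thesis
  proof (cases "F (n + 3) = 0")
    case True
    then show ?thesis using al n by blast
  next
    case False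
    \<comment> \<open>Three consecutive sign changes do not occur: \<open>Z\<close> and
      \<open>W\<close> agree in sign, so the geodesic separates
      \<open>v\<^sub>n\<^sub>+\<^sub>1\<close> from the other three vertices. The flipped diagonal
      from \<open>v\<^sub>n\<close> to \<open>v\<^sub>n\<^sub>+\<^sub>3\<close> is therefore
      opposite to a vertex that is cut off.\<close>
    define X Y Z W where "X = F n" and "Y = F (n + 1)" and "Z = F (n + 2)" and "W = F (n + 3)"
    have xy: "X * Y < 0" "Y * Z < 0" using al[of n] al[of "n + 1"] n by (auto simp: X_def Y_def Z_def add.assoc)
    have zw: "Z * W > 0" using ge False xy by (auto simp: Z_def W_def not_less less_le)
    have yw: "W * Y < 0" using xy zw by (auto simp: mult_less_0_iff zero_less_mult_iff)
    define v w where "v = side \<sigma> \<tau> (Suc n)" and "w = side \<sigma> \<tau> n"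
    have T: "turn (strip_cfg \<sigma> \<tau> c F n) = Cfg c Y w Z v X" by (simp add: strip_cfg_def X_def Y_def Z_def v_def w_def)
    have mT: "markov_triple c w v" using markov_turn[OF mt[of n]] unfolding T by simp
    have W: "W = (c\<^sup>2 + w\<^sup>2) * (Y + Z) / v\<^sup>2 - X"
      using st[of n] by (simp add: strip_step_def W_def X_def Y_def Z_def v_def w_def)
    let ?C = "Cfg c X w W ((c\<^sup>2 + w\<^sup>2) / v) Y"
    have fl: "flip (turn (strip_cfg \<sigma> \<tau> c F n)) = ?C" unfolding T W by simp
    have e: "(c\<^sup>2 + w\<^sup>2) / v = 3 * c * w - v" using markov_tripleD(6)[OF mT] .
    have b: "1 \<le> w" "v \<le> c" "w \<le> c" "1 \<le> c"
      using side_bounds[OF m] markov_tripleD(3)[OF m(1)] by (auto simp: v_def w_def)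
    have "c * 1 \<le> c * w" using b by (intro mult_left_mono) auto
    then have big: "3 * c * w - v \<ge> 2 * c" using b by linarith
    have "corner U ?C"
    proof -
      have "markov ?C" using markov_flip[OF markov_turn[OF mt[of n]]] unfolding fl .
      moreover have "unit_disc ?C" using unit_disc_flip[OF markov_turn[OF mt[of n]] unit_disc_turn[OF ut[of n]]] unfolding fl .
      moreover have "orbit_values ?C = U"
      proof -
        have "turn (strip_cfg \<sigma> \<tau> c F n) \<in> orbit (strip_cfg \<sigma> \<tau> c F 0)" using strip_cfg_orbit st by (intro orbit.turn) blast
        then have "orbit_values (turn (strip_cfg \<sigma> \<tau> c F n)) = U" using orbit_values_orbit[OF _ mt] U by simp
        then show ?thesis using orbit_values_flip[OF markov_turn[OF mt[of n]]] unfolding fl by simp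
      qed
      moreover have "c \<le> (c\<^sup>2 + w\<^sup>2) / v" "w \<le> (c\<^sup>2 + w\<^sup>2) / v" unfolding e using big b by linarith+
      ultimately show ?thesis using xy yw unfolding corner.simps markov.simps by blast
    qed
    moreover have "third_det ?C \<ge> c + 1" using big b unfolding third_det.simps e by linarith
    ultimately show ?thesis by blast
  qed
qed

text \<open>A corner sits somewhere in the middle of its strip. A first run finds one cusp; a second
  run starts at that cusp and goes back, so that it traverses the strip from end to end.\<close>

lemma corner_dichotomy:
  assumes cor: "corner U (Cfg x P y Q s R)"
    and t: "t > 0" "\<And>v. v \<in> U \<Longrightarrow> v \<noteq> 0 \<Longrightarrow> \<bar>v\<bar> \<ge> t" and rat: "U \<subseteq> \<rat>"
  shows "(\<exists>C'. corner U C' \<and> third_det C' \<ge> s + 1) \<or>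
    (\<exists>\<sigma> \<tau> M F. strip \<sigma> \<tau> s M F \<and> orbit_values (strip_cfg \<sigma> \<tau> s F 0) = U)"
proof -
  let ?C = "Cfg x P y Q s R"
  have m0: "markov_triple x y s" "x \<le> s" "y \<le> s" and u0: "unit_disc ?C" and V0: "orbit_values ?C = U" and sg: "P * R < 0" "Q * R < 0"
    using cor by auto
  have m: "markov_triple y x s" using markov_triple_mirror[OF m0(1)] .
  define F where "F = strip_seq y x s P R Q"
  have F012: "F 0 = P" "F 1 = R" "F 2 = Q" by (auto simp: F_def eval_nat_numeral)
  have st: "strip_step y x s F i" for i unfolding F_def by (rule strip_seq_strip_step)
  have "strip_cfg y x s F 0 = mirror (turn (turn ?C))" using F012 by (simp add: strip_cfg_def eval_nat_numeral)
  then have T0: "strip_cfg y x s F 0 \<in> orbit ?C" by (simp only: orbit.intros)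
  have mk0: "markov ?C" using m0 by simp
  have u: "unit_disc (strip_cfg y x s F 0)" by (rule orbit_unit_disc[OF T0 mk0 u0])
  have VU: "orbit_values (strip_cfg y x s F 0) = U" using orbit_values_orbit[OF T0 mk0] V0 by simp
  have "F 0 * F (0 + 1) < 0" "F (0 + 1) * F (0 + 2) < 0" using F012 sg by (auto simp: mult.commute eval_nat_numeral)
  from strip_end_or_larger_corner[OF m m0(3,2) st u VU t rat this]
  consider "\<exists>C'. corner U C' \<and> third_det C' \<ge> s + 1"
    | n where "\<And>i. i \<le> n + 1 \<Longrightarrow> F i * F (i + 1) < 0" "F (n + 3) = 0" by blast
  then show ?thesis
  proof cases
    case 1
    then show ?thesis by blast
  next
    case 2
    define \<sigma> \<tau> where "\<sigma> = side y x n" and "\<tau> = side y x (Suc n)"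
    have ms: "markov_triple \<sigma> \<tau> s" unfolding \<sigma>_def \<tau>_def by (rule markov_triple_side'[OF m])
    have les: "\<sigma> \<le> s" "\<tau> \<le> s" using side_bounds[OF m m0(3,2)] by (auto simp: \<sigma>_def \<tau>_def)
    \<comment> \<open>\<open>H\<close> reads the strip backwards from the cusp
      \<open>v\<^sub>n\<^sub>+\<^sub>3\<close>. Its value 0 breaks the sign pattern at index 0, so
      the second run uses index 1, which is why \<open>H 3\<close> must be known.\<close>
    define H where "H = strip_seq \<sigma> \<tau> s 0 (F (n + 2)) (F (n + 1))"
    have H012: "H 0 = 0" "H 1 = F (n + 2)" "H 2 = F (n + 1)" by (auto simp: H_def eval_nat_numeral)
    have sH: "strip_step \<sigma> \<tau> s H i" for i unfolding H_def by (rule strip_seq_strip_step)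
    have H3: "H 3 = F n"
    proof -
      have "F (n + 3) = (s\<^sup>2 + \<sigma>\<^sup>2) * (F (n + 1) + F (n + 2)) / \<tau>\<^sup>2 - F n"
        using st[of n] by (simp add: strip_step_def \<sigma>_def \<tau>_def)
      moreover have "H 3 = (s\<^sup>2 + \<sigma>\<^sup>2) * (F (n + 2) + F (n + 1)) / \<tau>\<^sup>2"
        using sH[of 0] H012 by (simp add: strip_step_def eval_nat_numeral)
      ultimately show ?thesis using 2(2) by (simp add: add.commute)
    qed
    have "strip_cfg \<sigma> \<tau> s H 0 = mirror (turn (strip_cfg y x s F (Suc n)))"
      using H012 2(2) by (simp add: strip_cfg_def \<sigma>_def \<tau>_def eval_nat_numeral)
    then have TH: "strip_cfg \<sigma> \<tau> s H 0 \<in> orbit (strip_cfg y x s F 0)"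
      using strip_cfg_orbit[OF st] by (auto intro: orbit.intros)
    have mkF: "markov (strip_cfg y x s F 0)" by (rule markov_strip_cfg[OF m])
    have uH: "unit_disc (strip_cfg \<sigma> \<tau> s H 0)" by (rule orbit_unit_disc[OF TH mkF u])
    have VH: "orbit_values (strip_cfg \<sigma> \<tau> s H 0) = U" using orbit_values_orbit[OF TH mkF] VU by simp
    have "H 1 * H (1 + 1) < 0" "H (1 + 1) * H (1 + 2) < 0"
      using H012 H3 2(1)[of "n + 1"] 2(1)[of n] by (auto simp: mult.commute eval_nat_numeral)
    from strip_end_or_larger_corner[OF ms les sH uH VH t rat this]
    consider "\<exists>C'. corner U C' \<and> third_det C' \<ge> s + 1"
      | k where "k \<ge> 1" "\<And>i. 1 \<le> i \<Longrightarrow> i \<le> k + 1 \<Longrightarrow> H i * H (i + 1) < 0" "H (k + 3) = 0" by blast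
    then show ?thesis
    proof cases
      case 1
      then show ?thesis by blast
    next
      case (2 k)
      have "unit_disc (strip_cfg \<sigma> \<tau> s H i)" for i
        using orbit_unit_disc[OF strip_cfg_orbit markov_strip_cfg[OF ms] uH] sH by blast
      then have "strip \<sigma> \<tau> s (k + 3) H"
        unfolding strip_def using ms les H012 2 sH by auto
      then show ?thesis using VH by blast
    qed
  qed
qed

text \<open>If every corner led to a larger one, their longest determinants would be unbounded,
  against \<open>corner_bound\<close> and \<open>t > 1/3\<close>.\<close>

lemma exists_strip:
  assumes cor: "corner U C0" and t: "t > 1 / 3" "\<And>v. v \<in> U \<Longrightarrow> v \<noteq> 0 \<Longrightarrow> \<bar>v\<bar> \<ge> t" and rat: "U \<subseteq> \<rat>"
  shows "\<exists>\<sigma> \<tau> c M F. strip \<sigma> \<tau> c M F \<and> orbit_values (strip_cfg \<sigma> \<tau> c F 0) = U \<and> t\<^sup>2 * (9 * c\<^sup>2 - 4) \<le> c\<^sup>2"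
proof (rule ccontr)
  assume no: "\<not> ?thesis"
  have t0: "t > 0" using t(1) by simp
  have "\<exists>C. corner U C \<and> third_det C \<ge> real n" for n
  proof (induction n)
    case 0
    obtain x P y Q s R where C: "C0 = Cfg x P y Q s R" by (cases C0)
    have "s \<ge> 1" using markov_tripleD(3)[of x y s] cor C by simp
    then show ?case using cor C by (intro exI[of _ C0]) simp
  next
    case (Suc n)
    then obtain x P y Q s R where C: "corner U (Cfg x P y Q s R)" "s \<ge> real n"
      by (metis third_det.simps third_det.cases)
    have "t\<^sup>2 * (9 * s\<^sup>2 - 4) \<le> s\<^sup>2" by (rule corner_bound[OF C(1) t0 t(2)])
    then have "\<exists>C'. corner U C' \<and> third_det C' \<ge> s + 1"
      using corner_dichotomy[OF C(1) t0 t(2) rat] no by blast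
    then show ?case using C(2) by fastforce
  qed
  moreover have tt: "9 * t\<^sup>2 - 1 > 0"
  proof -
    have "(1 / 3)\<^sup>2 < t\<^sup>2" using t(1) by (intro power_strict_mono) auto
    then show ?thesis by (simp add: power2_eq_square)
  qed
  obtain n :: nat where n: "real n > 4 * t\<^sup>2 / (9 * t\<^sup>2 - 1)" using reals_Archimedean2 by blast
  ultimately obtain C where C: "corner U C" "third_det C \<ge> real n" by blast
  obtain x P y Q s R where e: "C = Cfg x P y Q s R" by (cases C)
  have s1: "s \<ge> 1" using markov_tripleD(3)[of x y s] C e by simp
  have "t\<^sup>2 * (9 * s\<^sup>2 - 4) \<le> s\<^sup>2" using corner_bound[OF _ t0 t(2)] C(1) unfolding e by blast
  then have "s\<^sup>2 * (9 * t\<^sup>2 - 1) \<le> 4 * t\<^sup>2" by (simp add: algebra_simps)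
  moreover have "s * (9 * t\<^sup>2 - 1) \<le> s\<^sup>2 * (9 * t\<^sup>2 - 1)"
    using tt s1 by (intro mult_right_mono) (auto simp: power2_eq_square)
  ultimately have "s \<le> 4 * t\<^sup>2 / (9 * t\<^sup>2 - 1)" using tt by (simp add: field_simps)
  then show False using n C(2) e by simp
qed

lemma stripD:
  assumes "strip \<sigma> \<tau> c M F"
  shows "markov_triple \<sigma> \<tau> c" "\<sigma> \<le> c" "\<tau> \<le> c" "M \<ge> 3" "F 0 = 0" "F M = 0"
    "\<And>i. 0 < i \<Longrightarrow> i + 1 < M \<Longrightarrow> F i * F (i + 1) < 0"
    "\<And>i. i + 3 \<le> M \<Longrightarrow> strip_step \<sigma> \<tau> c F i"
    "\<And>i. i + 2 \<le> M \<Longrightarrow> unit_disc (strip_cfg \<sigma> \<tau> c F i)"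
  using assms by (auto simp: strip_def)

section \<open>Symmetries of strips and the equations at their ends\<close>

lemma strip_nonzero:
  assumes s: "strip \<sigma> \<tau> c M F" and i: "0 < i" "i < M"
  shows "F i \<noteq> 0"
proof (cases "i + 1 < M")
  case True
  then show ?thesis using stripD(7)[OF s, of i] i by auto
next
  case False
  then have "F (i - 1) * F (i - 1 + 1) < 0" using stripD(4)[OF s] i by (intro stripD(7)[OF s]) auto
  then show ?thesis using i by auto
qed

lemma strip_mem_orbit_values:
  assumes s: "strip \<sigma> \<tau> c M F" and i: "i \<le> M"
  shows "F i \<in> orbit_values (strip_cfg \<sigma> \<tau> c F 0)"
proof -
  define j where "j = min i (M - 2)"
  have "i = j + (i - j)" "i - j \<le> 2" "j + 2 \<le> M" using i stripD(4)[OF s] by (auto simp: j_def)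
  moreover have "strip_step \<sigma> \<tau> c F k" if "k < j" for k using stripD(8)[OF s] that \<open>j + 2 \<le> M\<close> by simp
  ultimately show ?thesis using strip_val[of j \<sigma> \<tau> c F "i - j"] by simp
qed

lemma strip_step_uminus: "strip_step \<sigma> \<tau> c F i \<Longrightarrow> strip_step \<sigma> \<tau> c (\<lambda>i. - F i) i"
  unfolding strip_step_def by (simp add: algebra_simps diff_divide_distrib add_divide_distrib)

lemma strip_cfg_uminus: "strip_cfg \<sigma> \<tau> c (\<lambda>i. - F i) i = negate (strip_cfg \<sigma> \<tau> c F i)"
  by (simp add: strip_cfg_def)

lemma unit_disc_negate: "unit_disc (negate C) = unit_disc C"
proof (cases C)
  case (Cfg x P y Q s R)
  have "s\<^sup>2 * - R - x\<^sup>2 * - P - y\<^sup>2 * - Q = - (s\<^sup>2 * R - x\<^sup>2 * P - y\<^sup>2 * Q)" by simp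
  then show ?thesis unfolding Cfg negate.simps unit_disc.simps by (simp only: power2_minus) simp
qed

lemma strip_uminus: "strip \<sigma> \<tau> c M F \<Longrightarrow> strip \<sigma> \<tau> c M (\<lambda>i. - F i)"
  unfolding strip_def strip_cfg_uminus unit_disc_negate using strip_step_uminus by auto

lemma strip_reverse:
  assumes s: "strip \<sigma> \<tau> c M F"
  shows "strip (side \<sigma> \<tau> (M - 1)) (side \<sigma> \<tau> (M - 2)) c M (\<lambda>i. F (M - i))"
proof -
  note d = stripD[OF s]
  let ?\<sigma> = "side \<sigma> \<tau> (M - 1)" and ?\<tau> = "side \<sigma> \<tau> (M - 2)" and ?F = "\<lambda>i. F (M - i)"
  \<comment> \<open>Edge \<open>i\<close> of the reversed strip is edge \<open>j\<close> of the
    original with \<open>i + j + 1 = M\<close>; the two new sides follow this parity.\<close>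
  obtain N where N: "M = N + 2" using d(4) by (intro that[of "M - 2"]) simp
  have side': "side ?\<sigma> ?\<tau> i = side \<sigma> \<tau> j" if "i + j + 1 = M" for i j
  proof -
    have "Suc N = i + j" using that N by simp
    then have "even (Suc N) \<longleftrightarrow> (even i \<longleftrightarrow> even j)" by (simp only: even_add)
    then show ?thesis using N by (auto simp: side_def)
  qed
  have m: "markov_triple ?\<sigma> ?\<tau> c" using markov_triple_mirror[OF markov_triple_side'[OF d(1), of N]] by (simp add: N)
  have st: "strip_step ?\<sigma> ?\<tau> c ?F i" if "i + 3 \<le> M" for i
  proof -
    obtain j where j: "M = i + 3 + j" using \<open>i + 3 \<le> M\<close> by (metis le_Suc_ex)
    have "F (j + 3) = (c\<^sup>2 + (side \<sigma> \<tau> j)\<^sup>2) * (F (j + 1) + F (j + 2)) / (side \<sigma> \<tau> (Suc j))\<^sup>2 - F j"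
      using d(8)[of j] j by (simp add: strip_step_def)
    moreover have "side ?\<sigma> ?\<tau> i = side \<sigma> \<tau> j" using side'[of i "Suc (Suc j)"] j by simp
    moreover have "side ?\<sigma> ?\<tau> (Suc i) = side \<sigma> \<tau> (Suc j)" using side'[of "Suc i" "Suc j"] j by simp
    moreover have "M - i = j + 3" "M - (i + 1) = j + 2" "M - (i + 2) = j + 1" "M - (i + 3) = j" using j by auto
    ultimately show ?thesis by (simp add: strip_step_def add.commute)
  qed
  have ud: "unit_disc (strip_cfg ?\<sigma> ?\<tau> c ?F i)" if "i + 2 \<le> M" for i
  proof -
    obtain j where j: "M = i + 2 + j" using \<open>i + 2 \<le> M\<close> by (metis le_Suc_ex)
    have "side ?\<sigma> ?\<tau> i = side \<sigma> \<tau> (Suc j)" using side'[of i "Suc j"] j by simp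
    moreover have "side ?\<sigma> ?\<tau> (Suc i) = side \<sigma> \<tau> j" using side'[of "Suc i" j] j by simp
    moreover have "M - i = j + 2" "M - (i + 1) = j + 1" "M - (i + 2) = j" using j by auto
    ultimately have "strip_cfg ?\<sigma> ?\<tau> c ?F i = mirror (turn (strip_cfg \<sigma> \<tau> c F j))" by (simp add: strip_cfg_def)
    moreover have "unit_disc (strip_cfg \<sigma> \<tau> c F j)" using d(9)[of j] j by simp
    ultimately show ?thesis using unit_disc_mirror unit_disc_turn by metis
  qed
  have al: "?F i * ?F (i + 1) < 0" if "0 < i" "i + 1 < M" for i
  proof -
    have "F (M - (i + 1)) * F (M - (i + 1) + 1) < 0" using that by (intro d(7)) auto
    moreover have "M - (i + 1) + 1 = M - i" using that by simp
    ultimately show ?thesis by (simp add: mult.commute)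
  qed
  show ?thesis unfolding strip_def
  proof (intro conjI allI impI)
    show "?\<sigma> \<le> c" "?\<tau> \<le> c" using side_bounds(2)[OF d(1-3)] by blast+
    show "?F 0 = 0" "?F M = 0" using d(5,6) by simp_all
  qed (use m d(4) al st ud in blast)+
qed

text \<open>All are the Markov equation with \<open>3 c\<close> written as
  \<open>rho c + 1 / rho c\<close>. The third shows that the limit \<open>c / rho c\<close> does not
  exceed the bound available for vertices off the strip.\<close>

lemma strip_identities:
  assumes m: "markov_triple \<sigma> \<tau> c" "\<sigma> \<le> c" "\<tau> \<le> c"
  shows "c \<le> \<sigma> * rho c - \<tau>" "\<sigma> * \<tau> * rho c - \<tau>\<^sup>2 - c\<^sup>2 = \<sigma> * (\<sigma> * rho c - \<tau>) / rho c"
    "c / rho c \<le> \<sigma> * \<tau> / c" "\<sigma>\<^sup>2 + c\<^sup>2 - \<sigma> * \<tau> / rho c = \<tau> * (\<sigma> * rho c - \<tau>)"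
proof -
  note p = markov_tripleD[OF m(1)]
  note r = rho_props[OF p(3)]
  have rp: "rho c > 0" using r(1) p(3) by simp
  have "1 * rho c \<le> \<sigma> * rho c" using rp p by (intro mult_right_mono) auto
  then show 1: "c \<le> \<sigma> * rho c - \<tau>" using r(1) m(3) by linarith
  have e: "\<sigma>\<^sup>2 + \<tau>\<^sup>2 + c\<^sup>2 = \<sigma> * \<tau> * (rho c + 1 / rho c)" using p(4) r(3) by (simp add: algebra_simps)
  have f: "\<sigma> * (\<sigma> * rho c - \<tau>) / rho c = \<sigma>\<^sup>2 - \<sigma> * \<tau> / rho c"
    using rp by (simp add: field_simps power2_eq_square)
  have g: "\<sigma> * \<tau> * (rho c + 1 / rho c) = \<sigma> * \<tau> * rho c + \<sigma> * \<tau> / rho c" by (simp add: algebra_simps)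
  show 2: "\<sigma> * \<tau> * rho c - \<tau>\<^sup>2 - c\<^sup>2 = \<sigma> * (\<sigma> * rho c - \<tau>) / rho c"
    unfolding f using e g by linarith
  have "\<tau> * (\<sigma> * rho c - \<tau>) = \<sigma> * \<tau> * rho c - \<tau>\<^sup>2" by (simp add: algebra_simps power2_eq_square)
  then show "\<sigma>\<^sup>2 + c\<^sup>2 - \<sigma> * \<tau> / rho c = \<tau> * (\<sigma> * rho c - \<tau>)" using e g by linarith
  have "\<sigma> * (\<sigma> * rho c - \<tau>) / rho c \<ge> 0" using 1 p rp by simp
  then have "c\<^sup>2 \<le> \<sigma> * \<tau> * rho c" using 2 zero_le_power2[of \<tau>] by linarith
  then have "c * c \<le> \<sigma> * \<tau> * rho c" by (simp add: power2_eq_square)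
  then show "c / rho c \<le> \<sigma> * \<tau> / c" using p(3) rp by (simp add: field_simps)
qed

lemma strip_start:
  assumes s: "strip \<sigma> \<tau> c M F" and F1: "F 1 > 0"
  shows "c\<^sup>2 * F 1 - \<sigma>\<^sup>2 * F 2 = \<sigma> * \<tau> * c"
proof -
  note d = stripD[OF s]
  note p = markov_tripleD[OF d(1)]
  have F2: "F 2 < 0" using d(7)[of 1] d(4) F1 by (simp add: mult_less_0_iff eval_nat_numeral)
  have "unit_disc (strip_cfg \<sigma> \<tau> c F 0)" using d(9)[of 0] d(4) by simp
  then have "(\<sigma>\<^sup>2 * F 2 - c\<^sup>2 * F 1)\<^sup>2 = (\<sigma> * \<tau> * c)\<^sup>2"
    using d(5) by (simp add: strip_cfg_def power_mult_distrib mult_ac eval_nat_numeral)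
  then have "\<sigma>\<^sup>2 * F 2 - c\<^sup>2 * F 1 = \<sigma> * \<tau> * c \<or> \<sigma>\<^sup>2 * F 2 - c\<^sup>2 * F 1 = - (\<sigma> * \<tau> * c)"
    by (simp only: power2_eq_iff)
  moreover have "\<sigma>\<^sup>2 * F 2 \<le> 0" "c\<^sup>2 * F 1 \<ge> 0" using F1 F2 by (auto simp: mult_nonneg_nonpos)
  moreover have "\<sigma> * \<tau> * c > 0" using p by simp
  ultimately show ?thesis by linarith
qed

section \<open>The constant of a long strip\<close>

text \<open>At the far end two edge means add up to at most \<open>3 c\<^sup>2\<close>, and the
  growing part has been multiplied by \<open>rho c ^ (M - 2)\<close>, at least
  \<open>2 ^ (M - 2)\<close>. The last factor \<open>c\<close> translates the edge mean defect into
  an error of \<open>F 2\<close>.\<close>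

definition strip_error :: "real \<Rightarrow> nat \<Rightarrow> real" where
  "strip_error c M = 3 * c ^ 3 / 2 ^ (M - 2)"

text \<open>\<open>strip_start\<close> and the relation between the first two edge means are two
  linear equations for \<open>F 1\<close> and \<open>F 2\<close>. With defect \<open>W = 0\<close>
  they give \<open>F 2 = - (c / rho c)\<close> exactly; boundedness at the far end makes
  \<open>W\<close> exponentially small.\<close>

lemma strip_end_pos:
  assumes s: "strip \<sigma> \<tau> c M F" and ge: "\<And>i. 0 < i \<Longrightarrow> i < M \<Longrightarrow> \<bar>F i\<bar> \<ge> 1 / 3" and F1: "F 1 > 0"
  shows "\<bar>\<bar>F 2\<bar> - c / rho c\<bar> \<le> strip_error c M" "\<bar>F 1\<bar> \<ge> c / rho c - strip_error c M"
proof -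
  note d = stripD[OF s]
  note p = markov_tripleD[OF d(1)]
  note r = rho_props[OF p(3)]
  note id = strip_identities[OF d(1-3)]
  have rp: "rho c > 0" and r2: "rho c \<ge> 2" using r(1) p(3) by auto
  have F2: "F 2 < 0" using d(7)[of 1] d(4) F1 by (simp add: mult_less_0_iff eval_nat_numeral)
  have b: "\<bar>F i\<bar> \<le> 3 * c\<^sup>2 / 4" if "i \<le> M" for i
  proof -
    consider "i = 0 \<or> i = M" | "0 < i" "i + 1 < M" | "1 < i" "i + 1 = M"
      using \<open>i \<le> M\<close> d(4) by force
    then show ?thesis
    proof cases
      case 1
      then show ?thesis using d(5,6) by auto
    next
      case 2
      then show ?thesis
        using strip_bounded(1)[OF d(1-3) d(9)[of i], of "1/3"] ge[of i] ge[of "i + 1"] d(7)[of i] by simp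
    next
      case 3
      then obtain j where j: "i = j + 1" "0 < j" by (intro that[of "i - 1"]) auto
      then show ?thesis
        using strip_bounded(2)[OF d(1-3) d(9)[of j], of "1/3"] ge[of j] ge[of "j + 1"] d(7)[of j] 3 by simp
    qed
  qed
  have g: "\<bar>edge_mean \<sigma> \<tau> F i\<bar> \<le> 3 * c\<^sup>2 / 2" if "i + 1 \<le> M" for i
  proof -
    have "\<bar>edge_mean \<sigma> \<tau> F i\<bar> = \<bar>F i + F (i + 1)\<bar> / side \<sigma> \<tau> i"
      unfolding edge_mean_def using side_bounds(1)[OF d(1-3), of i] by simp
    also have "\<dots> \<le> \<bar>F i + F (i + 1)\<bar>" using side_bounds(1)[OF d(1-3), of i]
      by (simp add: divide_le_eq mult_le_cancel_left1)
    also have "\<dots> \<le> 3 * c\<^sup>2 / 2" using b[of i] b[of "i + 1"] that by linarith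
    finally show ?thesis .
  qed
  define W where "W = edge_mean \<sigma> \<tau> F 1 - edge_mean \<sigma> \<tau> F 0 / rho c"
  have W: "c * \<bar>W\<bar> \<le> strip_error c M"
  proof -
    let ?i = "M - 2"
    have "2 ^ ?i * \<bar>W\<bar> \<le> rho c ^ ?i * \<bar>W\<bar>" using r2 by (intro mult_right_mono power_mono) auto
    also have "\<dots> = \<bar>edge_mean \<sigma> \<tau> F (?i + 1) - edge_mean \<sigma> \<tau> F ?i / rho c\<bar>"
      using edge_mean_defect[OF d(1), of ?i F] d(8) r2 unfolding W_def by (simp add: abs_mult)
    also have "\<dots> \<le> \<bar>edge_mean \<sigma> \<tau> F (?i + 1)\<bar> + \<bar>edge_mean \<sigma> \<tau> F ?i / rho c\<bar>" by (rule abs_triangle_ineq4)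
    also have "\<bar>edge_mean \<sigma> \<tau> F ?i / rho c\<bar> \<le> \<bar>edge_mean \<sigma> \<tau> F ?i\<bar>"
      using r2 by (simp add: divide_le_eq mult_le_cancel_left1)
    finally have "2 ^ ?i * \<bar>W\<bar> \<le> \<bar>edge_mean \<sigma> \<tau> F (?i + 1)\<bar> + \<bar>edge_mean \<sigma> \<tau> F ?i\<bar>" by simp
    moreover have "\<bar>edge_mean \<sigma> \<tau> F ?i\<bar> \<le> 3 * c\<^sup>2 / 2" "\<bar>edge_mean \<sigma> \<tau> F (?i + 1)\<bar> \<le> 3 * c\<^sup>2 / 2"
      by (rule g; use d(4) in simp)+
    ultimately have "2 ^ ?i * \<bar>W\<bar> \<le> 3 * c\<^sup>2" by linarith
    then have "c * (2 ^ ?i * \<bar>W\<bar>) \<le> c * (3 * c\<^sup>2)" using p(3) by (intro mult_left_mono) auto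
    then show ?thesis by (simp add: strip_error_def field_simps eval_nat_numeral)
  qed
  define q where "q = \<sigma> * rho c - \<tau>"
  have q: "q \<ge> c" "q > 0" using id(1) p(3) by (auto simp: q_def)
  have n: "\<sigma> > 0" "\<tau> > 0" "c > 0" using p by auto
  note st = strip_start[OF s F1]
  have "edge_mean \<sigma> \<tau> F 0 = F 1 / \<sigma>" "edge_mean \<sigma> \<tau> F 1 = (F 1 + F 2) / \<tau>"
    using d(5) by (simp_all add: edge_mean_def eval_nat_numeral)
  then have "(F 1 + F 2) / \<tau> = F 1 / (\<sigma> * rho c) + W" by (simp add: W_def)
  then have "F 1 + F 2 = \<tau> * (F 1 / (\<sigma> * rho c) + W)" using n by (simp add: field_simps)
  then have "\<sigma>\<^sup>2 * F 1 + \<sigma>\<^sup>2 * F 2 = \<sigma>\<^sup>2 * (\<tau> * (F 1 / (\<sigma> * rho c) + W))" by (simp add: distrib_left[symmetric])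
  also have "\<dots> = \<sigma> * \<tau> / rho c * F 1 + \<sigma>\<^sup>2 * \<tau> * W" using n rp by (simp add: field_simps power2_eq_square)
  finally have "F 1 * (\<sigma>\<^sup>2 + c\<^sup>2 - \<sigma> * \<tau> / rho c) = \<sigma> * \<tau> * c + \<sigma>\<^sup>2 * \<tau> * W"
    using st by (simp add: algebra_simps)
  then have "\<tau> * (F 1 * q) = \<tau> * (\<sigma> * c + \<sigma>\<^sup>2 * W)"
    unfolding id(4) q_def[symmetric] by (simp add: algebra_simps)
  then have Fq: "F 1 * q = \<sigma> * c + \<sigma>\<^sup>2 * W" using n by simp
  have cW: "c\<^sup>2 * \<bar>W\<bar> \<le> strip_error c M * q"
  proof -
    have "c\<^sup>2 * \<bar>W\<bar> = (c * \<bar>W\<bar>) * c" by (simp add: power2_eq_square)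
    also have "\<dots> \<le> strip_error c M * q" using W q n by (intro mult_mono) (auto simp: strip_error_def)
    finally show ?thesis .
  qed
  have "\<sigma>\<^sup>2 * (- F 2 * q) = \<sigma> * \<tau> * c * q - c\<^sup>2 * (F 1 * q)"
  proof -
    have h: "\<sigma>\<^sup>2 * (- F 2) = \<sigma> * \<tau> * c - c\<^sup>2 * F 1" using st by simp
    have "\<sigma>\<^sup>2 * (- F 2 * q) = \<sigma>\<^sup>2 * (- F 2) * q" by (simp only: mult.assoc)
    also have "\<dots> = \<sigma> * \<tau> * c * q - c\<^sup>2 * (F 1 * q)" unfolding h by (simp only: left_diff_distrib mult.assoc)
    finally show ?thesis .
  qed
  also have "\<dots> = \<sigma> * c * (\<sigma> * \<tau> * rho c - \<tau>\<^sup>2 - c\<^sup>2) - \<sigma>\<^sup>2 * c\<^sup>2 * W"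
    unfolding Fq by (simp add: q_def algebra_simps power2_eq_square)
  also have "\<dots> = \<sigma>\<^sup>2 * (c / rho c * q - c\<^sup>2 * W)"
    unfolding id(2) q_def[symmetric] using rp by (simp add: field_simps power2_eq_square)
  finally have A: "\<sigma>\<^sup>2 * (- F 2 * q) = \<sigma>\<^sup>2 * (c / rho c * q - c\<^sup>2 * W)" .
  have "- F 2 * q = c / rho c * q - c\<^sup>2 * W"
  proof -
    have "\<sigma>\<^sup>2 \<noteq> 0" using n by simp
    from mult_left_cancel[OF this, THEN iffD1, OF A] show ?thesis .
  qed
  then have e: "(\<bar>F 2\<bar> - c / rho c) * q = - (c\<^sup>2 * W)" using F2 by (simp add: left_diff_distrib)
  have "\<bar>\<bar>F 2\<bar> - c / rho c\<bar> * q = \<bar>(\<bar>F 2\<bar> - c / rho c) * q\<bar>" using q by (simp add: abs_mult)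
  also have "\<dots> = c\<^sup>2 * \<bar>W\<bar>" unfolding e by (simp add: abs_mult)
  finally have "\<bar>\<bar>F 2\<bar> - c / rho c\<bar> * q \<le> strip_error c M * q" using cW by simp
  then show "\<bar>\<bar>F 2\<bar> - c / rho c\<bar> \<le> strip_error c M" using q by simp
  have "c / rho c * q = \<sigma> * c - \<tau> * c / rho c" using rp by (simp add: q_def field_simps)
  moreover have "\<tau> * c / rho c \<ge> 0" using n rp by simp
  moreover have "\<sigma>\<^sup>2 * W \<ge> - (c\<^sup>2 * \<bar>W\<bar>)"
  proof -
    have "\<sigma>\<^sup>2 * \<bar>W\<bar> \<le> c\<^sup>2 * \<bar>W\<bar>" using d(2) n by (intro mult_right_mono power_mono) auto
    moreover have "\<sigma>\<^sup>2 * W \<ge> - (\<sigma>\<^sup>2 * \<bar>W\<bar>)"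
    proof -
      have "\<sigma>\<^sup>2 * (- \<bar>W\<bar>) \<le> \<sigma>\<^sup>2 * W" by (intro mult_left_mono) auto
      then show ?thesis by simp
    qed
    ultimately show ?thesis by linarith
  qed
  ultimately have "c / rho c * q - strip_error c M * q \<le> F 1 * q" using Fq cW by linarith
  then have "(c / rho c - strip_error c M) * q \<le> F 1 * q" by (simp add: left_diff_distrib)
  then show "\<bar>F 1\<bar> \<ge> c / rho c - strip_error c M" using q F1 by simp
qed

lemma strip_end:
  assumes s: "strip \<sigma> \<tau> c M F" and ge: "\<And>i. 0 < i \<Longrightarrow> i < M \<Longrightarrow> \<bar>F i\<bar> \<ge> 1 / 3"
  shows "\<bar>\<bar>F 2\<bar> - c / rho c\<bar> \<le> strip_error c M" "\<bar>F 1\<bar> \<ge> c / rho c - strip_error c M"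
proof -
  have "F 1 \<noteq> 0" using strip_nonzero[OF s, of 1] stripD(4)[OF s] by simp
  then consider "F 1 > 0" | "- F 1 > 0" by linarith
  then have "\<bar>\<bar>F 2\<bar> - c / rho c\<bar> \<le> strip_error c M \<and> \<bar>F 1\<bar> \<ge> c / rho c - strip_error c M"
  proof cases
    case 1
    then show ?thesis using strip_end_pos[OF s ge] by blast
  next
    case 2
    show ?thesis using strip_end_pos[OF strip_uminus[OF s], OF _ 2] ge by simp
  qed
  then show "\<bar>\<bar>F 2\<bar> - c / rho c\<bar> \<le> strip_error c M" "\<bar>F 1\<bar> \<ge> c / rho c - strip_error c M" by auto
qed

text \<open>No interior local minimum, hence the smallest value of a strip sits next to one of its ends.\<close>

lemma strip_local_min_aux:
  assumes pos: "u > 0" "v > 0" "c > (0::real)"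
    and X: "X + U = (c\<^sup>2 + u\<^sup>2) * (Y + Z) / v\<^sup>2" and T: "Y + T = (c\<^sup>2 + v\<^sup>2) * (Z + U) / u\<^sup>2"
    and Z: "Z < 0" and YU: "Y \<ge> - Z" "U \<ge> - Z" and XT: "X \<le> 0" "T \<le> 0"
  shows "\<bar>X\<bar> \<le> \<bar>Z\<bar> \<or> \<bar>T\<bar> < \<bar>Z\<bar>"
proof (rule ccontr)
  assume "\<not> ?thesis"
  then have n: "Z - X > 0" "Z - T \<ge> 0" using Z XT by auto
  define g h where "g = Y + Z" and "h = Z + U"
  have gh: "g \<ge> 0" "h \<ge> 0" using YU by (auto simp: g_def h_def)
  have 1: "Z - X = h - (c\<^sup>2 + u\<^sup>2) * g / v\<^sup>2" using X by (simp add: g_def h_def)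
  have 2: "Z - T = g - (c\<^sup>2 + v\<^sup>2) * h / u\<^sup>2" using T by (simp add: g_def h_def)
  have a: "(c\<^sup>2 + u\<^sup>2) * g < v\<^sup>2 * h" using n(1) pos unfolding 1 by (simp add: field_simps)
  have b: "(c\<^sup>2 + v\<^sup>2) * h \<le> u\<^sup>2 * g" using n(2) pos unfolding 2 by (simp add: field_simps)
  have "c\<^sup>2 * g \<ge> 0" "c\<^sup>2 * h \<ge> 0" using gh by auto
  then have "u\<^sup>2 * g < v\<^sup>2 * h" "v\<^sup>2 * h \<le> u\<^sup>2 * g" using a b by (auto simp: distrib_right)
  then show False by simp
qed

lemma strip_local_min:
  assumes s: "strip \<sigma> \<tau> c M F" and i: "i + 4 \<le> M"
    and le: "\<bar>F (i + 2)\<bar> \<le> \<bar>F (i + 1)\<bar>" "\<bar>F (i + 2)\<bar> \<le> \<bar>F (i + 3)\<bar>"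
  shows "\<bar>F i\<bar> \<le> \<bar>F (i + 2)\<bar> \<or> \<bar>F (i + 4)\<bar> < \<bar>F (i + 2)\<bar>"
proof -
  have main: "\<bar>F i\<bar> \<le> \<bar>F (i + 2)\<bar> \<or> \<bar>F (i + 4)\<bar> < \<bar>F (i + 2)\<bar>" if s: "strip \<sigma> \<tau> c M F" and Z: "F (i + 2) < 0"
    and le: "\<bar>F (i + 2)\<bar> \<le> \<bar>F (i + 1)\<bar>" "\<bar>F (i + 2)\<bar> \<le> \<bar>F (i + 3)\<bar>" for F
  proof -
    note d = stripD[OF s]
    have al1: "F (i + 1) * F (i + 2) < 0" using d(7)[of "i + 1"] i by (simp add: eval_nat_numeral)
    have al2: "F (i + 2) * F (i + 3) < 0" using d(7)[of "i + 2"] i by (simp add: eval_nat_numeral)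
    have Y: "F (i + 1) > 0" and U: "F (i + 3) > 0" using al1 al2 Z by (auto simp: mult_less_0_iff)
    have X: "F i \<le> 0"
    proof (cases "i = 0")
      case True then show ?thesis using d(5) by simp
    next
      case False
      then show ?thesis using d(7)[of i] i Y by (auto simp: mult_less_0_iff)
    qed
    have T: "F (i + 4) \<le> 0"
    proof (cases "i + 4 = M")
      case True then show ?thesis using d(6) by simp
    next
      case False
      then have "F (i + 3) * F (i + 4) < 0" using d(7)[of "i + 3"] i by (simp add: eval_nat_numeral)
      then show ?thesis using U by (auto simp: mult_less_0_iff)
    qed
    define u v where "u = side \<sigma> \<tau> i" and "v = side \<sigma> \<tau> (Suc i)"
    have p: "u > 0" "v > 0" "c > 0" using side_bounds(1)[OF d(1-3), of i] side_bounds(1)[OF d(1-3), of "Suc i"] markov_tripleD(3)[OF d(1)]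
      by (auto simp: u_def v_def)
    have e1: "F i + F (i + 3) = (c\<^sup>2 + u\<^sup>2) * (F (i + 1) + F (i + 2)) / v\<^sup>2"
      using d(8)[of i] i by (simp add: strip_step_def u_def v_def)
    have e2: "F (i + 1) + F (i + 4) = (c\<^sup>2 + v\<^sup>2) * (F (i + 2) + F (i + 3)) / u\<^sup>2"
      using d(8)[of "Suc i"] i by (simp add: strip_step_def u_def v_def eval_nat_numeral)
    show ?thesis
    proof (rule strip_local_min_aux[OF p e1 e2 Z _ _ X T])
      show "- F (i + 2) \<le> F (i + 1)" "- F (i + 2) \<le> F (i + 3)" using le Y U Z by linarith+
    qed
  qed
  have "F (i + 2) \<noteq> 0" using strip_nonzero[OF s, of "i + 2"] i by simp
  then consider "F (i + 2) < 0" | "- F (i + 2) < 0" by linarith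
  then show ?thesis
  proof cases
    case 1 then show ?thesis using main[OF s _ le] by simp
  next
    case 2 then show ?thesis using main[OF strip_uminus[OF s]] le by simp
  qed
qed

lemma strip_lower:
  assumes s: "strip \<sigma> \<tau> c M F" and ge: "\<And>i. 0 < i \<Longrightarrow> i < M \<Longrightarrow> \<bar>F i\<bar> \<ge> 1 / 3"
    and i: "0 < i" "i < M"
  shows "\<bar>F i\<bar> \<ge> c / rho c - strip_error c M"
proof -
  note d = stripD[OF s]
  have A: "\<bar>F 1\<bar> \<ge> c / rho c - strip_error c M" "\<bar>F 2\<bar> \<ge> c / rho c - strip_error c M"
    using strip_end[OF s ge] by auto
  have "\<bar>F (M - i)\<bar> \<ge> 1 / 3" if "0 < i" "i < M" for i using ge[of "M - i"] that by simp
  from strip_end[OF strip_reverse[OF s] this]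
  have B: "\<bar>F (M - 1)\<bar> \<ge> c / rho c - strip_error c M" "\<bar>F (M - 2)\<bar> \<ge> c / rho c - strip_error c M" by auto
  define S where "S = (\<lambda>i. \<bar>F i\<bar>) ` {0<..<M}"
  have "\<bar>F i\<bar> \<in> S" using i by (simp add: S_def)
  then have S: "finite S" "S \<noteq> {}" by (auto simp: S_def)
  \<comment> \<open>Choosing the first minimum breaks ties in the direction that
    \<open>strip_local_min\<close> requires: weak on the left, strict on the right.\<close>
  define k where "k = (LEAST k. 0 < k \<and> k < M \<and> \<bar>F k\<bar> = Min S)"
  have "\<exists>k. 0 < k \<and> k < M \<and> \<bar>F k\<bar> = Min S" using Min_in[OF S] by (auto simp: S_def)
  then have k: "0 < k" "k < M" "\<bar>F k\<bar> = Min S" using LeastI_ex[of "\<lambda>k. 0 < k \<and> k < M \<and> \<bar>F k\<bar> = Min S"] unfolding k_def by auto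
  have mn: "\<bar>F k\<bar> \<le> \<bar>F j\<bar>" if "0 < j" "j < M" for j
    unfolding k(3) using that S by (intro Min_le) (auto simp: S_def)
  have least: "\<bar>F k\<bar> \<noteq> \<bar>F j\<bar>" if "0 < j" "j < k" for j
    using not_less_Least[of j "\<lambda>k. 0 < k \<and> k < M \<and> \<bar>F k\<bar> = Min S"] that k unfolding k_def[symmetric] by auto
  have "k = 1 \<or> k = 2 \<or> k = M - 1 \<or> k = M - 2"
  proof (rule ccontr)
    assume "\<not> ?thesis"
    then have kk: "k > 2" "k + 2 < M" using k by auto
    define j where "j = k - 2"
    have j: "k = j + 2" "j > 0" "j + 4 < M" using kk by (auto simp: j_def)
    have "\<bar>F j\<bar> \<le> \<bar>F (j + 2)\<bar> \<or> \<bar>F (j + 4)\<bar> < \<bar>F (j + 2)\<bar>"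
      using strip_local_min[OF s, of j] mn[of "j + 1"] mn[of "j + 3"] j by simp
    then show False
    proof
      assume "\<bar>F j\<bar> \<le> \<bar>F (j + 2)\<bar>"
      then show False using mn[of j] least[of j] j by simp
    next
      assume "\<bar>F (j + 4)\<bar> < \<bar>F (j + 2)\<bar>"
      then show False using mn[of "j + 4"] j by simp
    qed
  qed
  then have "\<bar>F k\<bar> \<ge> c / rho c - strip_error c M" using A B by auto
  then show ?thesis using mn[OF i] by linarith
qed

section \<open>Values off the strip\<close>

lemma outer_start_sgn:
  assumes "markov (Cfg x P y Q s R)" "unit_disc (Cfg x P y Q s R)" "P * R \<le> 0" "Q * R \<le> 0" "R \<noteq> 0"
  shows "outer (cross (Cfg x P y Q s R)) \<or> outer (negate (cross (Cfg x P y Q s R)))"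
proof (cases "R < 0")
  case True
  then have "P \<ge> 0" "Q \<ge> 0" using assms by (auto simp: mult_le_0_iff)
  then show ?thesis using outer_start[OF assms(1,2)] True by simp
next
  case False
  then have "P \<le> 0" "Q \<le> 0" "R > 0" using assms by (auto simp: mult_le_0_iff)
  moreover have "unit_disc (Cfg x (- P) y (- Q) s (- R))" using assms(2) unit_disc_negate[of "Cfg x P y Q s R"] by simp
  moreover have "markov (Cfg x (- P) y (- Q) s (- R))" using assms(1) by simp
  ultimately have "outer (cross (negate (Cfg x P y Q s R)))" using outer_start[of x "- P" y "- Q" s "- R"] by simp
  then show ?thesis unfolding cross_negate by blast
qed

text \<open>\<open>I\<close> consists of the strip triangles after the first. Every other neighbour
  lies over an edge whose ends have value 0 or the sign opposite to the nonzero value of the vertex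
  left behind, so it is outer up to sign.\<close>

lemma strip_orbit_values_lower:
  assumes s: "strip \<sigma> \<tau> c M F" and ge: "\<And>i. 0 < i \<Longrightarrow> i < M \<Longrightarrow> \<bar>F i\<bar> \<ge> 1 / 3"
    and v: "v \<in> orbit_values (strip_cfg \<sigma> \<tau> c F 0)"
  shows "v = 0 \<or> \<bar>v\<bar> \<ge> c / rho c - strip_error c M"
proof -
  note d = stripD[OF s]
  note p = markov_tripleD[OF d(1)]
  let ?t = "strip_cfg \<sigma> \<tau> c F" and ?\<mu> = "c / rho c - strip_error c M"
  have markov: "markov (?t i)" for i by (rule markov_strip_cfg[OF d(1)])
  have gap0: "strip_error c M \<ge> 0" using p(3) by (simp add: strip_error_def)
  have good: "F i = 0 \<or> \<bar>F i\<bar> \<ge> ?\<mu>" if "i \<le> M" for i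
  proof (cases "i = 0 \<or> i = M")
    case True then show ?thesis using d(5,6) by auto
  next
    case False
    then show ?thesis using strip_lower[OF s ge] that by simp
  qed
  have least_abs: "F i \<noteq> 0" if "0 < i" "i < M" for i using strip_nonzero[OF s that] .
  have adj: "F i * F (i + 1) \<le> 0" if "i + 1 \<le> M" for i
  proof (cases "i = 0 \<or> i + 1 = M")
    case True then show ?thesis using d(5,6) by auto
  next
    case False then show ?thesis using d(7)[of i] that by simp
  qed
  have fwd: "cross (turn (?t i)) = ?t (Suc i)" if "i + 3 \<le> M" for i
    using strip_cfg_Suc d(8)[OF that] by blast
  have side: "outer (cross (turn (turn (?t i)))) \<or> outer (negate (cross (turn (turn (?t i)))))" if "i + 2 \<le> M" for i
  proof -
    have e: "turn (turn (?t i)) = Cfg (side \<sigma> \<tau> i) (F (i + 2)) (side \<sigma> \<tau> (Suc i)) (F i) c (F (i + 1))"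
      by (simp add: strip_cfg_def)
    have "markov (turn (turn (?t i)))" "unit_disc (turn (turn (?t i)))" using markov markov_turn unit_disc_turn d(9)[OF that] by blast+
    moreover have "F (i + 2) * F (i + 1) \<le> 0" "F i * F (i + 1) \<le> 0" "F (i + 1) \<noteq> 0"
      using adj[of i] adj[of "i + 1"] least_abs[of "i + 1"] that by (auto simp: mult.commute eval_nat_numeral)
    ultimately show ?thesis unfolding e by (intro outer_start_sgn) auto
  qed
  show ?thesis
  proof (rule orbit_values_lower_bound[where ?C0.0 = "?t 0" and c = c and k = "\<sigma> * \<tau> * c" and
        I = "\<lambda>C. \<exists>i. 0 < i \<and> i + 2 \<le> M \<and> C = ?t i", OF markov _ _ _ _ _ _ v])
    show "det_bound c (\<sigma> * \<tau> * c) (?t 0)" using d(2,3) by (simp add: strip_cfg_def mult_ac)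
    have "?\<mu> \<le> \<sigma> * \<tau> / c" using strip_identities(3)[OF d(1-3)] gap0 by linarith
    then show "?\<mu> \<le> \<sigma> * \<tau> * c / c\<^sup>2" using p(3) by (simp add: power2_eq_square)
    show "v = 0 \<or> ?\<mu> \<le> \<bar>v\<bar>" if "v \<in> vertex_values (?t 0)" for v
      using that good[of 0] good[of 1] good[of 2] d(4) by (auto simp: strip_cfg_def eval_nat_numeral)
    show "v = 0 \<or> ?\<mu> \<le> \<bar>v\<bar>" if I: "\<exists>i. 0 < i \<and> i + 2 \<le> M \<and> C = ?t i" and vC: "v \<in> vertex_values C" for C v
    proof -
      obtain i where i: "i + 2 \<le> M" "C = ?t i" using I by blast
      show ?thesis using vC good[of i] good[of "i + 1"] good[of "i + 2"] i by (auto simp: strip_cfg_def)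
    qed
    show "(\<exists>i. 0 < i \<and> i + 2 \<le> M \<and> N = ?t i) \<or> outer N \<or> outer (negate N)"
      if N: "N \<in> {cross (?t 0), cross (turn (?t 0)), cross (turn (turn (?t 0)))}" for N
    proof -
      have "outer (cross (?t 0)) \<or> outer (negate (cross (?t 0)))"
      proof -
        have "unit_disc (?t 0)" using d(9)[of 0] d(4) by simp
        moreover have "F 0 * F (0 + 2) \<le> 0" "F (0 + 1) * F (0 + 2) \<le> 0" "F (0 + 2) \<noteq> 0"
          using adj[of 1] least_abs[of 2] d(4,5) by (auto simp: eval_nat_numeral)
        ultimately show ?thesis using markov[of 0] unfolding strip_cfg_def by (intro outer_start_sgn) auto
      qed
      moreover have "cross (turn (?t 0)) = ?t 1" using fwd[of 0] d(4) by simp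
      moreover have "1 + 2 \<le> M" using d(4) by simp
      moreover have "outer (cross (turn (turn (?t 0)))) \<or> outer (negate (cross (turn (turn (?t 0)))))"
        using side[of 0] d(4) by simp
      ultimately show ?thesis using N by (metis insertE singletonD zero_less_one)
    qed
    show "(\<exists>i. 0 < i \<and> i + 2 \<le> M \<and> N = ?t i) \<or> outer N \<or> outer (negate N)"
      if I: "\<exists>i. 0 < i \<and> i + 2 \<le> M \<and> C = ?t i" and N: "N \<in> {cross (turn C), cross (turn (turn C))}" for C N
    proof -
      obtain i where i: "0 < i" "i + 2 \<le> M" "C = ?t i" using I by blast
      have "(\<exists>i. 0 < i \<and> i + 2 \<le> M \<and> cross (turn C) = ?t i) \<or> outer (cross (turn C)) \<or> outer (negate (cross (turn C)))"
      proof (cases "i + 3 \<le> M")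
        case True
        then show ?thesis using fwd[of i] i by (intro disjI1 exI[of _ "Suc i"]) simp
      next
        case False
        then have M: "i + 2 = M" using i by simp
        have e: "turn C = Cfg c (F (i + 1)) (side \<sigma> \<tau> i) (F (i + 2)) (side \<sigma> \<tau> (Suc i)) (F i)"
          using i by (simp add: strip_cfg_def)
        have "markov (turn C)" "unit_disc (turn C)" using markov markov_turn unit_disc_turn d(9)[OF i(2)] i(3) by blast+
        moreover have "F (i + 1) * F i \<le> 0" "F (i + 2) * F i \<le> 0" "F i \<noteq> 0"
          using adj[of i] least_abs[of i] M d(6) i(1) by (auto simp: mult.commute)
        ultimately show ?thesis unfolding e by (intro disjI2 outer_start_sgn) auto
      qed
      moreover have "outer (cross (turn (turn C))) \<or> outer (negate (cross (turn (turn C))))" using side[OF i(2)] i(3) by simp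
      ultimately show ?thesis using N by blast
    qed
  qed
qed

lemma strip_least_abs:
  assumes s: "strip \<sigma> \<tau> c M F" and ge: "\<And>i. 0 < i \<Longrightarrow> i < M \<Longrightarrow> \<bar>F i\<bar> \<ge> 1 / 3"
  shows "\<bar>least_abs (orbit_values (strip_cfg \<sigma> \<tau> c F 0)) - c / rho c\<bar> \<le> strip_error c M"
proof -
  have M: "M \<ge> 3" using stripD(4)[OF s] .
  have F2: "F 2 \<in> orbit_values (strip_cfg \<sigma> \<tau> c F 0)" "F 2 \<noteq> 0"
    using strip_mem_orbit_values[OF s, of 2] strip_nonzero[OF s, of 2] M by auto
  have "least_abs (orbit_values (strip_cfg \<sigma> \<tau> c F 0)) \<le> \<bar>F 2\<bar>" by (rule least_abs_le[OF F2])
  moreover have "c / rho c - strip_error c M \<le> least_abs (orbit_values (strip_cfg \<sigma> \<tau> c F 0))"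
    by (rule least_abs_ge[OF _ F2]) (use strip_orbit_values_lower[OF s ge] in blast)
  ultimately show ?thesis using strip_end(1)[OF s ge] by linarith
qed

text \<open>The recursion is expanding, so the value at the far end is strictly increasing in the value \<open>F 1\<close>.\<close>

lemma strip_unique_aux:
  assumes s: "strip \<sigma> \<tau> c M F" "strip \<sigma> \<tau> c M H" and pos: "F 1 > 0" "H 1 > 0"
  shows "\<not> F 1 < H 1"
proof
  assume lt: "F 1 < H 1"
  note d = stripD[OF s(1)] and e = stripD[OF s(2)]
  note p = markov_tripleD[OF d(1)]
  define D where "D = (\<lambda>i. H i - F i)"
  define g where "g = edge_mean \<sigma> \<tau> D"
  have st: "strip_step \<sigma> \<tau> c D i" if "i + 3 \<le> M" for i
    using d(8)[OF that] e(8)[OF that] unfolding strip_step_def D_def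
    by (simp add: algebra_simps diff_divide_distrib add_divide_distrib)
  have D0: "D 0 = 0" "D 1 > 0" using d(5) e(5) lt by (auto simp: D_def)
  have "c\<^sup>2 * D 1 = \<sigma>\<^sup>2 * D 2" using strip_start[OF s(1) pos(1)] strip_start[OF s(2) pos(2)]
    by (simp add: D_def algebra_simps)
  then have D2: "D 2 = c\<^sup>2 * D 1 / \<sigma>\<^sup>2" using p(1) by (simp add: field_simps)
  have g0: "g 0 = D 1 / \<sigma>" using D0 by (simp add: g_def edge_mean_def)
  have "g 1 = (3 * c - \<tau> / \<sigma>) * g 0"
  proof -
    have k: "\<sigma>\<^sup>2 + c\<^sup>2 = \<tau> * (3 * \<sigma> * c - \<tau>)" using p(4) by (simp add: algebra_simps power2_eq_square)
    have "g 1 = (D 1 + D 2) / \<tau>" by (simp add: g_def edge_mean_def eval_nat_numeral)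
    also have "\<dots> = (\<sigma>\<^sup>2 + c\<^sup>2) * D 1 / (\<sigma>\<^sup>2 * \<tau>)" unfolding D2 using p(1,2) by (simp add: field_simps)
    also have "\<dots> = (3 * c - \<tau> / \<sigma>) * g 0" unfolding k g0 using p(1,2) by (simp add: field_simps power2_eq_square)
    finally show ?thesis .
  qed
  moreover have "\<tau> / \<sigma> \<le> c"
  proof -
    have "c * 1 \<le> c * \<sigma>" using p by (intro mult_left_mono) auto
    then have "\<tau> \<le> c * \<sigma>" using d(3) by simp
    then show ?thesis using p(1) by (simp add: pos_divide_le_eq)
  qed
  moreover have gp: "g 0 > 0" using g0 D0 p(1) by simp
  ultimately have g1: "g 1 \<ge> 2 * c * g 0" by (simp add: mult_right_mono)
  have gr: "g (i + 1) \<ge> 2 * c * g i \<and> g i > 0" if "i + 2 \<le> M" for i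
    using that
  proof (induction i)
    case 0
    show ?case using g1 gp by simp
  next
    case (Suc i)
    then have IH: "g (i + 1) \<ge> 2 * c * g i" "g i > 0" by auto
    have "1 * g i \<le> 2 * c * g i" using IH p(3) by (intro mult_right_mono) auto
    then have a: "g (i + 1) \<ge> g i" using IH by linarith
    have "g (i + 2) = 3 * c * g (i + 1) - g i" unfolding g_def using edge_mean_rec[OF d(1) st[of i]] Suc.prems by simp
    moreover have "1 * g (i + 1) \<le> c * g (i + 1)" using IH a p(3) by (intro mult_right_mono) auto
    ultimately have "g (i + 2) \<ge> 2 * c * g (i + 1)" using a by linarith
    then show ?case using IH a by simp
  qed
  \<comment> \<open>\<open>D i + D (i + 1)\<close> is at most \<open>c * g i\<close>, while
    \<open>D (i + 1) + D (i + 2)\<close> is at least \<open>g (i + 1)\<close>, hence at least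
    \<open>2 * c * g i\<close>. Sums of neighbours are controlled, so growth is compared in steps of
    two.\<close>
  have inc: "D (i + 2) > D i" if "i + 2 \<le> M" for i
  proof -
    have n: "1 \<le> side \<sigma> \<tau> i" "side \<sigma> \<tau> i \<le> c" "1 \<le> side \<sigma> \<tau> (Suc i)" using side_bounds[OF d(1-3)] by auto
    have "D i + D (i + 1) = side \<sigma> \<tau> i * g i" "D (i + 1) + D (i + 2) = side \<sigma> \<tau> (Suc i) * g (i + 1)"
      using n by (auto simp: g_def edge_mean_def eval_nat_numeral)
    moreover have "side \<sigma> \<tau> i * g i \<le> c * g i" using n gr[OF that] by (intro mult_right_mono) auto
    moreover have "1 * g (i + 1) \<le> side \<sigma> \<tau> (Suc i) * g (i + 1)"
    proof (intro mult_right_mono)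
      show "0 \<le> g (i + 1)" using gr[OF that] p(3) by (smt (verit) mult_nonneg_nonneg)
    qed (use n in auto)
    moreover have "c * g i > 0" using gr[OF that] p(3) by simp
    ultimately show ?thesis using gr[OF that] by linarith
  qed
  have "D i \<ge> 0 \<and> (i > 0 \<longrightarrow> D i > 0)" if "i \<le> M" for i
    using that
  proof (induction i rule: less_induct)
    case (less i)
    consider "i = 0" | "i = 1" | j where "i = j + 2" by (metis One_nat_def add_2_eq_Suc' not0_implies_Suc)
    then show ?case
    proof cases
      case (3 j)
      then show ?thesis using less.IH[of j] less.prems inc[of j] by auto
    qed (use D0 in auto)
  qed
  then have "D M > 0" using d(4) by simp
  then show False using d(6) e(6) by (simp add: D_def)
qed

text \<open>\<open>strip\<close> leaves \<open>F\<close> arbitrary beyond \<open>M\<close>, so the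
  functions may differ there; the first triangle agrees and determines the whole orbit.\<close>

lemma strip_unique:
  assumes s: "strip \<sigma> \<tau> c M F" "strip \<sigma> \<tau> c M H" and pos: "F 1 > 0" "H 1 > 0"
  shows "strip_cfg \<sigma> \<tau> c F 0 = strip_cfg \<sigma> \<tau> c H 0"
proof -
  have 1: "F 1 = H 1" using strip_unique_aux[OF s pos] strip_unique_aux[OF s(2,1) pos(2,1)] by simp
  have "\<sigma> > 0" using markov_tripleD(1)[OF stripD(1)[OF s(1)]] by simp
  moreover have "\<sigma>\<^sup>2 * F 2 = \<sigma>\<^sup>2 * H 2"
    using strip_start[OF s(1) pos(1)] strip_start[OF s(2) pos(2)] unfolding 1 by linarith
  ultimately have "F 2 = H 2" by simp
  then show ?thesis using 1 stripD(5)[OF s(1)] stripD(5)[OF s(2)] by (simp add: strip_cfg_def eval_nat_numeral)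
qed

section \<open>Finitely many constants for each triple and length\<close>

definition strip_values :: "real \<Rightarrow> real \<Rightarrow> real \<Rightarrow> nat \<Rightarrow> real set" where
  "strip_values \<sigma> \<tau> c M = {least_abs (orbit_values (strip_cfg \<sigma> \<tau> c F 0)) | F. strip \<sigma> \<tau> c M F}"

lemma strip_values_pos:
  "strip_values \<sigma> \<tau> c M \<subseteq> {least_abs (orbit_values (strip_cfg \<sigma> \<tau> c F 0)) | F. strip \<sigma> \<tau> c M F \<and> F 1 > 0}"
proof
  fix z assume "z \<in> strip_values \<sigma> \<tau> c M"
  then obtain F where F: "strip \<sigma> \<tau> c M F" "z = least_abs (orbit_values (strip_cfg \<sigma> \<tau> c F 0))" by (auto simp: strip_values_def)
  have "F 1 \<noteq> 0" using strip_nonzero[OF F(1), of 1] stripD(4)[OF F(1)] by simp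
  then consider "F 1 > 0" | "- F 1 > 0" by linarith
  then show "z \<in> {least_abs (orbit_values (strip_cfg \<sigma> \<tau> c F 0)) | F. strip \<sigma> \<tau> c M F \<and> F 1 > 0}"
  proof cases
    case 1 then show ?thesis using F by blast
  next
    case 2
    have "z = least_abs (orbit_values (strip_cfg \<sigma> \<tau> c (\<lambda>i. - F i) 0))" by (simp add: F(2) strip_cfg_uminus orbit_values_negate least_abs_uminus)
    then show ?thesis using strip_uminus[OF F(1)] 2 by blast
  qed
qed

lemma finite_strip_values: "finite (strip_values \<sigma> \<tau> c M)"
proof (rule finite_subset[OF strip_values_pos])
  let ?S = "{least_abs (orbit_values (strip_cfg \<sigma> \<tau> c F 0)) | F. strip \<sigma> \<tau> c M F \<and> F 1 > 0}"
  show "finite ?S"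
  proof (cases "\<exists>F. strip \<sigma> \<tau> c M F \<and> F 1 > 0")
    case True
    then obtain F where F: "strip \<sigma> \<tau> c M F" "F 1 > 0" by blast
    have "?S \<subseteq> {least_abs (orbit_values (strip_cfg \<sigma> \<tau> c F 0))}"
    proof clarify
      fix H assume "strip \<sigma> \<tau> c M H" "H 1 > 0"
      then show "least_abs (orbit_values (strip_cfg \<sigma> \<tau> c H 0)) = least_abs (orbit_values (strip_cfg \<sigma> \<tau> c F 0))"
        using strip_unique[OF F(1) _ F(2), of H] by simp
    qed
    then show ?thesis by (rule finite_subset) simp
  next
    case False
    then have "?S = {}" by blast
    then show ?thesis by (simp only: finite.emptyI)
  qed
qed

section \<open>Limit points\<close>

text \<open>The geodesic starts at the cusp (0,1), so the first triangle has a vertex of value 0.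
  Its neighbour over the edge from (1,0) to (1,1) has third vertex (2,1), where the sign of
  \<open>4 * \<beta> - 2\<close> decides which vertex is cut off. For \<beta> equal to 1/2 the
  geodesic ends there.\<close>

lemma farey_corner:
  assumes "0 < \<beta>" "\<beta> < 1" "\<beta> \<noteq> 1 / 2"
  shows "\<exists>C. corner (orbit_values (farey \<beta>)) C"
proof -
  define D where "D = cross (turn (turn (farey \<beta>)))"
  have D: "D = Cfg 1 (\<beta> - 1) 1 \<beta> 1 (4 * \<beta> - 2)" by (simp add: D_def)
  have o: "turn D \<in> orbit (farey \<beta>)" "turn (turn D) \<in> orbit (farey \<beta>)" unfolding D_def by (intro orbit.intros)+
  have u: "unit_disc (farey \<beta>)" by simp
  have m1: "markov_triple 1 1 1" by (simp add: markov_triple_def)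
  note ou = orbit_unit_disc[OF o(1) markov_farey u] orbit_unit_disc[OF o(2) markov_farey u]
  note oV = orbit_values_orbit[OF o(1) markov_farey] orbit_values_orbit[OF o(2) markov_farey]
  show ?thesis
  proof (cases "\<beta> > 1 / 2")
    case True
    have e: "turn D = Cfg 1 \<beta> 1 (4 * \<beta> - 2) 1 (\<beta> - 1)" by (simp add: D)
    have "corner (orbit_values (farey \<beta>)) (turn D)"
      using ou(1) oV(1) m1 True assms unfolding e corner.simps by (simp add: mult_less_0_iff)
    then show ?thesis by blast
  next
    case False
    have e: "turn (turn D) = Cfg 1 (4 * \<beta> - 2) 1 (\<beta> - 1) 1 \<beta>" by (simp add: D)
    have "corner (orbit_values (farey \<beta>)) (turn (turn D))"
      using ou(2) oV(2) m1 False assms unfolding e corner.simps by (simp add: mult_less_0_iff)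
    then show ?thesis by blast
  qed
qed

lemma spectrum_classification:
  assumes "z \<in> Z_spectrum" "z \<ge> t" "t > 1 / 3"
  shows "z = least_abs (orbit_values (farey (1 / 2))) \<or>
    (\<exists>\<sigma> \<tau> c M. z \<in> strip_values \<sigma> \<tau> c M \<and> \<bar>z - c / rho c\<bar> \<le> strip_error c M \<and>
       markov_triple \<sigma> \<tau> c \<and> \<sigma> \<le> c \<and> \<tau> \<le> c \<and> t\<^sup>2 * (9 * c\<^sup>2 - 4) \<le> c\<^sup>2)"
proof -
  obtain r where r: "z = Zval r" "snd (quotient_of r) \<ge> 2" using assms(1) by (auto simp: Z_spectrum_def)
  obtain a b where ab: "quotient_of r = (a, b)" by (cases "quotient_of r")
  have b: "b \<ge> 2" using r(2) ab by simp
  define \<beta> :: real where "\<beta> = frac (of_int a / of_int b)"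
  have z: "z = least_abs (orbit_values (farey \<beta>))" unfolding \<beta>_def r(1) by (rule Zval_eq_least_abs[OF ab b])
  have "of_int a / of_int b \<notin> (\<int> :: real set)"
  proof
    assume "of_int a / of_int b \<in> (\<int> :: real set)"
    then obtain k where "of_int a / of_int b = (of_int k :: real)" by (auto elim: Ints_cases)
    then have "real_of_int a = real_of_int (k * b)" using b by (simp add: field_simps)
    then have "a = k * b" by (simp only: of_int_eq_iff)
    then have "b dvd a" by simp
    moreover have "coprime a b" by (rule quotient_of_coprime[OF ab])
    ultimately have "is_unit b" by (metis coprime_common_divisor dvd_refl)
    then show False using b by simp
  qed
  then have \<beta>: "0 < \<beta>" "\<beta> < 1" unfolding \<beta>_def by (auto simp: frac_lt_1 frac_gt_0_iff)
  have "\<beta> = of_int a / of_int b - of_int \<lfloor>of_int a / of_int b :: real\<rfloor>" by (simp add: \<beta>_def frac_def)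
  then have "\<beta> \<in> \<rat>" by simp
  then have "vertex_values (farey \<beta>) \<subseteq> \<rat>" by simp
  then have rat: "orbit_values (farey \<beta>) \<subseteq> \<rat>" unfolding orbit_values_def using orbit_Rats[OF _ markov_farey] by (intro UN_least)
  have ge: "\<bar>v\<bar> \<ge> t" if "v \<in> orbit_values (farey \<beta>)" "v \<noteq> 0" for v using least_abs_le[OF that] z assms(2) by simp
  show ?thesis
  proof (cases "\<beta> = 1 / 2")
    case True
    show ?thesis using z unfolding True by (rule disjI1)
  next
    case False
    obtain C where C: "corner (orbit_values (farey \<beta>)) C" using farey_corner[OF \<beta> False] by blast
    obtain \<sigma> \<tau> c M F where s: "strip \<sigma> \<tau> c M F" "orbit_values (strip_cfg \<sigma> \<tau> c F 0) = orbit_values (farey \<beta>)" "t\<^sup>2 * (9 * c\<^sup>2 - 4) \<le> c\<^sup>2"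
      using exists_strip[OF C assms(3) ge rat] by blast
    have "\<bar>F i\<bar> \<ge> 1 / 3" if "0 < i" "i < M" for i
      using ge[of "F i"] strip_mem_orbit_values[OF s(1), of i] strip_nonzero[OF s(1) that] that s(2) assms(3) by simp
    then have "\<bar>z - c / rho c\<bar> \<le> strip_error c M" using strip_least_abs[OF s(1)] s(2) z by simp
    moreover have "z = least_abs (orbit_values (strip_cfg \<sigma> \<tau> c F 0))" using s(2) z by simp
    then have "z \<in> strip_values \<sigma> \<tau> c M" using s(1) unfolding strip_values_def by blast
    ultimately show ?thesis using s(3) stripD(1-3)[OF s(1)] by blast
  qed
qed

lemma markov_triple_markoff:
  assumes "markov_triple x y s"
  shows "\<exists>m. markoff_number m \<and> s = real m"
proof -
  have "\<exists>n. z = real n" if "z \<in> \<int>" "z \<ge> 1" for z :: real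
  proof -
    obtain k where k: "z = of_int k" using \<open>z \<in> \<int>\<close> by (auto elim: Ints_cases)
    then have "z = real (nat k)" using that(2) by simp
    then show ?thesis by blast
  qed
  from this[of x] this[of y] this[of s]
  obtain i j k where e: "x = real i" "y = real j" "s = real k" using assms unfolding markov_triple_def by auto
  note p = markov_tripleD[OF assms]
  have "real (i\<^sup>2 + j\<^sup>2 + k\<^sup>2) = real (3 * i * j * k)" 
    using p(4) unfolding e by (simp only: of_nat_add of_nat_mult of_nat_power of_nat_numeral)
  then have "i\<^sup>2 + j\<^sup>2 + k\<^sup>2 = 3 * i * j * k" by (simp only: of_nat_eq_iff)
  moreover have "i > 0" "j > 0" "k > 0" using p(1-3) unfolding e by simp_all
  ultimately have "markoff_triple i j k" unfolding markoff_triple_def by blast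
  then show ?thesis using e(3) unfolding markoff_number_def by blast
qed

lemma finite_markov_triple: "finite {(x, y, s). markov_triple x y s \<and> x \<le> s \<and> y \<le> s \<and> s \<le> K}"
proof -
  define B where "B = (of_int ` {1..\<lfloor>K\<rfloor>} :: real set)"
  have "z \<in> B" if "z \<in> \<int>" "1 \<le> z" "z \<le> K" for z
  proof -
    obtain k where k: "z = of_int k" using \<open>z \<in> \<int>\<close> by (auto elim: Ints_cases)
    then have "k \<in> {1..\<lfloor>K\<rfloor>}" using that by (simp add: le_floor_iff)
    then show ?thesis unfolding B_def k by blast
  qed
  then have "{(x, y, s). markov_triple x y s \<and> x \<le> s \<and> y \<le> s \<and> s \<le> K} \<subseteq> B \<times> B \<times> B"
    unfolding markov_triple_def by (auto dest: order_trans)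
  moreover have "finite B" by (simp add: B_def)
  ultimately show ?thesis by (meson finite_SigmaI finite_subset)
qed

text \<open>A threshold between 1/3 and \<open>x\<close> leaves finitely many triples. If none has
  \<open>c / rho c = x\<close>, long strips have constants away from \<open>x\<close>, and short
  strips contribute finitely many, so some ball about \<open>x\<close> meets the spectrum in a
  finite set.\<close>

lemma spectrum_limit_point:
  assumes lim: "x islimpt Z_spectrum" and x: "x > 1 / 3"
  shows "\<exists>\<sigma> \<tau> c. markov_triple \<sigma> \<tau> c \<and> x = c / rho c"
proof (rule ccontr)
  assume no: "\<not> ?thesis"
  define t where "t = (x + 1 / 3) / 2"
  have t: "t > 1 / 3" "t < x" using x by (auto simp: t_def)
  have tt: "9 * t\<^sup>2 - 1 > 0"
  proof -
    have "(1 / 3)\<^sup>2 < t\<^sup>2" using t(1) by (intro power_strict_mono) auto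
    then show ?thesis by (simp add: power2_eq_square)
  qed
  define K where "K = max 1 (4 * t\<^sup>2 / (9 * t\<^sup>2 - 1))"
  have cK: "c \<le> K" if "c \<ge> 1" "t\<^sup>2 * (9 * c\<^sup>2 - 4) \<le> c\<^sup>2" for c
  proof -
    have "c\<^sup>2 * (9 * t\<^sup>2 - 1) \<le> 4 * t\<^sup>2" using that(2) by (simp add: algebra_simps)
    moreover have "c * (9 * t\<^sup>2 - 1) \<le> c\<^sup>2 * (9 * t\<^sup>2 - 1)"
      using tt that(1) by (intro mult_right_mono) (auto simp: power2_eq_square)
    ultimately have "c * (9 * t\<^sup>2 - 1) \<le> 4 * t\<^sup>2" by linarith
    then have "c \<le> 4 * t\<^sup>2 / (9 * t\<^sup>2 - 1)" using tt by (simp add: pos_le_divide_eq)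
    then show ?thesis by (simp add: K_def)
  qed
  define T where "T = {(\<sigma>, \<tau>, c). markov_triple \<sigma> \<tau> c \<and> \<sigma> \<le> c \<and> \<tau> \<le> c \<and> c \<le> K}"
  have finT: "finite T" unfolding T_def by (rule finite_markov_triple)
  define S where "S = insert (x - t) ((\<lambda>(\<sigma>, \<tau>, c). \<bar>x - c / rho c\<bar>) ` T)"
  have S: "finite S" "S \<noteq> {}" using finT by (auto simp: S_def)
  \<comment> \<open>Half of \<open>e\<close> is spent on the distance from \<open>x\<close> to a
    spectrum point and half on \<open>strip_error\<close>; the member \<open>x - t\<close> of
    \<open>S\<close> keeps the ball above the threshold.\<close>
  define e where "e = Min S"
  have "v > 0" if "v \<in> S" for v using that no t(2) by (auto simp: S_def T_def)
  then have e0: "e > 0" using S by (simp add: e_def)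
  have e1: "e \<le> x - t" unfolding e_def using S by (intro Min_le) (auto simp: S_def)
  have e2: "e \<le> \<bar>x - c / rho c\<bar>" if "(\<sigma>, \<tau>, c) \<in> T" for \<sigma> \<tau> c
    unfolding e_def using S that by (intro Min_le) (force simp: S_def)+
  obtain N :: nat where N: "3 * K ^ 3 / (e / 2) < 2 ^ N" using real_arch_pow[of 2 "3 * K ^ 3 / (e / 2)"] by auto
  have strip_error: "strip_error c M < e / 2" if "0 \<le> c" "c \<le> K" "M \<ge> N + 2" for c M
  proof -
    have "strip_error c M \<le> 3 * K ^ 3 / 2 ^ N"
      unfolding strip_error_def using that by (intro frac_le mult_left_mono power_mono power_increasing) auto
    also have "\<dots> < e / 2" using N e0 by (simp add: field_simps)
    finally show ?thesis .
  qed
  let ?fin = "insert (least_abs (orbit_values (farey (1 / 2)))) (\<Union>(\<sigma>, \<tau>, c)\<in>T. \<Union>M<N + 2. strip_values \<sigma> \<tau> c M)"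
  have "Z_spectrum \<inter> ball x (e / 2) \<subseteq> ?fin"
  proof
    fix z assume "z \<in> Z_spectrum \<inter> ball x (e / 2)"
    then have z: "z \<in> Z_spectrum" "\<bar>x - z\<bar> < e / 2" by (auto simp: dist_real_def)
    then have "z \<ge> t" using e1 e0 by linarith
    from spectrum_classification[OF z(1) this t(1)] show "z \<in> ?fin"
    proof (elim disjE exE conjE)
      assume "z = least_abs (orbit_values (farey (1 / 2)))"
      then show ?thesis by simp
    next
      fix \<sigma> \<tau> c M
      assume h: "z \<in> strip_values \<sigma> \<tau> c M" "\<bar>z - c / rho c\<bar> \<le> strip_error c M" "markov_triple \<sigma> \<tau> c"
        "\<sigma> \<le> c" "\<tau> \<le> c" "t\<^sup>2 * (9 * c\<^sup>2 - 4) \<le> c\<^sup>2"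
      have c: "c \<ge> 1" "c \<le> K" using markov_tripleD(3)[OF h(3)] cK h(6) by auto
      then have T: "(\<sigma>, \<tau>, c) \<in> T" using h by (simp add: T_def)
      have "M < N + 2"
      proof (rule ccontr)
        assume "\<not> M < N + 2"
        then have "strip_error c M < e / 2" using strip_error c by simp
        then have "\<bar>x - c / rho c\<bar> < e" using h(2) z(2) by linarith
        then show False using e2[OF T] by simp
      qed
      then show ?thesis using h(1) T by blast
    qed
  qed
  moreover have "finite ?fin" using finT finite_strip_values by auto
  moreover have "infinite (Z_spectrum \<inter> ball x (e / 2))"
    using lim e0 unfolding islimpt_eq_infinite_ball by simp
  ultimately show False using finite_subset by blast
qed

theorem theorem1:
  shows "(\<forall>m. markoff_number m \<longrightarrow>
            (2 * real m / (sqrt (9 * (real m)^2 - 4) + 3 * real m))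
              islimpt (Z_spectrum \<inter> {1/3<..}))
       \<and> (\<forall>x. x islimpt Z_spectrum \<and> x > 1/3 \<longrightarrow>
            (\<exists>m. markoff_number m \<and> x = 2 * real m / (sqrt (9 * (real m)^2 - 4) + 3 * real m)))"
proof (intro conjI allI impI)
  fix m assume "markoff_number m"
  then show "(2 * real m / (sqrt (9 * (real m)^2 - 4) + 3 * real m)) islimpt (Z_spectrum \<inter> {1/3<..})"
    by (rule markov_islimpt)
next
  fix x :: real assume "x islimpt Z_spectrum \<and> x > 1/3"
  then obtain \<sigma> \<tau> c where c: "markov_triple \<sigma> \<tau> c" "x = c / rho c" using spectrum_limit_point by blast
  obtain m where m: "markoff_number m" "c = real m" using markov_triple_markoff[OF c(1)] by blast
  have "x = 2 * real m / (sqrt (9 * (real m)^2 - 4) + 3 * real m)"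
    using c(2) rho_props(4)[OF markov_tripleD(3)[OF c(1)]] unfolding m(2) by simp
  then show "\<exists>m. markoff_number m \<and> x = 2 * real m / (sqrt (9 * (real m)^2 - 4) + 3 * real m)"
    using m(1) by blast
qed

end
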